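(* Let $n\ge2$, $Q=2n$, and let $0\le\alpha_1,\alpha_2<1/2$. There is a constant $C>0$ such that for every $N\in\mathbb N$, every $m:\mathbb R^2\to\mathbb C$ with $\operatorname{supp}m\subseteq[0,N]^2$, and every $z\in\mathbb S$, $$\Big(\int_{\mathbb S}\int_{\mathbb S}\big|\mathcal K^{bi}_{m(\sqrt{\mathcal L_1},\sqrt{\mathcal L_2})}(z,w,u)\,(1+N\varpi(z,w))^{\alpha_1}(1+N\varpi(z,u))^{\alpha_2}\big|^2\,d\sigma(w)\,d\sigma(u)\Big)^{1/2}\le C\,N^{Q}\,\|m(N\,\cdot,N\,\cdot)\|_{N,N,2}.$$
   Context: $\mathbb S=\{z\in\mathbb C^n:|z|=1\}$, $n\ge 2$, with its uniform (surface) measure $\sigma$; $\langle z,w\rangle=\sum_j z_j\bar w_j$; $\varpi(z,w)=(1-|\langle z,w\rangle|^2)^{1/2}$. For $\ell,\ell'\in\mathbb N_0$, $\mathcal H_{\ell,\ell'}$ is the (finite-dimensional) space of restrictions to $\mathbb S$ of harmonic polynomials on $\mathbb C^n$ homogeneous of bidegree $(\ell,\ell')$, i.e. $f(\lambda z)=\lambda^{\ell}\bar\lambda^{\ell'}f(z)$. For $w\in\mathbb S$, the zonal harmonic $Y_w^{\ell,\ell'}\in\mathcal H_{\ell,\ell'}$ is the unique element with $f(w)=\langle f,Y_w^{\ell,\ell'}\rangle_{L^2(\mathbb S)}$ for all $f\in\mathcal H_{\ell,\ell'}$. Put $\lambda_{\ell,\ell'}=4\ell\ell'+2(n-1)(\ell+\ell')$.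 The bilinear kernel is the (finite) sum $$\mathcal K^{bi}_{m(\sqrt{\mathcal L_1},\sqrt{\mathcal L_2})}(z,w,u)=\sum_{\ell_1,\ell_1',\ell_2,\ell_2'=0}^{\infty}m\big(\sqrt{\lambda_{\ell_1,\ell_1'}},\sqrt{\lambda_{\ell_2,\ell_2'}}\big)\,\overline{Y_z^{\ell_1,\ell_1'}(w)}\;\overline{Y_z^{\ell_2,\ell_2'}(u)}.$$ For $G:\mathbb R^2\to\mathbb C$ supported in $[0,1]^2$ and $N_1,N_2\in\mathbb N$, $$\|G\|_{N_1,N_2,2}=\Big(\frac1{N_1N_2}\sum_{i=1}^{N_1}\sum_{j=1}^{N_2}\ \sup_{\lambda_1\in[\frac{i-1}{N_1},\frac i{N_1}],\ \lambda_2\in[\frac{j-1}{N_2},\frac j{N_2}]}|G(\lambda_1,\lambda_2)|^2\Big)^{1/2}.$$ *)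

theory Defs
  imports "HOL-Analysis.Analysis"
begin

section \<open>The unit sphere\<close>

text \<open>
  Unnormalized surface measure on the unit sphere of a Euclidean space of dimension \<open>d\<close>:
  \<open>\<sigma> A\<close> is \<open>d\<close> times the Lebesgue measure of the cone \<open>{x. 0 < \<bar>x\<bar> < 1 \<and> x / \<bar>x\<bar> \<in> A}\<close>.
\<close>

definition surface_measure :: "'a::euclidean_space measure" where
  "surface_measure =
     scale_measure (of_nat DIM('a))
       (distr (restrict_space lborel (ball 0 1 - {0}))
              (restrict_space borel (sphere 0 1))
              (\<lambda>x. x /\<^sub>R norm x))"

definition cinner :: "complex ^ 'n::finite \<Rightarrow> complex ^ 'n \<Rightarrow> complex" where
  "cinner z w = (\<Sum>j\<in>UNIV. z $ j * cnj (w $ j))"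

definition varpi :: "complex ^ 'n::finite \<Rightarrow> complex ^ 'n \<Rightarrow> real" where
  "varpi z w = sqrt (1 - (cmod (cinner z w))\<^sup>2)"

section \<open>Complex spherical harmonics\<close>

definition dir_deriv :: "'a::euclidean_space \<Rightarrow> ('a \<Rightarrow> complex) \<Rightarrow> 'a \<Rightarrow> complex" where
  "dir_deriv b f x = vector_derivative (\<lambda>t. f (x + t *\<^sub>R b)) (at 0)"

definition laplacian :: "('a::euclidean_space \<Rightarrow> complex) \<Rightarrow> 'a \<Rightarrow> complex" where
  "laplacian f x = (\<Sum>b\<in>Basis. dir_deriv b (dir_deriv b f) x)"

text \<open>
  \<^const>\<open>polynomial_function\<close> refers to the real structure of \<open>\<complex>\<^sup>n\<close>, so these are the
  complex polynomials in \<open>z\<close> and its conjugate.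
\<close>

definition harmonic_poly :: "nat \<Rightarrow> nat \<Rightarrow> (complex ^ 'n::finite \<Rightarrow> complex) \<Rightarrow> bool" where
  "harmonic_poly l l' f \<longleftrightarrow>
     polynomial_function f \<and>
     (\<forall>z. laplacian f z = 0) \<and>
     (\<forall>c z. f (c *s z) = c ^ l * cnj c ^ l' * f z)"

text \<open>
  Functions on the sphere are represented extensionally (\<^const>\<open>undefined\<close> off the sphere), so that
  equality of such functions is equality on the sphere; the uniqueness of \<open>zonal\<close> relies on this.
\<close>

definition sph_harm :: "nat \<Rightarrow> nat \<Rightarrow> (complex ^ 'n::finite \<Rightarrow> complex) set" where
  "sph_harm l l' = {restrict f (sphere 0 1) | f. harmonic_poly l l' f}"

definition L2_inner ::
    "(complex ^ 'n::finite \<Rightarrow> complex) \<Rightarrow> (complex ^ 'n \<Rightarrow> complex) \<Rightarrow> complex" where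
  "L2_inner f g = (LINT x|surface_measure. f x * cnj (g x))"

definition zonal :: "nat \<Rightarrow> nat \<Rightarrow> complex ^ 'n::finite \<Rightarrow> complex ^ 'n \<Rightarrow> complex" where
  "zonal l l' w =
     (THE Y. Y \<in> sph_harm l l' \<and> (\<forall>f\<in>sph_harm l l'. f w = L2_inner f Y))"

section \<open>The bilinear kernel\<close>

definition eigval :: "nat \<Rightarrow> nat \<Rightarrow> nat \<Rightarrow> real" where
  "eigval n l l' = 4 * real l * real l' + 2 * (real n - 1) * (real l + real l')"

text \<open>
  For \<open>n \<ge> 2\<close> and \<open>m\<close> of bounded support only finitely many terms are nonzero, and the
  unordered sum is the finite sum of those.
\<close>

definition bi_kernel ::
    "(real \<times> real \<Rightarrow> complex) \<Rightarrow> complex ^ 'n::finite \<Rightarrow> complex ^ 'n \<Rightarrow> complex ^ 'n \<Rightarrow> complex" where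
  "bi_kernel m z w u =
     (\<Sum>\<^sub>\<infinity>(l1, l1', l2, l2')\<in>UNIV.
        m (sqrt (eigval CARD('n) l1 l1'), sqrt (eigval CARD('n) l2 l2'))
        * cnj (zonal l1 l1' z w) * cnj (zonal l2 l2' z u))"

section \<open>The norm of the multiplier\<close>

definition supp :: "(real \<times> real \<Rightarrow> complex) \<Rightarrow> (real \<times> real) set" where
  "supp m = closure {x. m x \<noteq> 0}"

text \<open>
  The multiplier is an arbitrary function, possibly unbounded, so the norm takes values in
  \<^typ>\<open>ennreal\<close>.
\<close>

definition ennreal_sqrt :: "ennreal \<Rightarrow> ennreal" where
  "ennreal_sqrt x = (if x = top then top else ennreal (sqrt (enn2real x)))"

definition grid_norm :: "nat \<Rightarrow> nat \<Rightarrow> (real \<times> real \<Rightarrow> complex) \<Rightarrow> ennreal" where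
  "grid_norm N1 N2 G =
     ennreal_sqrt
       (ennreal (1 / (real N1 * real N2)) *
        (\<Sum>i = 1..N1. \<Sum>j = 1..N2.
           SUP p \<in> {(real i - 1) / real N1 .. real i / real N1} \<times>
                   {(real j - 1) / real N2 .. real j / real N2}.
             ennreal ((cmod (G p))\<^sup>2)))"

end

theory Submission
  imports Defs
begin

text \<open>
  Write \<open>n\<close> for the complex dimension, \<open>x = \<langle>w, z\<rangle>\<close>, and let \<open>a \<le> b\<close> be the two entries of a bidegree
  \<open>(l, l')\<close> in increasing order. Since the weight is a product, the estimate reduces to one variable. For
  fixed \<open>z\<close> and a finite sum \<open>f = \<Sum> c\<^sub>E Z\<^sub>E\<close> of zonal harmonics the claim is
  \<open>\<integral> (1 + N \<varpi>)\<^sup>2\<^sup>\<alpha> \<bar>f\<bar>\<^sup>2 \<le> K \<Sum> \<bar>c\<^sub>E\<bar>\<^sup>2 V\<^sub>E\<close>, for explicit numbers \<open>V\<^sub>E\<close> whose sum over the bidegrees with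
  \<open>i - 1 \<le> \<surd>\<lambda>\<^sub>E \<le> i\<close> is at most a constant times \<open>N\<^bsup>2n - 1\<^esup>\<close> (\<open>weighted_Plancherel\<close> and
  \<open>window_sum_bound\<close>). Applying the claim in \<open>w\<close> and then in \<open>u\<close> bounds the double integral by
  \<open>\<Sum> \<bar>m\<bar>\<^sup>2 V\<^sub>E V\<^sub>E'\<close>. Summing over windows, with the supremum of \<open>\<bar>m\<bar>\<^sup>2\<close> over each cell, gives
  \<open>N\<^bsup>2(2n - 1)\<^esup>\<close> times \<open>N\<^sup>2\<close> times the square of the grid norm, which is the claimed \<open>N\<^bsup>2Q\<^esup>\<close>.

  The weighted estimate rests on the position of the mass of \<open>Z\<^sub>E\<close>. Multiplication by \<open>\<bar>x\<bar>\<^sup>2\<close> is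
  tridiagonal: it links \<open>(l, l')\<close> only to itself and to \<open>(l \<plusminus> 1, l' \<plusminus> 1)\<close>. So the quadratic form of
  \<open>\<varpi>\<^sup>2 = 1 - \<bar>x\<bar>\<^sup>2\<close> is dominated by twice its diagonal, and the diagonal coefficient is explicit and of
  size \<open>(a + 1) / (b + 1)\<close>. The fractional powers \<open>\<varpi>\<^sup>2\<^sup>\<alpha>\<close> follow by real interpolation: \<open>T\<^sup>\<alpha>\<close> is a
  dyadic sum of truncations \<open>min T 4\<^sup>j\<close>, and for each \<open>j\<close> the sum \<open>f\<close> is split according to whether
  \<open>a + 1 < 2\<^sup>j\<close>. The condition \<open>\<alpha> < 1/2\<close> enters when counting: a window has at most about
  \<open>i / (a + 1)\<close> elements for given \<open>a\<close>, each with \<open>V\<^sub>E\<close> at most a constant times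
  \<open>N\<^bsup>2n - 2\<^esup> (a + 1)\<^bsup>2\<alpha> - 1\<^esup>\<close>, and the series of the \<open>(a + 1)\<^bsup>2\<alpha> - 2\<^esup>\<close> converges for \<open>2\<alpha> < 1\<close>.

  The zonal harmonics themselves come from a single integral formula. Unitary invariance gives
  \<open>\<integral> \<bar>\<langle>w, v\<rangle>\<bar>\<^bsup>2P\<^esup> = M\<^sub>P \<bar>v\<bar>\<^bsup>2P\<^esup>\<close>, and polarization turns this into the integrals of
  \<open>\<langle>w, a\<rangle>\<^sup>l \<langle>b, w\<rangle>\<^sup>l\<^sup>' \<langle>z, w\<rangle>\<^sup>p \<langle>w, z\<rangle>\<^sup>q\<close>. A polynomial of bidegree \<open>(l, l')\<close> is a combination of
  the products \<open>\<langle>w, a\<rangle>\<^sup>l \<langle>b, w\<rangle>\<^sup>l\<^sup>'\<close>, and if it is harmonic, every term of the formula that contains the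
  factor \<open>\<langle>b, a\<rangle>\<close> cancels. What remains says that a harmonic \<open>f\<close> is orthogonal to
  \<open>x\<^sup>p (cnj x)\<^sup>q\<close> when \<open>p < l\<close> and \<open>p - q = l - l'\<close>, and that its inner product with
  \<open>x\<^sup>l (cnj x)\<^sup>l\<^sup>'\<close> is a known multiple of \<open>f z\<close> (\<open>L2_inner_bimonomial\<close>). Hence a harmonic polynomial in \<open>x\<close>,
  its conjugate and \<open>\<bar>w\<bar>\<^sup>2\<close> with the right leading coefficient reproduces \<open>f z\<close>, and must be the zonal
  harmonic. Its norm, its orthogonality relations and the diagonal of \<open>\<varpi>\<^sup>2\<close> use the same two facts.
\<close>

section \<open>The surface measure and its invariance\<close>

lemma distr_lborel_basis_bij:
  fixes \<beta> :: "'a::euclidean_space \<Rightarrow> 'b::euclidean_space"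
  assumes bij: "bij_betw \<beta> Basis Basis"
  shows "distr lborel borel (\<lambda>x. \<Sum>b\<in>Basis. (x \<bullet> b) *\<^sub>R \<beta> b) = lborel"
proof -
  define J where "J x = (\<Sum>b\<in>Basis. (x \<bullet> b) *\<^sub>R \<beta> b)" for x
  define J' where "J' y = (\<Sum>b\<in>Basis. (y \<bullet> \<beta> b) *\<^sub>R b)" for y
  have \<beta>B: "\<beta> b \<in> Basis" if "b \<in> Basis" for b using bij that by (auto simp: bij_betw_def)
  have inj: "\<beta> b = \<beta> c \<longleftrightarrow> b = c" if "b \<in> Basis" "c \<in> Basis" for b c
    using bij that by (auto simp: bij_betw_def inj_on_def)
  have JJ: "J x \<bullet> \<beta> b = x \<bullet> b" if "b \<in> Basis" for x b
    unfolding J_def using that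
    by (simp add: inner_sum_left inner_Basis \<beta>B inj if_distrib cong: if_cong)
  have J'J: "J' y \<bullet> b = y \<bullet> \<beta> b" if "b \<in> Basis" for y b
    unfolding J'_def using that
    by (simp add: inner_sum_left inner_Basis if_distrib cong: if_cong)
  have im: "Basis = \<beta> ` Basis" using bij by (auto simp: bij_betw_def)
  have vim: "J -` box l u = box (J' l) (J' u)" for l u
    unfolding box_def by (subst im) (auto simp: JJ J'J)
  have [measurable]: "J \<in> borel_measurable borel" unfolding J_def[abs_def] by measurable
  have "lborel = distr lborel borel J"
  proof (rule lborel_eqI)
    fix l u :: 'b assume le: "\<And>b. b \<in> Basis \<Longrightarrow> l \<bullet> b \<le> u \<bullet> b"
    have "emeasure (distr lborel borel J) (box l u) = emeasure lborel (box (J' l) (J' u))"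
      by (simp add: emeasure_distr vim)
    also have "\<dots> = (\<Prod>b\<in>Basis. (J' u - J' l) \<bullet> b)"
      using le by (subst emeasure_lborel_box) (auto simp: J'J \<beta>B)
    also have "(\<Prod>b\<in>Basis. (J' u - J' l) \<bullet> b) = (\<Prod>b\<in>Basis. (u - l) \<bullet> \<beta> b)"
      by (intro prod.cong refl) (simp add: inner_diff_left J'J)
    also have "\<dots> = (\<Prod>b\<in>Basis. (u - l) \<bullet> b)"
      using prod.reindex_bij_betw[OF bij, of "\<lambda>b. (u - l) \<bullet> b"] by simp
    finally show "emeasure (distr lborel borel J) (box l u) = (\<Prod>b\<in>Basis. (u - l) \<bullet> b)" .
  qed simp
  thus ?thesis unfolding J_def[abs_def] by simp
qed

lemma distr_lborel_orthogonal_cart: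
  fixes T :: "real ^ 'k::{finite,wellorder} \<Rightarrow> real ^ 'k::_"
  assumes T: "orthogonal_transformation T"
  shows "distr lborel borel T = lborel"
proof -
  have lin: "linear T" and bij: "bij T"
    using T orthogonal_transformation_linear orthogonal_transformation_bij by auto
  have iT: "orthogonal_transformation (inv T)" using T by (rule orthogonal_transformation_inv)
  have [measurable]: "T \<in> borel_measurable borel"
    using lin by (intro borel_measurable_continuous_onI linear_continuous_on linear_conv_bounded_linear[THEN iffD1])
  have "lborel = distr lborel borel T"
  proof (rule lborel_eqI)
    fix l u :: "real ^ 'k::_" assume le: "\<And>b. b \<in> Basis \<Longrightarrow> l \<bullet> b \<le> u \<bullet> b"
    have vim: "T -` box l u = inv T ` box l u" by (rule bij_vimage_eq_inv_image[OF bij])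
    have meas: "T -` box l u \<in> sets lborel" using measurable_sets[of T borel borel "box l u"] by simp
    have lm: "inv T ` box l u \<in> lmeasurable" "measure lebesgue (inv T ` box l u) = measure lebesgue (box l u)"
      using measurable_orthogonal_image[OF iT] measure_orthogonal_image[OF iT] by auto
    have "emeasure (distr lborel borel T) (box l u) = emeasure lborel (inv T ` box l u)"
      by (simp add: emeasure_distr vim)
    also have "\<dots> = emeasure lebesgue (inv T ` box l u)" using meas vim by simp
    also have "\<dots> = ennreal (measure lebesgue (box l u))"
      using lm by (simp add: emeasure_eq_measure2)
    also have "\<dots> = (\<Prod>b\<in>Basis. (u - l) \<bullet> b)"
      using le by (subst measure_completion) auto
    finally show "emeasure (distr lborel borel T) (box l u) = (\<Prod>b\<in>Basis. (u - l) \<bullet> b)" .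
  qed simp
  thus ?thesis by simp
qed

text \<open>
  Complex \<open>n\<close>-space is identified with real \<open>2n\<close>-space by matching the standard bases, which preserves
  Lebesgue measure; the type \<open>'n bit0\<close> has \<open>2n\<close> elements. Conjugating by this isometry
  reduces the claim to real coordinates, where it is a statement about determinants.
\<close>

lemma distr_lborel_orthogonal:
  fixes T :: "complex ^ 'n::finite \<Rightarrow> complex ^ 'n"
  assumes T: "orthogonal_transformation T"
  shows "distr lborel borel T = lborel"
proof -
  have "card (Basis :: (real ^ 'n bit0) set) = card (Basis :: (complex ^ 'n) set)" by simp
  then obtain \<beta> :: "real ^ 'n bit0 \<Rightarrow> complex ^ 'n" where bij: "bij_betw \<beta> Basis Basis"
    using finite_same_card_bij[OF finite_Basis finite_Basis] by blast
  define \<gamma> where "\<gamma> = the_inv_into Basis \<beta>"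
  have bij': "bij_betw \<gamma> Basis Basis" unfolding \<gamma>_def using bij by (rule bij_betw_the_inv_into)
  have gb: "\<gamma> (\<beta> b) = b" if "b \<in> Basis" for b
    unfolding \<gamma>_def using bij that by (auto simp: bij_betw_def the_inv_into_f_f)
  have bg: "\<beta> (\<gamma> b) = b" if "b \<in> Basis" for b
    unfolding \<gamma>_def using bij that by (auto simp: bij_betw_def intro!: f_the_inv_into_f)
  have \<beta>B: "\<beta> b \<in> Basis" if "b \<in> Basis" for b using bij that by (auto simp: bij_betw_def)
  have \<gamma>B: "\<gamma> b \<in> Basis" if "b \<in> Basis" for b using bij' that by (auto simp: bij_betw_def)
  define J where "J x = (\<Sum>b\<in>Basis. (x \<bullet> b) *\<^sub>R \<beta> b)" for x
  define K where "K x = (\<Sum>b\<in>Basis. (x \<bullet> b) *\<^sub>R \<gamma> b)" for x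
  have dJ: "distr lborel borel J = lborel" unfolding J_def[abs_def] by (rule distr_lborel_basis_bij[OF bij])
  have dK: "distr lborel borel K = lborel" unfolding K_def[abs_def] by (rule distr_lborel_basis_bij[OF bij'])
  have linJ: "linear J" unfolding J_def[abs_def]
    by (intro linear_compose_sum ballI linearI) (auto simp: inner_add_left scaleR_add_left)
  have linK: "linear K" unfolding K_def[abs_def]
    by (intro linear_compose_sum ballI linearI) (auto simp: inner_add_left scaleR_add_left)
  have Jb: "J b = \<beta> b" if "b \<in> Basis" for b
    unfolding J_def using that by (simp add: inner_Basis if_distrib[of "\<lambda>r. r *\<^sub>R _"] cong: if_cong)
  have Kb: "K b = \<gamma> b" if "b \<in> Basis" for b
    unfolding K_def using that by (simp add: inner_Basis if_distrib[of "\<lambda>r. r *\<^sub>R _"] cong: if_cong)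
  have JK: "J (K x) = x" for x
  proof -
    have "J \<circ> K = id"
      by (rule linear_eq_stdbasis) (auto intro: linear_compose linJ linK linear_id simp: Kb Jb \<gamma>B bg)
    thus ?thesis by (metis comp_apply id_apply)
  qed
  have normJ: "norm (J x) = norm x" for x
  proof -
    have "J x \<bullet> J x = (\<Sum>b\<in>Basis. (J x \<bullet> \<beta> b) * (J x \<bullet> \<beta> b))"
      by (subst euclidean_inner) (rule sum.reindex_bij_betw[OF bij, symmetric])
    also have "\<dots> = (\<Sum>b\<in>Basis. (x \<bullet> b) * (x \<bullet> b))"
    proof (intro sum.cong refl)
      fix b :: "real ^ 'n bit0" assume b: "b \<in> Basis"
      have "J x \<bullet> \<beta> b = (\<Sum>c\<in>Basis. (x \<bullet> c) * (if c = b then 1 else 0))"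
        unfolding J_def inner_sum_left inner_scaleR_left
        using b bij by (intro sum.cong refl) (auto simp: inner_Basis \<beta>B bij_betw_def inj_on_def)
      also have "\<dots> = x \<bullet> b" using b by (simp add: if_distrib cong: if_cong)
      finally show "J x \<bullet> \<beta> b * (J x \<bullet> \<beta> b) = (x \<bullet> b) * (x \<bullet> b)" by simp
    qed
    also have "\<dots> = x \<bullet> x" by (subst euclidean_inner[of x x]) simp
    finally show ?thesis by (simp add: norm_eq_sqrt_inner)
  qed
  have normK: "norm (K x) = norm x" for x using normJ[of "K x"] by (simp add: JK)
  define S where "S = K \<circ> T \<circ> J"
  have linT: "linear T" and normT: "\<And>x. norm (T x) = norm x"
    using T by (auto simp: orthogonal_transformation)
  have S: "orthogonal_transformation S"
    unfolding orthogonal_transformation S_def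
    by (auto intro!: linear_compose linJ linK linT simp: normK normT normJ)
  have dS: "distr lborel borel S = lborel" by (rule distr_lborel_orthogonal_cart[OF S])
  have meas: "f \<in> borel_measurable borel" if "linear f" for f :: "'c::euclidean_space \<Rightarrow> 'd::euclidean_space"
    using that by (intro borel_measurable_continuous_onI linear_continuous_on linear_conv_bounded_linear[THEN iffD1])
  have linS: "linear S" using S orthogonal_transformation_linear by auto
  note [measurable] = meas[OF linJ] meas[OF linK] meas[OF linS]
  have T_eq: "T = J \<circ> (S \<circ> K)" unfolding S_def by (auto simp: fun_eq_iff JK)
  have "distr lborel borel T = distr (distr (distr lborel borel K) borel S) borel J"
    by (simp add: T_eq distr_distr comp_assoc)
  also have "\<dots> = lborel" by (simp only: dK dS dJ)
  finally show ?thesis .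
qed

lemma space_surface_measure [simp]: "space surface_measure = sphere 0 1"
  unfolding surface_measure_def space_scale_measure by (simp add: space_restrict_space)

lemma sets_surface_measure: "sets surface_measure = sets (restrict_space borel (sphere 0 1))"
  by (simp add: surface_measure_def)

lemma radial_projection_measurable:
  "(\<lambda>x::'a::euclidean_space. x /\<^sub>R norm x)
     \<in> restrict_space lborel (ball 0 1 - {0}) \<rightarrow>\<^sub>M restrict_space borel (sphere 0 1)"
proof (rule measurable_restrict_space2)
  show "(\<lambda>x::'a. x /\<^sub>R norm x) \<in> space (restrict_space lborel (ball 0 1 - {0})) \<rightarrow> sphere 0 1"
    by (auto simp: space_restrict_space)
  have "(\<lambda>x::'a. x /\<^sub>R norm x) \<in> borel_measurable lborel" by measurable
  thus "(\<lambda>x::'a. x /\<^sub>R norm x) \<in> restrict_space lborel (ball 0 1 - {0}) \<rightarrow>\<^sub>M borel"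
    by (rule measurable_restrict_space1)
qed

lemma emeasure_surface_measure:
  fixes A :: "'a::euclidean_space set"
  assumes A: "A \<in> sets surface_measure"
  shows "emeasure surface_measure A =
           of_nat DIM('a) * emeasure lborel {x \<in> ball 0 1 - {0}. x /\<^sub>R norm x \<in> A}"
proof -
  let ?M = "restrict_space lborel (ball (0::'a) 1 - {0})"
  have vim: "(\<lambda>x. x /\<^sub>R norm x) -` A \<inter> space ?M = {x \<in> ball 0 1 - {0}. x /\<^sub>R norm x \<in> A}"
    by (auto simp: space_restrict_space)
  have A': "A \<in> sets (restrict_space borel (sphere 0 1))" using A by (simp add: sets_surface_measure)
  have "emeasure surface_measure A = of_nat DIM('a) * emeasure ?M ((\<lambda>x. x /\<^sub>R norm x) -` A \<inter> space ?M)"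
    unfolding surface_measure_def emeasure_scale_measure emeasure_distr[OF radial_projection_measurable A'] ..
  also have "emeasure ?M ((\<lambda>x. x /\<^sub>R norm x) -` A \<inter> space ?M)
      = emeasure lborel {x \<in> ball 0 1 - {0}. x /\<^sub>R norm x \<in> A}"
    unfolding vim by (rule emeasure_restrict_space) auto
  finally show ?thesis .
qed

lemma emeasure_surface_measure_sphere:
  "emeasure surface_measure (sphere 0 1 :: 'a::euclidean_space set) = of_nat DIM('a) * emeasure lborel (ball 0 1 :: 'a set)"
proof -
  have "sphere 0 1 \<in> sets (surface_measure :: 'a measure)"
    using sets.top[of "surface_measure :: 'a measure"] by simp
  moreover have "{x \<in> ball 0 1 - {0}. x /\<^sub>R norm x \<in> sphere 0 1} = ball (0::'a) 1 - {0}" by auto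
  moreover have "emeasure lborel (ball (0::'a) 1 - {0}) = emeasure lborel (ball (0::'a) 1)"
    by (rule emeasure_Diff_null_set) (auto simp: null_sets_def)
  ultimately show ?thesis by (simp add: emeasure_surface_measure)
qed

lemma finite_measure_surface_measure: "finite_measure (surface_measure :: 'a::euclidean_space measure)"
  by (rule finite_measureI)
     (use emeasure_lborel_ball_finite[of "0::'a" 1] in
        \<open>auto simp: emeasure_surface_measure_sphere ennreal_mult_eq_top_iff less_top[symmetric]\<close>)

lemma measure_surface_measure_pos: "measure (surface_measure :: 'a::euclidean_space measure) (sphere 0 1) > 0"
proof -
  interpret finite_measure "surface_measure :: 'a measure" by (rule finite_measure_surface_measure)
  have "emeasure lborel (ball 0 1 :: 'a set) > 0"
    using content_ball_pos[of 1 "0::'a"] by (simp add: emeasure_ball)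
  hence "emeasure surface_measure (sphere 0 1 :: 'a set) > 0"
    by (simp add: emeasure_surface_measure_sphere ennreal_zero_less_mult_iff)
  thus ?thesis by (simp add: emeasure_eq_measure)
qed

lemma integrable_surface_measure:
  fixes f :: "'a::euclidean_space \<Rightarrow> 'b::{banach, second_countable_topology}"
  assumes "continuous_on (sphere 0 1) f"
  shows "integrable surface_measure f"
proof -
  interpret finite_measure "surface_measure :: 'a measure" by (rule finite_measure_surface_measure)
  have "bounded (f ` sphere 0 1)"
    using assms compact_continuous_image compact_imp_bounded compact_sphere by blast
  then obtain B where "\<forall>x\<in>sphere 0 1. norm (f x) \<le> B" unfolding bounded_iff by blast
  hence B: "norm (f x) \<le> B" if "x \<in> sphere 0 1" for x using that by blast
  show ?thesis
  proof (rule integrable_const_bound)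
    show "AE x in surface_measure. norm (f x) \<le> B" by (rule AE_I2) (use B in auto)
    show "f \<in> borel_measurable surface_measure"
      using borel_measurable_continuous_on_restrict[OF assms]
      by (simp cong: measurable_cong_sets add: sets_surface_measure)
  qed
qed

text \<open>
  A linear isometry commutes with the radial projection and maps the punctured unit ball to itself, so
  invariance of Lebesgue measure passes to the sphere.
\<close>

lemma distr_surface_measure_orthogonal:
  fixes T :: "complex ^ 'n::finite \<Rightarrow> complex ^ 'n"
  assumes T: "orthogonal_transformation T"
  shows "T \<in> surface_measure \<rightarrow>\<^sub>M surface_measure"
    and "distr surface_measure surface_measure T = surface_measure"
proof -
  have lin: "linear T" and nrm: "\<And>x. norm (T x) = norm x"
    using T by (auto simp: orthogonal_transformation)
  have mT: "T \<in> borel_measurable borel"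
    using lin by (intro borel_measurable_continuous_onI linear_continuous_on linear_conv_bounded_linear[THEN iffD1])
  have "T \<in> restrict_space borel (sphere 0 1) \<rightarrow>\<^sub>M restrict_space borel (sphere 0 1)"
    by (rule measurable_restrict_space2)
       (auto simp: space_restrict_space nrm intro!: measurable_restrict_space1 mT)
  thus meas: "T \<in> surface_measure \<rightarrow>\<^sub>M surface_measure"
    by (simp cong: measurable_cong_sets add: sets_surface_measure)
  show "distr surface_measure surface_measure T = surface_measure"
  proof (rule measure_eqI)
    fix A :: "(complex ^ 'n) set" assume "A \<in> sets (distr surface_measure surface_measure T)"
    hence A: "A \<in> sets surface_measure" by simp
    have A': "T -` A \<inter> sphere 0 1 \<in> sets surface_measure"
      using measurable_sets[OF meas A] by simp
    let ?B = "\<lambda>A. {x \<in> ball 0 1 - {0}. x /\<^sub>R norm x \<in> A}"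
    have T0: "T x = 0 \<longleftrightarrow> x = 0" for x using nrm[of x] by (metis norm_eq_zero)
    have eq: "?B (T -` A \<inter> sphere 0 1) = T -` ?B A"
      by (auto simp: nrm T0 linear_cmul[OF lin])
    have meas': "?B A \<in> sets lborel"
    proof -
      have "(\<lambda>x. x /\<^sub>R norm x) -` A \<inter> space (restrict_space lborel (ball 0 1 - {0}))
              \<in> sets (restrict_space lborel (ball 0 1 - {0}))"
        using A by (intro measurable_sets[OF radial_projection_measurable]) (simp add: sets_surface_measure)
      moreover have "(\<lambda>x. x /\<^sub>R norm x) -` A \<inter> space (restrict_space lborel (ball 0 1 - {0})) = ?B A"
        by (auto simp: space_restrict_space)
      ultimately show ?thesis by (simp add: sets_restrict_space_iff)
    qed
    have "emeasure lborel (T -` ?B A) = emeasure (distr lborel borel T) (?B A)"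
      using mT meas' by (subst emeasure_distr) auto
    also have "\<dots> = emeasure lborel (?B A)" by (simp add: distr_lborel_orthogonal[OF T])
    finally have "emeasure lborel (?B (T -` A \<inter> sphere 0 1)) = emeasure lborel (?B A)"
      by (simp only: eq)
    thus "emeasure (distr surface_measure surface_measure T) A = emeasure surface_measure A"
      using A A' by (simp add: emeasure_distr[OF meas] emeasure_surface_measure[OF A] emeasure_surface_measure[OF A'])
  qed simp
qed

lemma integral_surface_measure_orthogonal:
  fixes T :: "complex ^ 'n::finite \<Rightarrow> complex ^ 'n" and f :: "complex ^ 'n \<Rightarrow> complex"
  assumes T: "orthogonal_transformation T" and f: "continuous_on (sphere 0 1) f"
  shows "(LINT x|surface_measure. f (T x)) = (LINT x|surface_measure. f x)"
proof -
  have "(LINT x|surface_measure. f x) = (LINT x|distr surface_measure surface_measure T. f x)"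
    by (simp add: distr_surface_measure_orthogonal[OF T])
  also have "\<dots> = (LINT x|surface_measure. f (T x))"
    by (rule integral_distr[OF distr_surface_measure_orthogonal(1)[OF T]])
       (use integrable_surface_measure[OF f] in auto)
  finally show ?thesis by simp
qed

section \<open>Moments of linear forms on the sphere\<close>

lemma cinner_add_left: "cinner (x + y) z = cinner x z + cinner y z"
  by (simp add: cinner_def sum.distrib algebra_simps)

lemma cinner_add_right: "cinner x (y + z) = cinner x y + cinner x z"
  by (simp add: cinner_def sum.distrib algebra_simps)

lemma cinner_scale_left: "cinner (c *s x) z = c * cinner x z"
  by (simp add: cinner_def sum_distrib_left algebra_simps)

lemma cinner_scale_right: "cinner x (c *s z) = cnj c * cinner x z"
  by (simp add: cinner_def sum_distrib_left algebra_simps)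

lemma cinner_scaleR_left: "cinner (c *\<^sub>R x) z = of_real c * cinner x z"
  by (simp add: cinner_def sum_distrib_left scaleR_conv_of_real[where 'a=complex] algebra_simps)

lemma cinner_scaleR_right: "cinner x (c *\<^sub>R z) = of_real c * cinner x z"
  by (simp add: cinner_def sum_distrib_left scaleR_conv_of_real[where 'a=complex] algebra_simps)

lemma cinner_diff_left: "cinner (x - y) z = cinner x z - cinner y z"
  by (simp add: cinner_def sum_subtractf algebra_simps)

lemma cinner_diff_right: "cinner x (y - z) = cinner x y - cinner x z"
  by (simp add: cinner_def sum_subtractf algebra_simps)

lemma cnj_cinner: "cnj (cinner x y) = cinner y x"
  by (simp add: cinner_def mult.commute)

lemma inner_eq_Re_cinner: "x \<bullet> y = Re (cinner x y)"
  by (simp add: inner_vec_def cinner_def inner_complex_def)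

lemma cinner_self: "cinner x x = of_real ((norm x)\<^sup>2)"
  by (auto simp: complex_eq_iff power2_norm_eq_inner inner_eq_Re_cinner)
     (simp add: cinner_def)

lemma continuous_on_cinner [continuous_intros]:
  "continuous_on S f \<Longrightarrow> continuous_on S g \<Longrightarrow> continuous_on S (\<lambda>w. cinner (f w) (g w))"
  unfolding cinner_def by (intro continuous_intros)

text \<open>
  The map is a complex Householder reflection. It exchanges \<open>u\<close> with \<open>v\<close> times a phase, chosen so that the
  inner product of the two is real and nonnegative; hence the factor \<open>\<omega>\<close>, which cancels in
  \<open>\<bar>\<langle>w, v\<rangle>\<bar>\<close>.
\<close>

lemma unitary_transitive:
  fixes u v :: "complex ^ 'n::finite"
  assumes uv: "norm u = norm v"
  shows "\<exists>T \<omega>. orthogonal_transformation T \<and> cmod \<omega> = 1 \<and> (\<forall>w. cinner (T w) v = \<omega> * cinner w u)"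
proof -
  define c where "c = cinner u v"
  define \<omega> where "\<omega> = (if c = 0 then 1 else sgn c)"
  have \<omega>: "cmod \<omega> = 1" "cnj \<omega> * \<omega> = 1" "cnj \<omega> * c = of_real (cmod c)"
  proof -
    have cc: "c * cnj c = of_real (cmod c) * of_real (cmod c)"
      by (metis complex_norm_square of_real_mult power2_eq_square)
    show "cmod \<omega> = 1" by (simp add: \<omega>_def norm_sgn)
    show "cnj \<omega> * \<omega> = 1" "cnj \<omega> * c = of_real (cmod c)"
      using cc by (auto simp: \<omega>_def sgn_eq field_simps)
  qed
  define v' where "v' = \<omega> *s v"
  have v'v: "cinner w v' = cnj \<omega> * cinner w v" for w by (simp add: v'_def cinner_scale_right)
  hence vv': "cinner w v = \<omega> * cinner w v'" for w using \<omega>(2) by (simp add: mult.assoc[symmetric] mult.commute)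
  have v'v': "cinner v' v' = cinner u u"
  proof -
    have "cinner v' v' = (cnj \<omega> * \<omega>) * cinner v v"
      unfolding v'_def cinner_scale_left cinner_scale_right by (simp only: mult_ac)
    thus ?thesis by (simp add: \<omega>(2) cinner_self uv)
  qed
  have uv': "cinner u v' = of_real (cmod c)" using \<omega>(3) by (simp add: v'v c_def)
  have v'u: "cinner v' u = of_real (cmod c)" using uv' cnj_cinner[of u v'] by simp
  define q where "q = u - v'"
  show ?thesis
  proof (cases "q = 0")
    case True
    hence "u = v'" by (simp add: q_def)
    thus ?thesis using vv' \<omega>(1)
      by (intro exI[of _ "\<lambda>x. x"] exI[of _ \<omega>]) auto
  next
    case False
    define Q where "Q = cinner q q"
    have Q0: "Q \<noteq> 0" using False by (simp add: Q_def cinner_self)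
    have Qr: "cnj Q = Q" unfolding Q_def by (rule cnj_cinner)
    define T where "T w = w - (2 * cinner w q / Q) *s q" for w
    have Qeq: "Q = 2 * (cinner u u - of_real (cmod c))"
      by (simp add: Q_def q_def cinner_diff_left cinner_diff_right uv' v'u v'v')
    have qv': "cinner q v' = - Q / 2"
      by (simp add: Qeq) (simp add: q_def cinner_diff_left uv' v'v')
    have Tv: "cinner (T w) v' = cinner w u" for w
    proof -
      have "cinner (T w) v' = cinner w v' + cinner w q"
        using Q0 by (simp add: T_def cinner_diff_left cinner_scale_left qv')
      also have "\<dots> = cinner w u" by (simp add: q_def cinner_diff_right)
      finally show ?thesis .
    qed
    have nT: "cinner (T w) (T w) = cinner w w" for w
    proof -
      have "cinner (T w) (T w) = cinner w w - cnj (2 * cinner w q / Q) * cinner w q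
          - (2 * cinner w q / Q) * cinner q w + (2 * cinner w q / Q) * cnj (2 * cinner w q / Q) * Q"
        by (simp add: T_def cinner_diff_left cinner_diff_right cinner_scale_left cinner_scale_right Q_def algebra_simps)
      also have "\<dots> = cinner w w"
        using Q0 by (simp add: Qr cnj_cinner field_simps)
      finally show ?thesis .
    qed
    have normT: "norm (T w) = norm w" for w
    proof -
      have "of_real ((norm (T w))\<^sup>2) = (of_real ((norm w)\<^sup>2) :: complex)"
        using nT[of w] unfolding cinner_self .
      hence "(norm (T w))\<^sup>2 = (norm w)\<^sup>2" unfolding of_real_eq_iff .
      thus ?thesis by simp
    qed
    have linT: "linear T"
    proof (rule linearI)
      show "T (x + y) = T x + T y" for x y
        by (simp add: T_def cinner_add_left vec_eq_iff ring_distribs add_divide_distrib)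
      show "T (r *\<^sub>R x) = r *\<^sub>R T x" for r x
        by (simp add: T_def cinner_scaleR_left vec_eq_iff scaleR_conv_of_real[where 'a=complex] algebra_simps)
    qed
    have "cinner (T w) v = \<omega> * cinner w u" for w by (simp add: vv' Tv)
    thus ?thesis using linT normT \<omega>(1) unfolding orthogonal_transformation by blast
  qed
qed

text \<open>
  By unitary invariance every unit vector gives the same value; a coordinate axis is chosen.
\<close>

definition moment :: "'n::finite itself \<Rightarrow> nat \<Rightarrow> complex" where
  "moment _ P = (LINT w|surface_measure.
      (cinner w (axis undefined 1 :: complex ^ 'n) * cinner (axis undefined 1) w) ^ P)"

lemma integral_diagonal_form:
  fixes v :: "complex ^ 'n::finite"
  shows "(LINT w|surface_measure. (cinner w v * cinner v w) ^ P) = moment TYPE('n) P * cinner v v ^ P"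
proof -
  define e where "e = (axis undefined 1 :: complex ^ 'n)"
  define u where "u = norm v *\<^sub>R e"
  have "norm e = 1" by (simp add: e_def norm_axis_1)
  hence "norm u = norm v" by (simp add: u_def)
  then obtain T \<omega> where T: "orthogonal_transformation T" "cmod \<omega> = 1"
      "\<And>w. cinner (T w) v = \<omega> * cinner w u"
    using unitary_transitive by blast
  have Tc: "cinner v (T w) = cnj \<omega> * cinner u w" for w
    using T(3)[of w] by (metis cnj_cinner complex_cnj_mult)
  have \<omega>: "\<omega> * cnj \<omega> = 1" using T(2) by (simp add: complex_norm_square[symmetric])
  have "(LINT w|surface_measure. (cinner w v * cinner v w) ^ P)
      = (LINT w|surface_measure. (cinner (T w) v * cinner v (T w)) ^ P)"
    by (rule integral_surface_measure_orthogonal[OF T(1), symmetric]) (intro continuous_intros)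
  also have "(\<lambda>w. (cinner (T w) v * cinner v (T w)) ^ P)
      = (\<lambda>w. of_real ((norm v)\<^sup>2) ^ P * (cinner w e * cinner e w) ^ P)"
  proof
    fix w
    have "cinner (T w) v * cinner v (T w) = (\<omega> * cnj \<omega>) * (cinner w u * cinner u w)"
      by (simp add: T(3) Tc)
    also have "\<dots> = of_real ((norm v)\<^sup>2) * (cinner w e * cinner e w)"
      by (simp add: \<omega> u_def cinner_scaleR_left cinner_scaleR_right power2_eq_square)
    finally show "(cinner (T w) v * cinner v (T w)) ^ P
      = of_real ((norm v)\<^sup>2) ^ P * (cinner w e * cinner e w) ^ P" by (simp only: power_mult_distrib)
  qed
  also have "(LINT w|surface_measure. of_real ((norm v)\<^sup>2) ^ P * (cinner w e * cinner e w) ^ P)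
      = of_real ((norm v)\<^sup>2) ^ P * (LINT w|surface_measure. (cinner w e * cinner e w) ^ P)"
    by (rule integral_mult_right_zero)
  finally show ?thesis by (simp add: moment_def e_def[symmetric] cinner_self mult.commute)
qed

lemma infinite_unit_circle: "infinite {s::complex. cmod s = 1}"
proof
  assume fin: "finite {s::complex. cmod s = 1}"
  have "inj_on cis {0<..<pi}"
    by (rule inj_onI) (auto simp: complex_eq_iff intro: cos_inj_pi)
  moreover have "cis ` {0<..<pi} \<subseteq> {s. cmod s = 1}" by auto
  ultimately have "finite {0<..<pi}" using fin by (meson finite_imageD finite_subset)
  thus False using pi_gt_zero infinite_Ioo by blast
qed

lemma coeff_power_top:
  fixes q :: "'a::comm_ring_1 poly"
  assumes "degree q \<le> d"
  shows "coeff (q ^ P) (d * P) = coeff q d ^ P"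
proof (induction P)
  case (Suc P)
  have dP: "degree (q ^ P) \<le> d * P"
    using degree_power_le[of q P] assms by (meson le_trans mult_le_mono1)
  have "coeff (q ^ Suc P) (d * Suc P) = (\<Sum>i\<le>d + d * P. coeff q i * coeff (q ^ P) (d + d * P - i))"
    by (simp add: coeff_mult)
  also have "\<dots> = (\<Sum>i\<in>{d}. coeff q i * coeff (q ^ P) (d + d * P - i))"
  proof (rule sum.mono_neutral_right)
    show "\<forall>i\<in>{..d + d * P} - {d}. coeff q i * coeff (q ^ P) (d + d * P - i) = 0"
    proof
      fix i assume "i \<in> {..d + d * P} - {d}"
      hence "i > d \<or> d + d * P - i > d * P" by auto
      thus "coeff q i * coeff (q ^ P) (d + d * P - i) = 0"
        using assms dP coeff_eq_0[of q i] coeff_eq_0[of "q ^ P" "d + d * P - i"] by auto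
    qed
  qed auto
  finally show ?case using Suc by simp
qed simp

lemma poly_eq_sum_coeff:
  fixes x :: "'a::{comm_semiring_0,semiring_1}"
  assumes "degree p \<le> d"
  shows "poly p x = (\<Sum>i\<le>d. coeff p i * x ^ i)"
  unfolding poly_altdef using assms
  by (intro sum.mono_neutral_left) (auto simp: coeff_eq_0)

lemma coeff_linear_power:
  fixes a b :: "'a::comm_semiring_1"
  shows "coeff ([:a, b:] ^ n) i = of_nat (n choose i) * b ^ i * a ^ (n - i)"
proof (cases "i \<le> n")
  case False
  have "degree ([:a, b:] ^ n) \<le> degree [:a, b:] * n" by (rule degree_power_le)
  also have "\<dots> \<le> n" by (simp add: degree_pCons_eq_if)
  finally show ?thesis using False by (simp add: coeff_eq_0 binomial_eq_0)
qed (rule coeff_linear_poly_power)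

text \<open>
  The unit circle is infinite, so a polynomial identity on it determines all coefficients. This is the tool
  for polarization: on the circle the conjugate of \<open>s\<close> can be eliminated by multiplying with \<open>s\<close>.
\<close>

lemma integral_coeff_eq:
  fixes q :: "'a \<Rightarrow> complex poly" and r :: "complex poly"
  assumes deg: "\<And>w. degree (q w) \<le> d" and int: "\<And>i. integrable M (\<lambda>w. coeff (q w) i)"
    and eq: "\<And>s. cmod s = 1 \<Longrightarrow> (LINT w|M. poly (q w) s) = poly r s"
  shows "(LINT w|M. coeff (q w) i) = coeff r i"
proof -
  define p where "p = (\<Sum>i\<le>d. monom (LINT w|M. coeff (q w) i) i)"
  have coeff_p: "coeff p i = (LINT w|M. coeff (q w) i)" for i
  proof (cases "i \<le> d")
    case False
    hence "coeff (q w) i = 0" for w using deg[of w] by (intro coeff_eq_0) auto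
    thus ?thesis using False by (simp add: p_def coeff_sum)
  qed (simp add: p_def coeff_sum)
  have "poly p s = poly r s" if "cmod s = 1" for s
  proof -
    have "poly (q w) s = (\<Sum>i\<le>d. coeff (q w) i * s ^ i)" for w
      using deg[of w] by (rule poly_eq_sum_coeff)
    hence "(LINT w|M. poly (q w) s) = (\<Sum>i\<le>d. (LINT w|M. coeff (q w) i) * s ^ i)"
      by (simp add: int)
    thus ?thesis using eq[OF that] by (simp add: p_def poly_sum poly_monom)
  qed
  hence "{s. cmod s = 1} \<subseteq> {s. poly (p - r) s = 0}" by auto
  hence "p - r = 0" using infinite_unit_circle poly_roots_finite[of "p - r"] finite_subset by blast
  thus ?thesis by (simp add: coeff_p[symmetric])
qed

lemma continuous_on_coeff_power:
  fixes q :: "'a::topological_space \<Rightarrow> 'b::real_normed_field poly"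
  assumes "\<And>i. continuous_on S (\<lambda>w. coeff (q w) i)"
  shows "continuous_on S (\<lambda>w. coeff (q w ^ P) i)"
  by (induction P arbitrary: i) (auto simp: coeff_mult intro!: continuous_intros assms)

text \<open>
  Insert \<open>v = a + s b\<close> with \<open>\<bar>s\<bar> = 1\<close> into the diagonal formula and multiply by \<open>s\<^sup>P\<close>. Both sides are then
  \<open>P\<close>-th powers of quadratic polynomials in \<open>s\<close>, and the claim is the equality of their leading
  coefficients.
\<close>

lemma integral_polarized_form:
  fixes a b :: "complex ^ 'n::finite"
  shows "(LINT w|surface_measure. (cinner w a * cinner b w) ^ P) = moment TYPE('n) P * cinner b a ^ P"
proof -
  define q where "q w = [:cinner w b * cinner a w, cinner w a * cinner a w + cinner w b * cinner b w,
      cinner w a * cinner b w:]" for w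
  define r where "r = [:cinner a b, cinner a a + cinner b b, cinner b a:]"
  have cq: "continuous_on (sphere 0 1) (\<lambda>w. coeff (q w) i)" for i
  proof -
    have "coeff (q w) i = (if i = 0 then cinner w b * cinner a w
        else if i = 1 then cinner w a * cinner a w + cinner w b * cinner b w
        else if i = 2 then cinner w a * cinner b w else 0)" for w
      by (auto simp: q_def coeff_pCons numeral_2_eq_2 split: nat.split)
    thus ?thesis
      by (cases "i = 0"; cases "i = 1"; cases "i = 2") (simp_all, (intro continuous_intros)+)
  qed
  have dq: "degree (q w) \<le> 2" for w by (simp add: q_def)
  have dq': "degree (q w ^ P) \<le> 2 * P" for w
    using degree_power_le[of "q w" P] dq[of w] by (meson le_trans mult_le_mono1)
  have "(LINT w|surface_measure. coeff (q w ^ P) (2 * P)) = coeff (smult (moment TYPE('n) P) (r ^ P)) (2 * P)"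
  proof (rule integral_coeff_eq[OF dq'])
    show "integrable surface_measure (\<lambda>w. coeff (q w ^ P) i)" for i
      by (intro integrable_surface_measure continuous_on_coeff_power cq)
    fix s :: complex assume s: "cmod s = 1"
    hence ss: "s * cnj s = 1" by (simp add: complex_norm_square[symmetric])
    define v where "v = a + s *s b"
    have eq: "poly (q w) s = s * (cinner w v * cinner v w)" for w
    proof -
      have "s * (cinner w v * cinner v w) = (s * cinner w a + (s * cnj s) * cinner w b) * (cinner a w + s * cinner b w)"
        by (simp add: v_def cinner_add_left cinner_add_right cinner_scale_left cinner_scale_right algebra_simps)
      also have "\<dots> = poly (q w) s" by (simp add: ss q_def algebra_simps)
      finally show ?thesis by simp
    qed
    have eqr: "poly r s = s * cinner v v"
    proof -
      have "s * cinner v v = s * cinner a a + s * s * cinner b a + (s * cnj s) * cinner a b + (s * cnj s) * s * cinner b b"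
        by (simp add: v_def cinner_add_left cinner_add_right cinner_scale_left cinner_scale_right algebra_simps)
      also have "\<dots> = poly r s" by (simp add: ss r_def algebra_simps)
      finally show ?thesis by simp
    qed
    show "(LINT w|surface_measure. poly (q w ^ P) s) = poly (smult (moment TYPE('n) P) (r ^ P)) s"
      by (simp add: poly_power eq eqr power_mult_distrib[of s] integral_diagonal_form)
  qed
  moreover have "coeff (q w ^ P) (2 * P) = (cinner w a * cinner b w) ^ P" for w
    by (subst coeff_power_top[OF dq]) (simp add: q_def numeral_2_eq_2)
  moreover have "coeff (r ^ P) (2 * P) = cinner b a ^ P"
    by (subst coeff_power_top) (simp_all add: r_def numeral_2_eq_2)
  ultimately show ?thesis by simp
qed

text \<open>
  Replace \<open>a\<close> and \<open>b\<close> in the polarized formula by \<open>a + s z\<close> and \<open>b + t z\<close> and extract the coefficient of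
  the appropriate monomial in the conjugate of \<open>s\<close> and in \<open>t\<close>. The right-hand side is the coefficient of
  \<open>t\<^sup>p\<close> in \<open>(\<langle>b, a\<rangle> + t \<langle>z, a\<rangle>)\<^sup>l (\<langle>b, z\<rangle> + t)\<^sup>q\<close>.
\<close>

lemma integral_mixed_form:
  fixes a b z :: "complex ^ 'n::finite"
  assumes z: "norm z = 1" and P: "l + q = P" "l' + p = P"
  shows "of_nat (P choose p) *
      (LINT w|surface_measure. cinner w a ^ l * cinner w z ^ q * cinner b w ^ l' * cinner z w ^ p)
    = moment TYPE('n) P * (\<Sum>k\<le>p. of_nat (l choose k) * of_nat (q choose (p - k)) *
        cinner b a ^ (l - k) * cinner z a ^ k * cinner b z ^ (q - (p - k)))"
proof -
  define M where "M = moment TYPE('n) P"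
  have zz: "cinner z z = 1" using z by (simp add: cinner_self)
  have step1: "(LINT w|surface_measure. cinner w a ^ l * cinner w z ^ q * (cinner b w + t * cinner z w) ^ P)
      = M * (cinner b a + t * cinner z a) ^ l * (cinner b z + t) ^ q" for t
  proof -
    define c where "c i = (LINT w|surface_measure. cinner w a ^ (P - i) * cinner w z ^ i * (cinner b w + t * cinner z w) ^ P)" for i
    define d where "d i = M * (cinner b a + t * cinner z a) ^ (P - i) * (cinner b z + t) ^ i" for i
    have "(\<Sum>i\<le>P. (of_nat (P choose i) * c i) * s ^ i) = (\<Sum>i\<le>P. (of_nat (P choose i) * d i) * s ^ i)" for s
    proof -
      have "(\<Sum>i\<le>P. (of_nat (P choose i) * c i) * s ^ i)
          = (LINT w|surface_measure. (\<Sum>i\<le>P. of_nat (P choose i) * s ^ i *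
               (cinner w a ^ (P - i) * cinner w z ^ i * (cinner b w + t * cinner z w) ^ P)))"
        unfolding c_def
        by (subst Bochner_Integration.integral_sum)
           (auto intro!: integrable_surface_measure continuous_intros sum.cong)
      also have "\<dots> = (LINT w|surface_measure. (cinner w (a + cnj s *s z) * cinner (b + t *s z) w) ^ P)"
      proof (rule Bochner_Integration.integral_cong[OF refl])
        fix w
        have "(cinner w (a + cnj s *s z) * cinner (b + t *s z) w) ^ P
            = (s * cinner w z + cinner w a) ^ P * (cinner b w + t * cinner z w) ^ P"
          by (simp add: cinner_add_left cinner_add_right cinner_scale_left cinner_scale_right power_mult_distrib add.commute)
        also have "(s * cinner w z + cinner w a) ^ P
            = (\<Sum>i\<le>P. of_nat (P choose i) * s ^ i * cinner w z ^ i * cinner w a ^ (P - i))"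
          by (subst binomial_ring) (simp add: power_mult_distrib mult.assoc)
        finally show "(\<Sum>i\<le>P. of_nat (P choose i) * s ^ i *
               (cinner w a ^ (P - i) * cinner w z ^ i * (cinner b w + t * cinner z w) ^ P))
            = (cinner w (a + cnj s *s z) * cinner (b + t *s z) w) ^ P"
          by (simp only: sum_distrib_right) (intro sum.cong refl, simp only: mult_ac)
      qed
      also have "\<dots> = M * ((s * (cinner b z + t)) + (cinner b a + t * cinner z a)) ^ P"
        unfolding integral_polarized_form M_def
        by (simp add: cinner_add_left cinner_add_right cinner_scale_left cinner_scale_right zz algebra_simps)
      also have "\<dots> = (\<Sum>i\<le>P. (of_nat (P choose i) * d i) * s ^ i)"
        unfolding d_def by (subst binomial_ring)
          (simp only: sum_distrib_left power_mult_distrib, intro sum.cong refl, simp only: mult_ac)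
      finally show ?thesis .
    qed
    hence "\<forall>i\<le>P. of_nat (P choose i) * c i = of_nat (P choose i) * d i"
      by (intro polyfun_eq_coeffs[THEN iffD1] allI)
    moreover have "q \<le> P" using P by simp
    ultimately have "of_nat (P choose q) * c q = of_nat (P choose q) * d q" by blast
    hence "c q = d q" using \<open>q \<le> P\<close> by simp
    moreover have "P - q = l" using P by simp
    ultimately show ?thesis by (simp add: c_def d_def)
  qed
  define c where "c i = (LINT w|surface_measure. cinner w a ^ l * cinner w z ^ q * cinner b w ^ (P - i) * cinner z w ^ i)" for i
  define R where "R = smult M ([:cinner b a, cinner z a:] ^ l * [:cinner b z, 1:] ^ q)"
  have dR: "degree R \<le> P"
  proof -
    have "degree ([:cinner b a, cinner z a:] ^ l * [:cinner b z, 1:] ^ q)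
        \<le> degree ([:cinner b a, cinner z a:] ^ l) + degree ([:cinner b z, 1:] ^ q)" by (rule degree_mult_le)
    also have "\<dots> \<le> 1 * l + 1 * q"
      by (intro add_mono order.trans[OF degree_power_le] mult_le_mono1) (auto simp: degree_pCons_eq_if)
    finally have "degree ([:cinner b a, cinner z a:] ^ l * [:cinner b z, 1:] ^ q) \<le> P" using P by simp
    thus ?thesis unfolding R_def by (rule order.trans[OF degree_smult_le])
  qed
  have "(\<Sum>i\<le>P. (of_nat (P choose i) * c i) * t ^ i) = (\<Sum>i\<le>P. coeff R i * t ^ i)" for t
  proof -
    have "(\<Sum>i\<le>P. (of_nat (P choose i) * c i) * t ^ i)
        = (LINT w|surface_measure. (\<Sum>i\<le>P. of_nat (P choose i) * t ^ i *
             (cinner w a ^ l * cinner w z ^ q * cinner b w ^ (P - i) * cinner z w ^ i)))"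
      unfolding c_def
      by (subst Bochner_Integration.integral_sum)
         (auto intro!: integrable_surface_measure continuous_intros sum.cong)
    also have "\<dots> = (LINT w|surface_measure. cinner w a ^ l * cinner w z ^ q * (cinner b w + t * cinner z w) ^ P)"
    proof (rule Bochner_Integration.integral_cong[OF refl])
      fix w
      have "(t * cinner z w + cinner b w) ^ P
          = (\<Sum>i\<le>P. of_nat (P choose i) * t ^ i * cinner z w ^ i * cinner b w ^ (P - i))"
        by (subst binomial_ring) (simp add: power_mult_distrib mult.assoc)
      thus "(\<Sum>i\<le>P. of_nat (P choose i) * t ^ i *
             (cinner w a ^ l * cinner w z ^ q * cinner b w ^ (P - i) * cinner z w ^ i))
        = cinner w a ^ l * cinner w z ^ q * (cinner b w + t * cinner z w) ^ P"
        by (simp only: add.commute[of "cinner b w"] sum_distrib_left) (intro sum.cong refl, simp only: mult_ac)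
    qed
    also have "\<dots> = poly R t"
      unfolding step1 R_def by (simp add: poly_power algebra_simps)
    also have "\<dots> = (\<Sum>i\<le>P. coeff R i * t ^ i)" by (rule poly_eq_sum_coeff[OF dR])
    finally show ?thesis .
  qed
  hence "\<forall>i\<le>P. of_nat (P choose i) * c i = coeff R i"
    by (intro polyfun_eq_coeffs[THEN iffD1] allI)
  moreover have "p \<le> P" using P by simp
  ultimately have "of_nat (P choose p) * c p = coeff R p" by blast
  moreover have "P - p = l'" using P by simp
  moreover have "coeff R p = M * (\<Sum>k\<le>p. of_nat (l choose k) * of_nat (q choose (p - k)) *
        cinner b a ^ (l - k) * cinner z a ^ k * cinner b z ^ (q - (p - k)))"
    unfolding R_def coeff_smult coeff_mult coeff_linear_power power_one
    by (intro arg_cong[where f = "(*) M"] sum.cong refl) (simp only: mult_ac mult_1_right mult_1_left)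
  ultimately show ?thesis by (simp add: c_def M_def)
qed

lemma sum_Basis_complex_vec:
  fixes g :: "complex ^ 'n::finite \<Rightarrow> 'b::comm_monoid_add"
  shows "(\<Sum>b\<in>Basis. g b) = (\<Sum>i\<in>UNIV. g (axis i 1) + g (axis i \<i>))"
proof -
  have "(\<Sum>b\<in>Basis. g b) = (\<Sum>i\<in>UNIV. \<Sum>b\<in>{axis i 1, axis i \<i>}. g b)"
    unfolding Basis_vec_def
    by (subst sum.UNION_disjoint[symmetric])
       (auto simp: Basis_complex_def axis_eq_axis intro!: arg_cong[where f="sum g"])
  also have "\<dots> = (\<Sum>i\<in>UNIV. g (axis i 1) + g (axis i \<i>))"
    by (intro sum.cong refl) (simp add: axis_eq_axis)
  finally show ?thesis .
qed

lemma cinner_axis_left: "cinner (axis i c) a = c * cnj (a $ i)"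
  unfolding cinner_def axis_def by (simp add: if_distrib[of "\<lambda>x. x * _"] cong: if_cong)

lemma cinner_axis_right: "cinner a (axis i c) = (a $ i) * cnj c"
  unfolding cinner_def axis_def by (simp add: if_distrib[of "\<lambda>x. _ * cnj x"] cong: if_cong)

text \<open>
  Take \<open>l = l' = 1\<close> and \<open>a = b = e\<^sub>j\<close> in the mixed formula and sum over the coordinates \<open>j\<close>: on the sphere
  the integrands add up to \<open>\<bar>\<langle>w, z\<rangle>\<bar>\<^bsup>2P\<^esup>\<close>.
\<close>

lemma moment_Suc:
  "of_nat (P + CARD('n)) * moment TYPE('n::finite) (Suc P) = of_nat (Suc P) * moment TYPE('n) P"
proof -
  define z :: "complex ^ 'n" where "z = axis undefined 1"
  have z: "norm z = 1" by (simp add: z_def norm_axis_1)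
  have zz: "cinner z z = 1" using z by (simp add: cinner_self)
  define e :: "'n \<Rightarrow> complex ^ 'n" where "e j = axis j 1" for j
  have ee: "cinner (e j) (e j) = 1" for j by (simp add: e_def cinner_axis_left)
  have sum_e: "(\<Sum>j\<in>UNIV. cinner w (e j) * cinner (e j) w) = cinner w w" for w
    by (simp add: e_def cinner_axis_left cinner_axis_right) (simp add: cinner_def)
  have each: "of_nat (Suc P) * (LINT w|surface_measure. cinner w (e j) * cinner (e j) w * (cinner w z * cinner z w) ^ P)
      = moment TYPE('n) (Suc P) * (1 + of_nat P * (cinner z (e j) * cinner (e j) z))" for j
  proof -
    have "(\<Sum>k\<le>P. of_nat (1 choose k) * of_nat (P choose (P - k)) *
        cinner (e j) (e j) ^ (1 - k) * cinner z (e j) ^ k * cinner (e j) z ^ (P - (P - k)))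
       = 1 + of_nat P * (cinner z (e j) * cinner (e j) z)" (is "sum ?f _ = _")
    proof (cases P)
      case (Suc m)
      have "sum ?f {..P} = sum ?f {0, 1}"
        by (rule sum.mono_neutral_right) (auto simp: Suc binomial_eq_0)
      also have "\<dots> = 1 + of_nat P * (cinner z (e j) * cinner (e j) z)"
        by (simp add: ee Suc)
      finally show ?thesis .
    qed (simp add: ee)
    thus ?thesis
      using integral_mixed_form[OF z, of 1 P "Suc P" 1 P "e j" "e j"]
      by (simp add: power_mult_distrib mult_ac)
  qed
  have "of_nat (Suc P) * moment TYPE('n) P
      = of_nat (Suc P) * (LINT w|surface_measure. (cinner w z * cinner z w) ^ P)"
    by (simp add: integral_diagonal_form zz)
  also have "(LINT w|surface_measure. (cinner w z * cinner z w) ^ P)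
      = (LINT w|surface_measure. (\<Sum>j\<in>UNIV. cinner w (e j) * cinner (e j) w * (cinner w z * cinner z w) ^ P))"
    by (rule Bochner_Integration.integral_cong[OF refl])
       (simp add: sum_distrib_right[symmetric] sum_e cinner_self)
  also have "of_nat (Suc P) * \<dots> = (\<Sum>j\<in>UNIV. of_nat (Suc P) *
        (LINT w|surface_measure. cinner w (e j) * cinner (e j) w * (cinner w z * cinner z w) ^ P))"
    by (subst Bochner_Integration.integral_sum)
       (auto intro!: integrable_surface_measure continuous_intros simp only: sum_distrib_left)
  also have "\<dots> = (\<Sum>j\<in>UNIV. moment TYPE('n) (Suc P) * (1 + of_nat P * (cinner z (e j) * cinner (e j) z)))"
    by (intro sum.cong refl each)
  also have "\<dots> = moment TYPE('n) (Suc P) * (of_nat (CARD('n)) + of_nat P * cinner z z)"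
    by (simp only: sum_distrib_left[symmetric] sum.distrib sum_e) simp
  finally show ?thesis by (simp add: zz algebra_simps)
qed

lemma moment_0: "moment TYPE('n::finite) 0 = of_real (measure (surface_measure :: (complex ^ 'n) measure) (sphere 0 1))"
  by (simp add: moment_def scaleR_conv_of_real)

definition sphere_mass :: "'n::finite itself \<Rightarrow> real" where
  "sphere_mass _ = measure (surface_measure :: (complex ^ 'n) measure) (sphere 0 1)"

lemma sphere_mass_pos: "sphere_mass TYPE('n::finite) > 0"
  unfolding sphere_mass_def by (rule measure_surface_measure_pos)

lemma moment_eq:
  "moment TYPE('n::finite) P = of_real (sphere_mass TYPE('n) * fact P * fact (CARD('n) - 1) / fact (P + CARD('n) - 1))"
proof (induction P)
  case 0
  thus ?case by (simp add: moment_0 sphere_mass_def)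
next
  case (Suc P)
  have n: "CARD('n) > 0" by simp
  then obtain m where m: "CARD('n) = Suc m" by (metis not0_implies_Suc less_numeral_extra(3))
  define \<mu> where "\<mu> = sphere_mass TYPE('n)"
  have real_eq: "real (Suc P) * (\<mu> * fact P * fact m / fact (P + m))
      = real (P + Suc m) * (\<mu> * fact (Suc P) * fact m / fact (Suc (P + m)))"
    by (simp add: divide_simps del: of_nat_Suc of_nat_add)
  have "of_nat (P + CARD('n)) * moment TYPE('n) (Suc P) = of_nat (Suc P) * moment TYPE('n) P"
    by (rule moment_Suc)
  also have "\<dots> = of_real (real (Suc P) * (\<mu> * fact P * fact m / fact (P + m)))"
    by (simp add: Suc.IH m \<mu>_def)
  also have "\<dots> = of_nat (P + CARD('n)) * of_real (\<mu> * fact (Suc P) * fact m / fact (Suc (P + m)))"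
    by (simp only: real_eq m of_real_mult of_real_of_nat_eq)
  finally have "of_nat (P + CARD('n)) * moment TYPE('n) (Suc P)
      = of_nat (P + CARD('n)) * of_real (\<mu> * fact (Suc P) * fact m / fact (Suc (P + m)))" .
  moreover have "of_nat (P + CARD('n)) \<noteq> (0::complex)"
    unfolding of_nat_eq_0_iff by (simp add: m)
  ultimately have "moment TYPE('n) (Suc P) = of_real (\<mu> * fact (Suc P) * fact m / fact (Suc (P + m)))"
    unfolding mult_cancel_left by blast
  thus ?case by (simp add: m \<mu>_def)
qed

section \<open>Bihomogeneous polynomials are combinations of powers of linear forms\<close>

inductive form_span :: "nat \<Rightarrow> nat \<Rightarrow> (complex ^ 'n::finite \<Rightarrow> complex) \<Rightarrow> bool" for l l' where
  form_span_base: "form_span l l' (\<lambda>w. c * (cinner w a ^ l * cinner b w ^ l'))"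
| form_span_add: "form_span l l' f \<Longrightarrow> form_span l l' g \<Longrightarrow> form_span l l' (\<lambda>w. f w + g w)"

lemma form_span_zero: "form_span l l' (\<lambda>w. 0)"
  using form_span_base[of l l' 0] by simp

lemma form_span_sum:
  "finite I \<Longrightarrow> (\<And>i. i \<in> I \<Longrightarrow> form_span l l' (f i)) \<Longrightarrow> form_span l l' (\<lambda>w. \<Sum>i\<in>I. f i w)"
  by (induction I rule: finite_induct) (auto intro: form_span_zero form_span_add)

lemma form_span_homogeneous:
  "form_span l l' f \<Longrightarrow> f (c *s w) = c ^ l * cnj c ^ l' * f w"
  by (induction rule: form_span.induct)
     (simp_all add: cinner_scale_left cinner_scale_right power_mult_distrib algebra_simps)

lemma form_span_explicit:
  assumes "form_span l l' f"
  shows "\<exists>N c a b. \<forall>w. f w = (\<Sum>i<(N::nat). c i * (cinner w (a i) ^ l * cinner (b i) w ^ l'))"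
proof -
  have "\<exists>xs. \<forall>w. f w = (\<Sum>(c, a, b)\<leftarrow>xs. c * (cinner w a ^ l * cinner b w ^ l'))"
    using assms
  proof (induction rule: form_span.induct)
    case (form_span_base c a b)
    show ?case by (rule exI[of _ "[(c, a, b)]"]) simp
  next
    case (form_span_add f g)
    then obtain xs ys where
      "\<forall>w. f w = (\<Sum>(c, a, b)\<leftarrow>xs. c * (cinner w a ^ l * cinner b w ^ l'))"
      "\<forall>w. g w = (\<Sum>(c, a, b)\<leftarrow>ys. c * (cinner w a ^ l * cinner b w ^ l'))" by blast
    thus ?case by (intro exI[of _ "xs @ ys"]) simp
  qed
  then obtain xs where xs: "\<forall>w. f w = (\<Sum>(c, a, b)\<leftarrow>xs. c * (cinner w a ^ l * cinner b w ^ l'))" by blast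
  show ?thesis
    by (rule exI[of _ "length xs"], rule exI[of _ "\<lambda>i. fst (xs ! i)"],
        rule exI[of _ "\<lambda>i. fst (snd (xs ! i))"], rule exI[of _ "\<lambda>i. snd (snd (xs ! i))"])
       (simp add: xs sum_list_sum_nth case_prod_unfold atLeast0LessThan)
qed

lemma sum_root_unity_powers:
  fixes N e :: nat
  assumes "N > 0"
  defines "\<omega> \<equiv> exp (2 * of_real pi * \<i> * of_nat 1 / of_nat N)"
  shows "(\<Sum>i<N. (\<omega> ^ e) ^ i) = (if N dvd e then of_nat N else 0)"
proof -
  have we: "\<omega> ^ e = exp (2 * of_real pi * \<i> * of_nat e / of_nat N)"
    by (simp add: \<omega>_def exp_of_nat_mult[symmetric] mult_ac)
  have one: "\<omega> ^ e = 1 \<longleftrightarrow> N dvd e"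
    using complex_root_unity_eq_1[of N e] assms(1) by (simp add: we)
  have "(\<omega> ^ e) ^ N = 1"
    using assms(1) by (simp add: we exp_of_nat_mult[symmetric])
       (metis exp_two_pi_i exp_of_nat_mult power_one mult.commute)
  show ?thesis
  proof (cases "N dvd e")
    case True
    hence "\<omega> ^ e = 1" using one by simp
    thus ?thesis using True by simp
  next
    case False
    thus ?thesis using one \<open>(\<omega> ^ e) ^ N = 1\<close> by (simp add: geometric_sum)
  qed
qed

text \<open>
  Filtering by roots of unity: averaging \<open>(x + \<omega>\<^sup>i y)\<^bsup>l + k\<^esup>\<close> against \<open>\<omega>\<^bsup>- i k\<^esup>\<close> over the
  \<open>(l + k + 1)\<close>-th roots of unity \<open>\<omega>\<^sup>i\<close> isolates one term of the binomial expansion.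
\<close>

lemma product_of_powers_as_sum_of_powers:
  fixes l k :: nat
  shows "\<exists>N d \<omega>. \<forall>x y::complex. x ^ l * y ^ k = (\<Sum>i<(N::nat). d i * (x + \<omega> i * y) ^ (l + k))"
proof -
  define N where "N = Suc (l + k)"
  define \<omega> :: complex where "\<omega> = exp (2 * of_real pi * \<i> * of_nat 1 / of_nat N)"
  \<comment> \<open>The exponent \<open>N - k\<close> stands for \<open>- k\<close>, which agrees with it modulo \<open>N\<close>.\<close>
  define d where "d i = \<omega> ^ (i * (N - k)) / (of_nat N * of_nat ((l + k) choose k))" for i
  have "x ^ l * y ^ k = (\<Sum>i<N. d i * (x + \<omega> ^ i * y) ^ (l + k))" for x y :: complex
  proof -
    have "(\<Sum>i<N. \<omega> ^ (i * (N - k)) * (x + \<omega> ^ i * y) ^ (l + k))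
        = (\<Sum>i<N. \<Sum>j\<le>l + k. of_nat ((l + k) choose j) * y ^ j * x ^ (l + k - j) * (\<omega> ^ (N - k + j)) ^ i)"
    proof (intro sum.cong refl)
      fix i
      have "(x + \<omega> ^ i * y) ^ (l + k)
          = (\<Sum>j\<le>l + k. of_nat ((l + k) choose j) * (\<omega> ^ i * y) ^ j * x ^ (l + k - j))"
        by (subst add.commute) (rule binomial_ring)
      thus "\<omega> ^ (i * (N - k)) * (x + \<omega> ^ i * y) ^ (l + k)
         = (\<Sum>j\<le>l + k. of_nat ((l + k) choose j) * y ^ j * x ^ (l + k - j) * (\<omega> ^ (N - k + j)) ^ i)"
        by (simp add: sum_distrib_left power_mult_distrib power_add power_mult[symmetric] mult_ac)
    qed
    also have "\<dots> = (\<Sum>j\<le>l + k. \<Sum>i<N. of_nat ((l + k) choose j) * y ^ j * x ^ (l + k - j) * (\<omega> ^ (N - k + j)) ^ i)"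
      by (rule sum.swap)
    also have "\<dots> = (\<Sum>j\<le>l + k. of_nat ((l + k) choose j) * y ^ j * x ^ (l + k - j) *
        (if N dvd N - k + j then of_nat N else 0))"
      unfolding sum_distrib_left[symmetric] \<omega>_def
      by (intro sum.cong refl, subst sum_root_unity_powers) (auto simp: N_def)
    also have "\<dots> = (\<Sum>j\<in>{k}. of_nat ((l + k) choose j) * y ^ j * x ^ (l + k - j) *
        (if N dvd N - k + j then of_nat N else 0))"
    proof (rule sum.mono_neutral_right)
      show "\<forall>j\<in>{..l + k} - {k}. of_nat ((l + k) choose j) * y ^ j * x ^ (l + k - j) *
        (if N dvd N - k + j then of_nat N else 0) = 0"
      proof
        fix j assume j: "j \<in> {..l + k} - {k}"
        have "\<not> N dvd N - k + j"
        proof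
          assume "N dvd N - k + j"
          then obtain t where t: "N - k + j = N * t" by blast
          have "N - k + j > 0" "N - k + j < 2 * N" using j by (auto simp: N_def)
          hence "0 < N * t" "N * t < N * 2" unfolding t by simp_all
          hence "t = 1" unfolding nat_mult_less_cancel_disj by simp
          thus False using t j by (simp add: N_def)
        qed
        thus "of_nat ((l + k) choose j) * y ^ j * x ^ (l + k - j) * (if N dvd N - k + j then of_nat N else 0) = 0" by simp
      qed
    qed auto
    also have "\<dots> = of_nat N * of_nat ((l + k) choose k) * (x ^ l * y ^ k)"
      by (simp add: N_def mult_ac)
    finally have eq: "(\<Sum>i<N. \<omega> ^ (i * (N - k)) * (x + \<omega> ^ i * y) ^ (l + k))
        = of_nat N * of_nat ((l + k) choose k) * (x ^ l * y ^ k)" .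
    have ne: "of_nat N * of_nat ((l + k) choose k) \<noteq> (0::complex)"
      by (simp add: N_def del: of_nat_Suc)
    have "(\<Sum>i<N. d i * (x + \<omega> ^ i * y) ^ (l + k))
        = (\<Sum>i<N. \<omega> ^ (i * (N - k)) * (x + \<omega> ^ i * y) ^ (l + k)) / (of_nat N * of_nat ((l + k) choose k))"
      by (simp add: d_def sum_divide_distrib)
    thus ?thesis unfolding eq using ne by simp
  qed
  thus ?thesis by blast
qed

lemma form_span_mult:
  assumes "form_span l l' f" "form_span k k' g"
  shows "form_span (l + k) (l' + k') (\<lambda>w. f w * g w)"
  using assms(1)
proof (induction rule: form_span.induct)
  case (form_span_base c a b)
  show ?case using assms(2)
  proof (induction rule: form_span.induct)
    case (form_span_base c' a' b')
    obtain N d \<omega> where 1: "\<And>x y::complex. x ^ l * y ^ k = (\<Sum>i<(N::nat). d i * (x + \<omega> i * y) ^ (l + k))"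
      using product_of_powers_as_sum_of_powers by blast
    obtain N' d' \<omega>' where 2: "\<And>x y::complex. x ^ l' * y ^ k' = (\<Sum>i<(N'::nat). d' i * (x + \<omega>' i * y) ^ (l' + k'))"
      using product_of_powers_as_sum_of_powers by blast
    have "(\<lambda>w. (c * (cinner w a ^ l * cinner b w ^ l')) * (c' * (cinner w a' ^ k * cinner b' w ^ k')))
        = (\<lambda>w. \<Sum>i<N. \<Sum>j<N'. (c * c' * d i * d' j) *
            (cinner w (a + cnj (\<omega> i) *s a') ^ (l + k) * cinner (b + \<omega>' j *s b') w ^ (l' + k')))"
    proof
      fix w
      have "(c * (cinner w a ^ l * cinner b w ^ l')) * (c' * (cinner w a' ^ k * cinner b' w ^ k'))
         = c * c' * ((cinner w a ^ l * cinner w a' ^ k) * (cinner b w ^ l' * cinner b' w ^ k'))"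
        by (simp add: mult_ac)
      also have "\<dots> = (\<Sum>i<N. \<Sum>j<N'. (c * c' * d i * d' j) *
            (cinner w (a + cnj (\<omega> i) *s a') ^ (l + k) * cinner (b + \<omega>' j *s b') w ^ (l' + k')))"
        unfolding 1 2 sum_product
        by (simp only: sum_distrib_left, intro sum.cong refl)
           (simp add: cinner_add_left cinner_add_right cinner_scale_left cinner_scale_right mult_ac)
      finally show "(c * (cinner w a ^ l * cinner b w ^ l')) * (c' * (cinner w a' ^ k * cinner b' w ^ k')) = \<dots>" .
    qed
    thus ?case by (simp only:) (intro form_span_sum form_span.form_span_base finite_lessThan)
  next
    case (form_span_add f g)
    show ?case unfolding distrib_left by (rule form_span.form_span_add[OF form_span_add.IH])
  qed
next
  case (form_span_add f f')
  show ?case unfolding distrib_right by (rule form_span.form_span_add[OF form_span_add.IH])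
qed

text \<open>
  The expansion is required for every large bound \<open>k\<close>, not for one, so that the expansions of two functions
  can be added without padding them to a common range.
\<close>

definition bigraded :: "(complex ^ 'n::finite \<Rightarrow> complex) \<Rightarrow> bool" where
  "bigraded f \<longleftrightarrow> (\<exists>K F. (\<forall>p q. form_span p q (F p q)) \<and>
      (\<forall>k\<ge>K. \<forall>w. f w = (\<Sum>p\<le>k. \<Sum>q\<le>k. F p q w)))"

lemma bigraded_form_span:
  assumes "form_span l l' f"
  shows "bigraded f"
  unfolding bigraded_def
proof (intro exI conjI allI impI)
  let ?F = "\<lambda>p q. if p = l \<and> q = l' then f else (\<lambda>w. 0)"
  show "form_span p q (?F p q)" for p q using assms by (auto intro: form_span_zero)
  fix k w assume k: "max l l' \<le> k"
  have "(\<Sum>p\<le>k. \<Sum>q\<le>k. ?F p q w) = (\<Sum>p\<le>k. if p = l then f w else 0)"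
    using k by (intro sum.cong refl) (auto simp: if_distrib[of "\<lambda>g. g w"] cong: if_cong)
  thus "f w = (\<Sum>p\<le>k. \<Sum>q\<le>k. ?F p q w)" using k by simp
qed

lemma bigraded_add:
  assumes "bigraded f" "bigraded g"
  shows "bigraded (\<lambda>w. f w + g w)"
proof -
  from assms obtain K F K' F' where
    F: "\<forall>p q. form_span p q (F p q)" "\<forall>k\<ge>K. \<forall>w. f w = (\<Sum>p\<le>k. \<Sum>q\<le>k. F p q w)" and
    F': "\<forall>p q. form_span p q (F' p q)" "\<forall>k\<ge>K'. \<forall>w. g w = (\<Sum>p\<le>k. \<Sum>q\<le>k. F' p q w)"
    unfolding bigraded_def by metis
  show ?thesis unfolding bigraded_def
    by (rule exI[of _ "max K K'"], rule exI[of _ "\<lambda>p q w. F p q w + F' p q w"])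
       (use F F' in \<open>auto simp: sum.distrib intro: form_span_add\<close>)
qed

lemma bigraded_sum:
  "finite I \<Longrightarrow> (\<And>i. i \<in> I \<Longrightarrow> bigraded (f i)) \<Longrightarrow> bigraded (\<lambda>w. \<Sum>i\<in>I. f i w)"
  by (induction I rule: finite_induct)
     (auto intro: bigraded_add bigraded_form_span[OF form_span_zero])

lemma bigraded_mult:
  assumes "bigraded f" "bigraded g"
  shows "bigraded (\<lambda>w. f w * g w)"
proof -
  from assms obtain K F K' F' where
    F: "\<And>p q. form_span p q (F p q)" "\<And>w. f w = (\<Sum>p\<le>K. \<Sum>q\<le>K. F p q w)" and
    F': "\<And>p q. form_span p q (F' p q)" "\<And>w. g w = (\<Sum>p\<le>K'. \<Sum>q\<le>K'. F' p q w)"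
    unfolding bigraded_def by (metis order_refl)
  have "bigraded (\<lambda>w. \<Sum>p\<le>K. \<Sum>q\<le>K. \<Sum>p'\<le>K'. \<Sum>q'\<le>K'. F p q w * F' p' q' w)"
    by (intro bigraded_sum finite_atMost bigraded_form_span[OF form_span_mult[OF F(1) F'(1)]])
  also have "(\<lambda>w. \<Sum>p\<le>K. \<Sum>q\<le>K. \<Sum>p'\<le>K'. \<Sum>q'\<le>K'. F p q w * F' p' q' w) = (\<lambda>w. f w * g w)"
    unfolding F F' by (simp only: sum_distrib_right) (simp only: sum_distrib_left)
  finally show ?thesis .
qed

lemma bigraded_const: "bigraded (\<lambda>w. c)"
  using bigraded_form_span[OF form_span_base[of 0 0 c]] by simp

lemma bigraded_real_polynomial_function:
  fixes f :: "complex ^ 'n::finite \<Rightarrow> real"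
  assumes "real_polynomial_function f"
  shows "bigraded (\<lambda>w. of_real (f w))"
  using assms
proof (induction rule: real_polynomial_function.induct)
  case (linear f)
  hence lin: "linear f" by (rule bounded_linear.linear)
  define v where "v = (\<Sum>b\<in>Basis. f b *\<^sub>R b)"
  have "f w = w \<bullet> v" for w
  proof -
    have "f w = f (\<Sum>b\<in>Basis. (w \<bullet> b) *\<^sub>R b)" by (simp add: euclidean_representation)
    also have "\<dots> = (\<Sum>b\<in>Basis. (w \<bullet> b) * f b)"
      using lin by (simp add: linear_sum linear_cmul)
    also have "\<dots> = w \<bullet> v" by (simp add: v_def inner_sum_right mult.commute)
    finally show ?thesis .
  qed
  hence "of_real (f w) = (1/2) * (cinner w v ^ 1 * cinner v w ^ 0) + (1/2) * (cinner w v ^ 0 * cinner v w ^ 1)" for w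
    by (simp add: inner_eq_Re_cinner cnj_cinner[of w v, symmetric] complex_eq_iff)
  thus ?case
    using bigraded_add[OF bigraded_form_span[OF form_span_base[of 1 0 "1/2" v v]]
        bigraded_form_span[OF form_span_base[of 0 1 "1/2" v v]]] by simp
qed (auto intro: bigraded_const bigraded_add bigraded_mult)

text \<open>
  Comparing powers of the modulus of \<open>c\<close> isolates the total degree, and on the unit circle the remaining sum
  is, up to a power of \<open>c\<close>, a polynomial in \<open>c\<close>.
\<close>

lemma bihomogeneous_coeffs_unique:
  fixes A :: "nat \<Rightarrow> nat \<Rightarrow> complex"
  assumes eq: "\<And>c::complex. (\<Sum>p\<le>K. \<Sum>q\<le>K. A p q * (c ^ p * cnj c ^ q)) = 0"
    and pq: "p0 \<le> K" "q0 \<le> K"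
  shows "A p0 q0 = 0"
proof -
  define m where "m = p0 + q0"
  have 1: "(\<Sum>p\<le>K. \<Sum>q\<le>K. if p + q = m then A p q * (\<omega> ^ p * cnj \<omega> ^ q) else 0) = 0" for \<omega>
  proof -
    define Q where "Q = (\<Sum>p\<le>K. \<Sum>q\<le>K. monom (A p q * (\<omega> ^ p * cnj \<omega> ^ q)) (p + q))"
    have "poly Q (of_real r) = 0" for r
      using eq[of "of_real r * \<omega>"]
      by (simp add: Q_def poly_sum poly_monom power_mult_distrib power_add mult_ac)
    hence "range (of_real :: real \<Rightarrow> complex) \<subseteq> {x. poly Q x = 0}" by auto
    moreover have "infinite (range (of_real :: real \<Rightarrow> complex))"
      by (simp add: finite_image_iff inj_of_real infinite_UNIV_char_0)
    ultimately have "Q = 0" using poly_roots_finite finite_subset by blast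
    hence "coeff Q m = 0" by simp
    thus ?thesis by (simp add: Q_def coeff_sum)
  qed
  define R where "R = (\<Sum>p\<le>K. \<Sum>q\<le>K. if p + q = m then monom (A p q) (p + (K - q)) else 0)"
  have "poly R \<omega> = 0" if "cmod \<omega> = 1" for \<omega>
  proof -
    have ww: "cnj \<omega> * \<omega> = 1" using that by (simp add: complex_norm_square[symmetric] mult.commute)
    have wq: "\<omega> ^ K * cnj \<omega> ^ q = \<omega> ^ (K - q)" if "q \<le> K" for q
    proof -
      have "\<omega> ^ K = \<omega> ^ (K - q) * \<omega> ^ q" using that by (simp add: power_add[symmetric])
      thus ?thesis using ww by (simp add: mult.assoc power_mult_distrib[symmetric] mult.commute[of \<omega>])
    qed
    have "poly R \<omega> = \<omega> ^ K * (\<Sum>p\<le>K. \<Sum>q\<le>K. if p + q = m then A p q * (\<omega> ^ p * cnj \<omega> ^ q) else 0)"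
      unfolding R_def poly_sum sum_distrib_left
    proof (intro sum.cong refl)
      fix p q assume "q \<in> {..K}"
      hence "\<omega> ^ (K - q) = \<omega> ^ K * cnj \<omega> ^ q" using wq by simp
      thus "poly (if p + q = m then monom (A p q) (p + (K - q)) else 0) \<omega>
          = \<omega> ^ K * (if p + q = m then A p q * (\<omega> ^ p * cnj \<omega> ^ q) else 0)"
        by (simp add: poly_monom power_add mult_ac)
    qed
    thus ?thesis unfolding 1 by simp
  qed
  hence "{\<omega>. cmod \<omega> = 1} \<subseteq> {x. poly R x = 0}" by auto
  hence "R = 0" using poly_roots_finite infinite_unit_circle finite_subset by blast
  hence "0 = coeff R (p0 + (K - q0))" by simp
  also have "\<dots> = (\<Sum>p\<le>K. \<Sum>q\<le>K. if p = p0 \<and> q = q0 then A p q else 0)"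
    unfolding R_def coeff_sum
    by (intro sum.cong refl) (use pq in \<open>auto simp: m_def\<close>)
  also have "\<dots> = (\<Sum>p\<le>K. if p = p0 then A p0 q0 else 0)"
    using pq by (intro sum.cong refl) auto
  also have "\<dots> = A p0 q0" using pq by simp
  finally show ?thesis by simp
qed

text \<open>
  Real linear forms are combinations of \<open>\<langle>w, v\<rangle>\<close> and \<open>\<langle>v, w\<rangle>\<close>, so every polynomial is a sum of components in
  the spans of various bidegrees. Homogeneity of \<open>f\<close> forces all components but one to vanish.
\<close>

lemma form_span_bihomogeneous_polynomial:
  fixes f :: "complex ^ 'n::finite \<Rightarrow> complex"
  assumes f: "polynomial_function f" and hom: "\<And>c z. f (c *s z) = c ^ l * cnj c ^ l' * f z"
  shows "form_span l l' f"
proof -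
  have "real_polynomial_function (Re \<circ> f)" "real_polynomial_function (Im \<circ> f)"
    using f bounded_linear_Re bounded_linear_Im unfolding polynomial_function_def by auto
  hence "bigraded (\<lambda>w. of_real (Re (f w)) + \<i> * of_real (Im (f w)))"
    using bigraded_real_polynomial_function[of "Re \<circ> f"] bigraded_real_polynomial_function[of "Im \<circ> f"]
    by (intro bigraded_add bigraded_mult bigraded_const) (simp_all add: o_def)
  hence "bigraded f" by (simp add: complex_eq[symmetric])
  then obtain K0 F where F: "\<And>p q. form_span p q (F p q)"
      "\<And>k w. k \<ge> K0 \<Longrightarrow> f w = (\<Sum>p\<le>k. \<Sum>q\<le>k. F p q w)"
    unfolding bigraded_def by metis
  define K where "K = max K0 (max l l')"
  have "f = F l l'"
  proof
    fix w
    define A where "A p q = F p q w - (if p = l \<and> q = l' then f w else 0)" for p q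
    have "A l l' = 0"
    proof (rule bihomogeneous_coeffs_unique)
      fix c :: complex
      have "(\<Sum>p\<le>K. \<Sum>q\<le>K. (if p = l \<and> q = l' then f w else 0) * (c ^ p * cnj c ^ q))
          = (\<Sum>p\<le>K. if p = l then f w * (c ^ l * cnj c ^ l') else 0)"
      proof (intro sum.cong refl)
        fix p
        show "(\<Sum>q\<le>K. (if p = l \<and> q = l' then f w else 0) * (c ^ p * cnj c ^ q))
          = (if p = l then f w * (c ^ l * cnj c ^ l') else 0)"
          by (cases "p = l") (simp_all add: K_def if_distrib[of "\<lambda>x. x * _"] cong: if_cong)
      qed
      also have "\<dots> = f (c *s w)" by (simp add: K_def hom mult_ac)
      also have "\<dots> = (\<Sum>p\<le>K. \<Sum>q\<le>K. F p q w * (c ^ p * cnj c ^ q))"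
        by (subst F(2)[of K]) (auto simp: K_def form_span_homogeneous[OF F(1)] mult_ac)
      finally show "(\<Sum>p\<le>K. \<Sum>q\<le>K. A p q * (c ^ p * cnj c ^ q)) = 0"
        by (simp add: A_def left_diff_distrib sum_subtractf)
    qed (auto simp: K_def)
    thus "f w = F l l' w" by (simp add: A_def)
  qed
  thus ?thesis using F(1) by simp
qed

section \<open>The Laplacian\<close>

definition has_dir_deriv :: "'a::euclidean_space \<Rightarrow> ('a \<Rightarrow> complex) \<Rightarrow> ('a \<Rightarrow> complex) \<Rightarrow> bool" where
  "has_dir_deriv b f g \<longleftrightarrow> (\<forall>x. ((\<lambda>t. f (x + t *\<^sub>R b)) has_vector_derivative g x) (at 0))"

definition twice_dir_deriv where
  "twice_dir_deriv b f f1 f2 \<longleftrightarrow> has_dir_deriv b f f1 \<and> has_dir_deriv b f1 f2"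

lemma has_dir_deriv_unique: "has_dir_deriv b f g \<Longrightarrow> dir_deriv b f = g"
  by (auto simp: has_dir_deriv_def dir_deriv_def fun_eq_iff intro: vector_derivative_at)

lemma laplacian_eqI:
  assumes "\<And>b. b \<in> Basis \<Longrightarrow> twice_dir_deriv b f (f1 b) (f2 b)"
  shows "laplacian f x = (\<Sum>b\<in>Basis. f2 b x)"
  unfolding laplacian_def
proof (intro sum.cong refl)
  fix b :: 'a assume "b \<in> Basis"
  hence "dir_deriv b f = f1 b" "dir_deriv b (f1 b) = f2 b"
    using assms has_dir_deriv_unique by (auto simp: twice_dir_deriv_def)
  thus "dir_deriv b (dir_deriv b f) x = f2 b x" by simp
qed

lemma has_dir_deriv_const: "has_dir_deriv b (\<lambda>w. c) (\<lambda>w. 0)"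
  by (simp add: has_dir_deriv_def)

lemma has_dir_deriv_add:
  "has_dir_deriv b f f' \<Longrightarrow> has_dir_deriv b g g' \<Longrightarrow> has_dir_deriv b (\<lambda>w. f w + g w) (\<lambda>w. f' w + g' w)"
  unfolding has_dir_deriv_def by (intro allI has_vector_derivative_add) auto

lemma has_dir_deriv_mult:
  assumes "has_dir_deriv b f f'" "has_dir_deriv b g g'"
  shows "has_dir_deriv b (\<lambda>w. f w * g w) (\<lambda>w. f w * g' w + f' w * g w)"
  unfolding has_dir_deriv_def
proof
  fix x
  from assms have "((\<lambda>t. f (x + t *\<^sub>R b)) has_vector_derivative f' x) (at 0)"
      "((\<lambda>t. g (x + t *\<^sub>R b)) has_vector_derivative g' x) (at 0)"
    by (auto simp: has_dir_deriv_def)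
  from has_vector_derivative_mult[OF this]
  show "((\<lambda>t. f (x + t *\<^sub>R b) * g (x + t *\<^sub>R b)) has_vector_derivative f x * g' x + f' x * g x) (at 0)"
    by simp
qed

lemma has_dir_deriv_power:
  assumes "has_dir_deriv b f f'"
  shows "has_dir_deriv b (\<lambda>w. f w ^ p) (\<lambda>w. of_nat p * f w ^ (p - 1) * f' w)"
proof (induction p)
  case 0
  show ?case using has_dir_deriv_const[of b 1] by simp
next
  case (Suc p)
  have eq: "(\<lambda>w. f w * (of_nat p * f w ^ (p - 1) * f' w) + f' w * f w ^ p)
      = (\<lambda>w. of_nat (Suc p) * f w ^ (Suc p - 1) * f' w)"
    by (cases p) (auto simp: fun_eq_iff algebra_simps)
  show ?case using has_dir_deriv_mult[OF assms Suc.IH] unfolding eq by simp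
qed

lemma has_dir_deriv_cinner_left: "has_dir_deriv b (\<lambda>w. cinner w a) (\<lambda>w. cinner b a)"
  unfolding has_dir_deriv_def cinner_add_left cinner_scaleR_left scaleR_conv_of_real[where 'a=complex, symmetric]
  by (auto intro!: derivative_eq_intros)

lemma has_dir_deriv_cinner_right: "has_dir_deriv b (\<lambda>w. cinner a w) (\<lambda>w. cinner a b)"
  unfolding has_dir_deriv_def cinner_add_right cinner_scaleR_right scaleR_conv_of_real[where 'a=complex, symmetric]
  by (auto intro!: derivative_eq_intros)

lemma has_dir_deriv_cinner_self:
  "has_dir_deriv b (\<lambda>w. cinner w w) (\<lambda>w. cinner b w + cinner w b)"
  unfolding has_dir_deriv_def
proof
  fix x
  have eq: "(\<lambda>t. cinner (x + t *\<^sub>R b) (x + t *\<^sub>R b))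
     = (\<lambda>t. cinner x x + t *\<^sub>R (cinner b x + cinner x b) + (t * t) *\<^sub>R cinner b b)"
    by (simp add: fun_eq_iff cinner_add_left cinner_add_right cinner_scaleR_left cinner_scaleR_right
        scaleR_conv_of_real[where 'a=complex] algebra_simps)
  show "((\<lambda>t. cinner (x + t *\<^sub>R b) (x + t *\<^sub>R b)) has_vector_derivative cinner b x + cinner x b) (at 0)"
    unfolding eq by (auto intro!: derivative_eq_intros)
qed

lemma twice_dir_deriv_const: "twice_dir_deriv b (\<lambda>w. c) (\<lambda>w. 0) (\<lambda>w. 0)"
  by (simp add: twice_dir_deriv_def has_dir_deriv_const)

lemma twice_dir_deriv_add:
  "twice_dir_deriv b f f1 f2 \<Longrightarrow> twice_dir_deriv b g g1 g2 \<Longrightarrow>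
   twice_dir_deriv b (\<lambda>w. f w + g w) (\<lambda>w. f1 w + g1 w) (\<lambda>w. f2 w + g2 w)"
  by (simp add: twice_dir_deriv_def has_dir_deriv_add)

lemma twice_dir_deriv_sum:
  "finite I \<Longrightarrow> (\<And>i. i \<in> I \<Longrightarrow> twice_dir_deriv b (f i) (f1 i) (f2 i)) \<Longrightarrow>
   twice_dir_deriv b (\<lambda>w. \<Sum>i\<in>I. f i w) (\<lambda>w. \<Sum>i\<in>I. f1 i w) (\<lambda>w. \<Sum>i\<in>I. f2 i w)"
  by (induction I rule: finite_induct) (auto intro: twice_dir_deriv_const twice_dir_deriv_add)

lemma twice_dir_deriv_mult:
  assumes "twice_dir_deriv b f f1 f2" "twice_dir_deriv b g g1 g2"
  shows "twice_dir_deriv b (\<lambda>w. f w * g w) (\<lambda>w. f w * g1 w + f1 w * g w)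
           (\<lambda>w. f w * g2 w + 2 * (f1 w * g1 w) + f2 w * g w)"
proof -
  have eq: "(\<lambda>w. f w * g2 w + 2 * (f1 w * g1 w) + f2 w * g w)
     = (\<lambda>w. (f w * g2 w + f1 w * g1 w) + (f1 w * g1 w + f2 w * g w))"
    by (simp add: fun_eq_iff)
  show ?thesis using assms unfolding eq twice_dir_deriv_def
    by (intro conjI has_dir_deriv_add has_dir_deriv_mult) auto
qed

lemma twice_dir_deriv_power:
  assumes "twice_dir_deriv b f f1 f2"
  shows "twice_dir_deriv b (\<lambda>w. f w ^ p) (\<lambda>w. of_nat p * f w ^ (p - 1) * f1 w)
     (\<lambda>w. of_nat p * of_nat (p - 1) * f w ^ (p - 1 - 1) * (f1 w * f1 w) + of_nat p * f w ^ (p - 1) * f2 w)"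
proof -
  from assms have f: "has_dir_deriv b f f1" "has_dir_deriv b f1 f2" by (auto simp: twice_dir_deriv_def)
  have "has_dir_deriv b (\<lambda>w. (of_nat p * f w ^ (p - 1)) * f1 w)
     (\<lambda>w. (of_nat p * f w ^ (p - 1)) * f2 w + (of_nat p * (of_nat (p - 1) * f w ^ (p - 1 - 1) * f1 w) + 0 * f w ^ (p - 1)) * f1 w)"
    by (intro has_dir_deriv_mult has_dir_deriv_power has_dir_deriv_const f)
  also have "(\<lambda>w. (of_nat p * f w ^ (p - 1)) * f2 w + (of_nat p * (of_nat (p - 1) * f w ^ (p - 1 - 1) * f1 w) + 0 * f w ^ (p - 1)) * f1 w)
     = (\<lambda>w. of_nat p * of_nat (p - 1) * f w ^ (p - 1 - 1) * (f1 w * f1 w) + of_nat p * f w ^ (p - 1) * f2 w)"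
    by (simp add: fun_eq_iff algebra_simps)
  finally show ?thesis using has_dir_deriv_power[OF f(1)] by (simp add: twice_dir_deriv_def)
qed

lemma Basis_sum_cinner:
  fixes a b :: "complex ^ 'n::finite"
  shows "(\<Sum>e\<in>Basis. cinner e a * cinner e b) = 0"
    and "(\<Sum>e\<in>Basis. cinner a e * cinner b e) = 0"
    and "(\<Sum>e\<in>Basis. cinner e a * cinner b e) = 2 * cinner b a"
    and "(\<Sum>e\<in>Basis. cinner b e * cinner e a) = 2 * cinner b a"
    and "(\<Sum>e\<in>(Basis :: (complex ^ 'n) set). cinner e e) = 2 * of_nat CARD('n)"
proof -
  note [simp] = sum_Basis_complex_vec cinner_axis_left cinner_axis_right
  show "(\<Sum>e\<in>Basis. cinner e a * cinner e b) = 0" by (simp add: algebra_simps)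
  show "(\<Sum>e\<in>Basis. cinner a e * cinner b e) = 0" by (simp add: algebra_simps)
  show *: "(\<Sum>e\<in>Basis. cinner e a * cinner b e) = 2 * cinner b a"
    unfolding cinner_def[of b a] sum_distrib_left sum_Basis_complex_vec
    by (intro sum.cong refl) (simp add: algebra_simps)
  thus "(\<Sum>e\<in>Basis. cinner b e * cinner e a) = 2 * cinner b a" by (simp only: mult.commute)
  show "(\<Sum>e\<in>(Basis :: (complex ^ 'n) set). cinner e e) = 2 * of_nat CARD('n)" by simp
qed

text \<open>
  In the product rule the squares of the gradients of \<open>\<langle>w, a\<rangle>\<close> and of \<open>\<langle>b, w\<rangle>\<close> drop out, because these forms are
  holomorphic and antiholomorphic. The mixed term gives the contraction \<open>\<langle>b, a\<rangle>\<close>, and the terms that contain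
  a derivative of \<open>\<bar>w\<bar>\<^sup>2\<close> combine by Euler's identity.
\<close>

lemma laplacian_monomial_family:
  fixes a b :: "nat \<Rightarrow> complex ^ 'n::finite"
  assumes "finite I"
  shows "laplacian (\<lambda>w. \<Sum>i\<in>I. c i * (cinner w (a i) ^ p i * cinner (b i) w ^ q i * cinner w w ^ j i)) w
     = (\<Sum>i\<in>I. c i * (4 * (of_nat (p i * q i) * cinner (b i) (a i) * cinner w (a i) ^ (p i - 1) * cinner (b i) w ^ (q i - 1) * cinner w w ^ j i
          + of_nat (j i) * (of_nat (p i + q i + j i + CARD('n)) - 1) * cinner w (a i) ^ p i * cinner (b i) w ^ q i * cinner w w ^ (j i - 1))))"
proof -
  define x where "x i = cinner w (a i)" for i
  define y where "y i = cinner (b i) w" for i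
  define r where "r = cinner w w"
  define D2 where "D2 i e =
      (x i ^ p i * y i ^ q i) * (of_nat (j i) * of_nat (j i - 1) * r ^ (j i - 1 - 1) * ((cinner e w + cinner w e) * (cinner e w + cinner w e))
          + of_nat (j i) * r ^ (j i - 1) * (cinner e e + cinner e e))
     + 2 * ((x i ^ p i * (of_nat (q i) * y i ^ (q i - 1) * cinner (b i) e) + of_nat (p i) * x i ^ (p i - 1) * cinner e (a i) * y i ^ q i)
         * (of_nat (j i) * r ^ (j i - 1) * (cinner e w + cinner w e)))
     + (x i ^ p i * (of_nat (q i) * of_nat (q i - 1) * y i ^ (q i - 1 - 1) * (cinner (b i) e * cinner (b i) e) + of_nat (q i) * y i ^ (q i - 1) * 0)
        + 2 * ((of_nat (p i) * x i ^ (p i - 1) * cinner e (a i)) * (of_nat (q i) * y i ^ (q i - 1) * cinner (b i) e))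
        + (of_nat (p i) * of_nat (p i - 1) * x i ^ (p i - 1 - 1) * (cinner e (a i) * cinner e (a i)) + of_nat (p i) * x i ^ (p i - 1) * 0) * y i ^ q i)
       * r ^ j i" for i e
  have lin: "twice_dir_deriv e (\<lambda>w. cinner w a) (\<lambda>w. cinner e a) (\<lambda>w. 0)"
       "twice_dir_deriv e (\<lambda>w. cinner b w) (\<lambda>w. cinner b e) (\<lambda>w. 0)"
       "twice_dir_deriv e (\<lambda>w. cinner w w) (\<lambda>w. cinner e w + cinner w e) (\<lambda>w. cinner e e + cinner e e)"
    for a b e :: "complex ^ 'n"
    unfolding twice_dir_deriv_def
    by (intro conjI has_dir_deriv_add has_dir_deriv_cinner_left has_dir_deriv_cinner_right
         has_dir_deriv_cinner_self has_dir_deriv_const)+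
  note tw = twice_dir_deriv_sum[OF assms twice_dir_deriv_mult[OF twice_dir_deriv_const
       twice_dir_deriv_mult[OF twice_dir_deriv_mult[OF twice_dir_deriv_power[OF lin(1)] twice_dir_deriv_power[OF lin(2)]]
        twice_dir_deriv_power[OF lin(3)]]]]
  have "laplacian (\<lambda>w. \<Sum>i\<in>I. c i * (cinner w (a i) ^ p i * cinner (b i) w ^ q i * cinner w w ^ j i)) w
      = (\<Sum>e\<in>Basis. \<Sum>i\<in>I. c i * D2 i e)"
    by (subst laplacian_eqI[OF tw]) (simp add: D2_def x_def y_def r_def)
  also have "\<dots> = (\<Sum>i\<in>I. c i * (\<Sum>e\<in>Basis. D2 i e))"
    by (subst sum.swap) (simp add: sum_distrib_left)
  also have "\<dots> = (\<Sum>i\<in>I. c i * (4 * (of_nat (p i * q i) * cinner (b i) (a i) * x i ^ (p i - 1) * y i ^ (q i - 1) * r ^ j i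
          + of_nat (j i) * (of_nat (p i + q i + j i + CARD('n)) - 1) * x i ^ p i * y i ^ q i * r ^ (j i - 1))))"
  proof (intro sum.cong refl arg_cong[where f = "(*) _"])
    fix i
    define J where "J = (of_nat (j i) :: complex)"
    define X Y R where "X = x i ^ p i" and "Y = y i ^ q i" and "R = r ^ (j i - 1)"
    define X' Y' where "X' = of_nat (p i) * x i ^ (p i - 1)" and "Y' = of_nat (q i) * y i ^ (q i - 1)"
    define X'' Y'' R'' where "X'' = of_nat (p i) * of_nat (p i - 1) * x i ^ (p i - 1 - 1)"
      and "Y'' = of_nat (q i) * of_nat (q i - 1) * y i ^ (q i - 1 - 1)"
      and "R'' = J * of_nat (j i - 1) * r ^ (j i - 1 - 1)"
    have "(\<Sum>e\<in>Basis. D2 i e) = (\<Sum>e\<in>Basis.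
          X * Y * R'' * (cinner e w * cinner e w) + X * Y * R'' * (cinner w e * cinner w e)
        + 2 * X * Y * R'' * (cinner e w * cinner w e) + 2 * X * Y * J * R * cinner e e
        + 2 * X * Y' * J * R * (cinner (b i) e * cinner e w) + 2 * X * Y' * J * R * (cinner (b i) e * cinner w e)
        + 2 * X' * Y * J * R * (cinner e (a i) * cinner e w) + 2 * X' * Y * J * R * (cinner e (a i) * cinner w e)
        + X * Y'' * r ^ j i * (cinner (b i) e * cinner (b i) e) + 2 * X' * Y' * r ^ j i * (cinner e (a i) * cinner (b i) e)
        + X'' * Y * r ^ j i * (cinner e (a i) * cinner e (a i)))"
      by (intro sum.cong refl, unfold D2_def X_def[symmetric] Y_def[symmetric] R_def[symmetric] J_def[symmetric]
            X'_def[symmetric] Y'_def[symmetric] X''_def[symmetric] Y''_def[symmetric] R''_def[symmetric])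
         (simp add: algebra_simps)
    also have "\<dots> = 4 * (X * Y * (R'' * r) + X * Y * J * R * of_nat CARD('n) + X * (Y' * y i) * J * R
        + (X' * x i) * Y * J * R + X' * Y' * r ^ j i * cinner (b i) (a i))"
      by (simp only: sum.distrib sum_distrib_left[symmetric] Basis_sum_cinner)
         (simp add: x_def y_def r_def algebra_simps)
    also have "R'' * r = J * (J - 1) * R"
      by (cases "j i"; cases "j i - 1") (auto simp: R''_def R_def J_def)
    also have "Y' * y i = of_nat (q i) * Y" by (cases "q i") (auto simp: Y'_def Y_def)
    also have "X' * x i = of_nat (p i) * X" by (cases "p i") (auto simp: X'_def X_def)
    also have "4 * (X * Y * (J * (J - 1) * R) + X * Y * J * R * of_nat CARD('n) + X * (of_nat (q i) * Y) * J * R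
        + of_nat (p i) * X * Y * J * R + X' * Y' * r ^ j i * cinner (b i) (a i))
      = 4 * (of_nat (p i * q i) * cinner (b i) (a i) * x i ^ (p i - 1) * y i ^ (q i - 1) * r ^ j i
          + J * (of_nat (p i + q i) + J + of_nat (CARD('n)) - 1) * X * Y * R)"
      by (simp add: X'_def Y'_def algebra_simps)
    finally show "(\<Sum>e\<in>Basis. D2 i e)
       = 4 * (of_nat (p i * q i) * cinner (b i) (a i) * x i ^ (p i - 1) * y i ^ (q i - 1) * r ^ j i
          + of_nat (j i) * (of_nat (p i + q i + j i + CARD('n)) - 1) * x i ^ p i * y i ^ q i * r ^ (j i - 1))"
      by (simp add: X_def Y_def R_def J_def)
  qed
  finally show ?thesis unfolding x_def y_def r_def .
qed

section \<open>The reproducing property\<close>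

text \<open>
  Each application of the Laplacian to such a combination lowers both exponents and produces a factor
  \<open>\<langle>b, a\<rangle>\<close>; all iterated Laplacians of a harmonic function are zero.
\<close>

lemma harmonic_contraction_vanishes:
  fixes a b :: "nat \<Rightarrow> complex ^ 'n::finite"
  assumes harm: "\<And>w. laplacian (\<lambda>w. \<Sum>i<N. c i * (cinner w (a i) ^ l * cinner (b i) w ^ l')) w = 0"
    and "Suc r \<le> l" "Suc r \<le> l'"
  shows "(\<Sum>i<N. c i * (cinner (b i) (a i) ^ Suc r * cinner w (a i) ^ (l - Suc r) * cinner (b i) w ^ (l' - Suc r))) = 0"
  using assms(2,3)
proof (induction r arbitrary: w)
  have lap: "laplacian (\<lambda>w. \<Sum>i<N. c i * (cinner (b i) (a i) ^ r * cinner w (a i) ^ (l - r) * cinner (b i) w ^ (l' - r))) w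
     = 4 * of_nat ((l - r) * (l' - r)) * (\<Sum>i<N. c i * (cinner (b i) (a i) ^ Suc r * cinner w (a i) ^ (l - Suc r) * cinner (b i) w ^ (l' - Suc r)))"
    for r w
    using laplacian_monomial_family[of "{..<N}" "\<lambda>i. c i * cinner (b i) (a i) ^ r" a "\<lambda>i. l - r" b "\<lambda>i. l' - r" "\<lambda>i. 0" w]
    by (simp add: sum_distrib_left mult_ac)
  {
    case 0
    thus ?case using lap[of 0 w] harm[of w] by simp
  next
    case (Suc r)
    have "(\<Sum>i<N. c i * (cinner (b i) (a i) ^ Suc r * cinner w (a i) ^ (l - Suc r) * cinner (b i) w ^ (l' - Suc r))) = 0" for w
      using Suc by simp
    hence "laplacian (\<lambda>w. \<Sum>i<N. c i * (cinner (b i) (a i) ^ Suc r * cinner w (a i) ^ (l - Suc r) * cinner (b i) w ^ (l' - Suc r))) w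
       = laplacian (\<lambda>w. 0) w" by simp
    also have "\<dots> = 0"
      by (subst laplacian_eqI[OF twice_dir_deriv_const]) simp
    finally have "4 * of_nat ((l - Suc r) * (l' - Suc r)) * (\<Sum>i<N. c i * (cinner (b i) (a i) ^ Suc (Suc r) *
        cinner w (a i) ^ (l - Suc (Suc r)) * cinner (b i) w ^ (l' - Suc (Suc r)))) = 0"
      unfolding lap .
    moreover have "4 * of_nat ((l - Suc r) * (l' - Suc r)) \<noteq> (0::complex)"
      using Suc.prems by (simp only: mult_eq_0_iff of_nat_eq_0_iff) simp
    ultimately show ?case by (simp only: mult_eq_0_iff) blast
  }
qed

text \<open>
  Insert the expansion of \<open>f\<close> into the mixed formula. The terms with a positive power of \<open>\<langle>b, a\<rangle>\<close> cancel by
  harmonicity, so only \<open>k = l\<close> survives, which occurs in the range of summation exactly when \<open>p = l\<close>.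
\<close>

lemma harmonic_poly_pairing:
  fixes z :: "complex ^ 'n::finite"
  assumes f: "harmonic_poly l l' f" and z: "norm z = 1" and P: "l + q = P" "l' + p = P" and p: "p \<le> l"
  shows "of_nat (P choose p) * (LINT w|surface_measure. f w * (cinner z w ^ p * cinner w z ^ q))
       = (if p = l then moment TYPE('n) P * f z else 0)"
proof -
  have fs: "form_span l l' f"
    using f by (intro form_span_bihomogeneous_polynomial) (auto simp: harmonic_poly_def)
  obtain N c a b where fe': "\<forall>w. f w = (\<Sum>i<(N::nat). c i * (cinner w (a i) ^ l * cinner (b i) w ^ l'))"
    using form_span_explicit[OF fs] by blast
  hence fe: "f w = (\<Sum>i<N. c i * (cinner w (a i) ^ l * cinner (b i) w ^ l'))" for w by blast
  have harm: "\<And>w. laplacian (\<lambda>w. \<Sum>i<N. c i * (cinner w (a i) ^ l * cinner (b i) w ^ l')) w = 0"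
    using f by (simp add: harmonic_poly_def fe[symmetric])
  define S where "S k = (\<Sum>i<N. c i * (cinner (b i) (a i) ^ (l - k) * cinner z (a i) ^ k * cinner (b i) z ^ (q - (p - k))))" for k
  have "of_nat (P choose p) * (LINT w|surface_measure. f w * (cinner z w ^ p * cinner w z ^ q))
      = of_nat (P choose p) * (LINT w|surface_measure. (\<Sum>i<N. c i * (cinner w (a i) ^ l * cinner w z ^ q * cinner (b i) w ^ l' * cinner z w ^ p)))"
    by (intro arg_cong[where f = "(*) _"] Bochner_Integration.integral_cong refl,
        unfold fe sum_distrib_right, intro sum.cong refl) (simp only: mult_ac)
  also have "\<dots> = (\<Sum>i<N. c i * (of_nat (P choose p) * (LINT w|surface_measure. cinner w (a i) ^ l * cinner w z ^ q * cinner (b i) w ^ l' * cinner z w ^ p)))"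
    by (subst Bochner_Integration.integral_sum)
       (auto intro!: integrable_surface_measure continuous_intros simp: sum_distrib_left mult_ac)
  also have "\<dots> = (\<Sum>i<N. c i * (moment TYPE('n) P * (\<Sum>k\<le>p. of_nat (l choose k) * of_nat (q choose (p - k)) *
        cinner (b i) (a i) ^ (l - k) * cinner z (a i) ^ k * cinner (b i) z ^ (q - (p - k)))))"
    by (simp only: integral_mixed_form[OF z P])
  also have "\<dots> = moment TYPE('n) P * (\<Sum>k\<le>p. of_nat (l choose k) * of_nat (q choose (p - k)) * S k)"
    unfolding S_def sum_distrib_left by (subst sum.swap) (simp only: mult_ac)
  also have "(\<Sum>k\<le>p. of_nat (l choose k) * of_nat (q choose (p - k)) * S k) = (\<Sum>k\<le>p. if k = l then f z else 0)"
  proof (intro sum.cong refl)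
    fix k assume k: "k \<in> {..p}"
    show "of_nat (l choose k) * of_nat (q choose (p - k)) * S k = (if k = l then f z else 0)"
    proof (cases "k = l")
      case True
      hence "p = l" "q = l'" using k p P by auto
      thus ?thesis using True by (simp add: S_def fe mult_ac)
    next
      case False
      show ?thesis
      proof (cases "p - k \<le> q")
        case True
        define r where "r = l - k - 1"
        have r: "l - k = Suc r" "l - Suc r = k" "q - (p - k) = l' - Suc r" "Suc r \<le> l" "Suc r \<le> l'"
          using False True k p P by (auto simp: r_def)
        have "S k = 0"
          using harmonic_contraction_vanishes[OF harm r(4,5), of z] unfolding S_def r by simp
        thus ?thesis using False by simp
      qed (use False in \<open>simp add: binomial_eq_0\<close>)
    qed
  qed
  also have "\<dots> = (if p = l then f z else 0)" using p by auto
  finally show ?thesis by simp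
qed

section \<open>Zonal harmonics in closed form\<close>

lemma Suc_times_choose_real:
  "real (Suc k) * real (n choose Suc k) = (real n - real k) * real (n choose k)"
proof (cases "k \<le> n")
  case True
  have "Suc k * (n choose Suc k) = (n - k) * (n choose k)"
    by (simp only: binomial_absorption binomial_absorb_comp)
  hence "real (Suc k * (n choose Suc k)) = real ((n - k) * (n choose k))" by (rule arg_cong)
  thus ?thesis using True by (simp only: of_nat_mult of_nat_diff)
qed (simp add: binomial_eq_0)

text \<open>
  A form of the Chu--Vandermonde identity, proved with Pascal's rule in \<open>l\<close>: the shifted part of the sum is
  the same sum for \<open>l' - 1\<close> and \<open>L - 1\<close>, up to the factor \<open>- l' / L\<close>.
\<close>

lemma alternating_binomial_ratio_sum:
  "l + l' \<le> L \<Longrightarrow>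
   (\<Sum>j\<le>l. (-1) ^ j * real (l choose j) * real (l' choose j) / real (L choose j)) * real (L choose l)
     = real ((L - l') choose l)"
proof (induction l arbitrary: l' L)
  case 0
  show ?case by simp
next
  case (Suc l)
  define S where "S l l' L = (\<Sum>j\<le>l. (-1) ^ j * real (l choose j) * real (l' choose j) / real (L choose j))" for l l' L
  show ?case
  proof (cases l')
    case 0
    have "(\<Sum>j\<le>Suc l. (-1) ^ j * real (Suc l choose j) * real (0 choose j) / real (L choose j))
        = (\<Sum>j\<in>{0}. (-1) ^ j * real (Suc l choose j) * real (0 choose j) / real (L choose j))"
      by (rule sum.mono_neutral_right) (auto simp: binomial_eq_0)
    thus ?thesis by (simp add: 0)
  next
    case (Suc k)
    obtain M where M: "L = Suc M" using Suc.prems by (cases L) auto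
    have lk: "l + k < M" using Suc.prems Suc M by simp
    have "S (Suc l) l' L = (\<Sum>j\<le>Suc l. (-1) ^ j * real (l choose j) * real (l' choose j) / real (L choose j))
        + (\<Sum>j\<le>Suc l. (-1) ^ j * real (if j = 0 then 0 else l choose (j - 1)) * real (l' choose j) / real (L choose j))"
      unfolding S_def sum.distrib[symmetric]
    proof (intro sum.cong refl)
      fix j
      have "real (Suc l choose j) = real (l choose j) + real (if j = 0 then 0 else l choose (j - 1))"
        by (cases j) auto
      thus "(-1) ^ j * real (Suc l choose j) * real (l' choose j) / real (L choose j)
        = (-1) ^ j * real (l choose j) * real (l' choose j) / real (L choose j)
         + (-1) ^ j * real (if j = 0 then 0 else l choose (j - 1)) * real (l' choose j) / real (L choose j)"
        by (simp only: distrib_left distrib_right add_divide_distrib)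
    qed
    also have "(\<Sum>j\<le>Suc l. (-1) ^ j * real (l choose j) * real (l' choose j) / real (L choose j)) = S l l' L"
      by (simp add: S_def binomial_eq_0)
    also have "(\<Sum>j\<le>Suc l. (-1) ^ j * real (if j = 0 then 0 else l choose (j - 1)) * real (l' choose j) / real (L choose j))
       = (\<Sum>j\<le>l. - (real l' / real L) * ((-1) ^ j * real (l choose j) * real (k choose j) / real (M choose j)))"
    proof -
      have "(\<Sum>j\<le>Suc l. (-1) ^ j * real (if j = 0 then 0 else l choose (j - 1)) * real (l' choose j) / real (L choose j))
         = (\<Sum>j\<le>l. - ((-1) ^ j * real (l choose j) * real (l' choose Suc j) / real (L choose Suc j)))"
        by (subst sum.atMost_Suc_shift) (simp del: binomial_Suc_Suc)
      also have "\<dots> = (\<Sum>j\<le>l. - (real l' / real L) * ((-1) ^ j * real (l choose j) * real (k choose j) / real (M choose j)))"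
      proof (intro sum.cong refl)
      fix j assume j: "j \<in> {..l}"
      have a: "real (Suc j) * real (l' choose Suc j) = real l' * real (k choose j)"
        using Suc_times_binomial[of j k] unfolding Suc of_nat_mult[symmetric] by (simp only:)
      have b: "real (Suc j) * real (L choose Suc j) = real L * real (M choose j)"
        using Suc_times_binomial[of j M] unfolding M of_nat_mult[symmetric] by (simp only:)
      have "real (l' choose Suc j) / real (L choose Suc j) = (real (Suc j) * real (l' choose Suc j)) / (real (Suc j) * real (L choose Suc j))"
        by (simp del: of_nat_Suc)
      also have "\<dots> = (real l' / real L) * (real (k choose j) / real (M choose j))"
        unfolding a b by simp
      finally have "(-1) ^ j * real (l choose j) * (real (l' choose Suc j) / real (L choose Suc j))
          = (-1) ^ j * real (l choose j) * ((real l' / real L) * (real (k choose j) / real (M choose j)))" by (rule arg_cong)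
      thus "- ((-1) ^ j * real (l choose j) * real (l' choose Suc j) / real (L choose Suc j))
          = - (real l' / real L) * ((-1) ^ j * real (l choose j) * real (k choose j) / real (M choose j))"
        by (simp add: mult_ac del: binomial_Suc_Suc)
      qed
      finally show ?thesis .
    qed
    also have "\<dots> = - (real l' / real L) * S l k M" by (simp only: S_def sum_distrib_left[symmetric])
    finally have rec: "S (Suc l) l' L = S l l' L - (real l' / real L) * S l k M" by simp
    define B where "B = real ((L - l') choose l)"
    have s1: "S l l' L * real (L choose l) = B"
      unfolding S_def B_def using Suc.prems by (intro Suc.IH) simp
    have s2: "S l k M * real (M choose l) = B"
    proof -
      have "M - k = L - l'" by (simp add: Suc M)
      thus ?thesis using Suc.IH[of k M] lk unfolding S_def B_def by simp
    qed
    have c0: "real (L choose l) \<noteq> 0" "real (M choose l) \<noteq> 0" "real L > 0" using lk M by auto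
    have Ll: "real L - real l > 0" using lk M by simp
    have c1: "(real L - real l) * real (L choose l) = real L * real (M choose l)"
      using Suc_times_choose_real[of l L] Suc_times_binomial[of l M, THEN arg_cong[where f = real]]
      by (simp only: M of_nat_mult)
    have c2: "real (Suc l) * real (L choose Suc l) = (real L - real l) * real (L choose l)"
      by (rule Suc_times_choose_real)
    have c3: "real (Suc l) * real ((L - l') choose Suc l) = (real L - real l' - real l) * B"
      using Suc_times_choose_real[of l "L - l'"] Suc.prems by (simp add: B_def)
    have "real (Suc l) * (S (Suc l) l' L * real (L choose Suc l))
        = S (Suc l) l' L * ((real L - real l) * real (L choose l))"
      unfolding c2[symmetric] by (simp only: mult_ac)
    also have "\<dots> = (real L - real l) * (S l l' L * real (L choose l))
        - (real l' / real L) * (S l k M * ((real L - real l) * real (L choose l)))"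
      unfolding rec by (simp only: left_diff_distrib right_diff_distrib mult_ac)
    also have "\<dots> = (real L - real l) * B - real l' * (S l k M * real (M choose l))"
      unfolding s1 c1 using c0 by (simp add: field_simps)
    also have "\<dots> = (real L - real l' - real l) * B" unfolding s2 by (simp add: algebra_simps)
    also have "\<dots> = real (Suc l) * real ((L - l') choose Suc l)" by (rule c3[symmetric])
    finally have "S (Suc l) l' L * real (L choose Suc l) = real ((L - l') choose Suc l)"
      by (simp only: mult_cancel_left) simp
    thus ?thesis unfolding S_def .
  qed
qed

text \<open>
  The coefficients are those that make the sum in \<open>zonal_poly\<close> harmonic, normalized to be \<open>1\<close> for
  \<open>j = 0\<close>; on the sphere the sum is a Jacobi polynomial in \<open>\<bar>\<langle>w, z\<rangle>\<bar>\<^sup>2\<close> times a power of \<open>\<langle>w, z\<rangle>\<close> or of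
  its conjugate.
\<close>

definition zonal_coeff :: "nat \<Rightarrow> nat \<Rightarrow> nat \<Rightarrow> nat \<Rightarrow> real" where
  "zonal_coeff n l l' j = (-1) ^ j * real (l choose j) * real (l' choose j) / real ((l + l' + n - 2) choose j)"

text \<open>
  The quotient of the binomial coefficient of \<open>l + l'\<close> over \<open>l\<close> by the moment of order \<open>l + l'\<close>: the inverse of the
  factor in \<open>harmonic_poly_pairing\<close>.
\<close>

definition zonal_const :: "'n::finite itself \<Rightarrow> nat \<Rightarrow> nat \<Rightarrow> real" where
  "zonal_const T l l' = real ((l + l') choose l) * fact (l + l' + CARD('n) - 1)
     / (sphere_mass T * fact (l + l') * fact (CARD('n) - 1))"

definition zonal_poly :: "nat \<Rightarrow> nat \<Rightarrow> complex ^ 'n::finite \<Rightarrow> complex ^ 'n \<Rightarrow> complex" where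
  "zonal_poly l l' z w = of_real (zonal_const TYPE('n) l l') *
     (\<Sum>j\<le>min l l'. of_real (zonal_coeff CARD('n) l l' j) *
        (cinner w z ^ (l - j) * cinner z w ^ (l' - j) * cinner w w ^ j))"

definition bimonomial :: "nat \<Rightarrow> nat \<Rightarrow> complex ^ 'n::finite \<Rightarrow> complex ^ 'n \<Rightarrow> complex" where
  "bimonomial p q z w = cinner w z ^ p * cinner z w ^ q"

lemma zonal_coeff_0 [simp]: "zonal_coeff n l l' 0 = 1"
  by (simp add: zonal_coeff_def)

lemma zonal_coeff_1: "zonal_coeff n l l' (Suc 0) = - (real l * real l' / real (l + l' + n - 2))"
  by (simp add: zonal_coeff_def)

lemma zonal_coeff_Suc:
  assumes "n \<ge> 2" "j < min l l'"
  shows "zonal_coeff n l l' (Suc j) * real (Suc j) * (real (l + l' + n) - 2 - real j)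
     = - zonal_coeff n l l' j * (real l - real j) * (real l' - real j)"
proof -
  define L where "L = l + l' + n - 2"
  have L: "real (l + l' + n) - 2 = real L" using assms by (simp add: L_def of_nat_diff)
  have jL: "j < L" using assms by (auto simp: L_def)
  have a: "real (Suc j) * real (l choose Suc j) = (real l - real j) * real (l choose j)"
   and b: "real (Suc j) * real (l' choose Suc j) = (real l' - real j) * real (l' choose j)"
   and c: "real (Suc j) * real (L choose Suc j) = (real L - real j) * real (L choose j)"
    by (rule Suc_times_choose_real)+
  have pos: "real (L choose Suc j) > 0" "real (L choose j) > 0" "real L - real j > 0" using jL by auto
  have c': "(real L - real j) / real (L choose Suc j) = real (Suc j) / real (L choose j)"
    using c pos by (simp add: field_simps del: of_nat_Suc)
  have "zonal_coeff n l l' (Suc j) * real (Suc j) * (real L - real j)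
      = - ((-1) ^ j) * real (l choose Suc j) * real (Suc j) * real (l' choose Suc j) * ((real L - real j) / real (L choose Suc j))"
    by (simp add: zonal_coeff_def L_def[symmetric] del: of_nat_Suc)
  also have "\<dots> = - ((-1) ^ j) * (real (Suc j) * real (l choose Suc j)) * (real (Suc j) * real (l' choose Suc j)) / real (L choose j)"
    unfolding c' by (simp del: of_nat_Suc)
  also have "\<dots> = - zonal_coeff n l l' j * (real l - real j) * (real l' - real j)"
    unfolding a b zonal_coeff_def L_def[symmetric] by simp
  finally show ?thesis unfolding L .
qed

lemma zonal_const_pos: "zonal_const TYPE('n::finite) l l' > 0"
  unfolding zonal_const_def using sphere_mass_pos[where 'n='n] by simp

lemma zonal_const_moment:
  "of_real (zonal_const TYPE('n::finite) l l') * moment TYPE('n) (l + l') = of_nat ((l + l') choose l)"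
proof -
  define F D :: real where "F = fact (l + l' + CARD('n) - 1)"
    and "D = sphere_mass TYPE('n) * fact (l + l') * fact (CARD('n) - 1)"
  have FD: "F \<noteq> 0" "D \<noteq> 0" using sphere_mass_pos[where 'n='n] by (simp_all add: F_def D_def)
  have "zonal_const TYPE('n) l l' * (D / F) = real ((l + l') choose l)"
    unfolding zonal_const_def F_def[symmetric] D_def[symmetric] using FD by simp
  moreover have "moment TYPE('n) (l + l') = of_real (D / F)"
    unfolding moment_eq F_def D_def ..
  ultimately show ?thesis by (metis of_real_mult of_real_of_nat_eq)
qed

lemma polynomial_function_complex_mult:
  fixes f g :: "'a::euclidean_space \<Rightarrow> complex"
  assumes "polynomial_function f" "polynomial_function g"
  shows "polynomial_function (\<lambda>x. f x * g x)"
proof -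
  have "real_polynomial_function (\<lambda>x. Re (f x))" "real_polynomial_function (\<lambda>x. Im (f x))"
    "real_polynomial_function (\<lambda>x. Re (g x))" "real_polynomial_function (\<lambda>x. Im (g x))"
    using assms bounded_linear_Re bounded_linear_Im by (auto simp: polynomial_function_def o_def)
  thus ?thesis
    unfolding polynomial_function_iff_Basis_inner Basis_complex_def
    by (auto intro!: real_polynomial_function_diff real_polynomial_function.intros(3,4))
qed

lemma polynomial_function_complex_power:
  fixes f :: "'a::euclidean_space \<Rightarrow> complex"
  shows "polynomial_function f \<Longrightarrow> polynomial_function (\<lambda>x. f x ^ k)"
  by (induction k) (auto intro: polynomial_function_complex_mult)

lemma polynomial_function_cinner:
  fixes a :: "complex ^ 'n::finite"
  shows "polynomial_function (\<lambda>w. cinner w a)" "polynomial_function (\<lambda>w. cinner a w)"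
        "polynomial_function (\<lambda>w::complex ^ 'n. cinner w w)"
proof -
  have 1: "polynomial_function (\<lambda>w::complex ^ 'n. w $ j)" for j
    by (rule polynomial_function_bounded_linear) (rule bounded_linear_vec_nth)
  have 2: "polynomial_function (\<lambda>w::complex ^ 'n. cnj (w $ j))" for j
    by (rule polynomial_function_bounded_linear)
       (rule bounded_linear_compose[OF bounded_linear_cnj bounded_linear_vec_nth])
  show "polynomial_function (\<lambda>w. cinner w a)" "polynomial_function (\<lambda>w. cinner a w)"
        "polynomial_function (\<lambda>w::complex ^ 'n. cinner w w)"
    unfolding cinner_def
    by (intro polynomial_function_sum polynomial_function_complex_mult 1 2 polynomial_function_const finite)+
qed

lemma continuous_on_zonal_poly [continuous_intros]: "continuous_on S (zonal_poly l l' z)"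
  unfolding zonal_poly_def by (intro continuous_intros)

lemma continuous_on_bimonomial [continuous_intros]: "continuous_on S (bimonomial p q z)"
  unfolding bimonomial_def by (intro continuous_intros)

text \<open>
  By \<open>laplacian_monomial_family\<close> the Laplacian of the \<open>j\<close>-th term has two parts, and \<open>zonal_coeff_Suc\<close> says
  that the second part for \<open>j + 1\<close> cancels the first part for \<open>j\<close>.
\<close>

lemma harmonic_poly_zonal_poly:
  fixes z :: "complex ^ 'n::finite"
  assumes n: "CARD('n) \<ge> 2" and z: "norm z = 1"
  shows "harmonic_poly l l' (zonal_poly l l' z)"
  unfolding harmonic_poly_def
proof (intro conjI allI)
  show "polynomial_function (zonal_poly l l' z)"
    unfolding zonal_poly_def
    by (intro polynomial_function_sum polynomial_function_complex_mult polynomial_function_complex_power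
        polynomial_function_cinner polynomial_function_const finite_atMost)
next
  fix c w
  have "cinner (c *s w) z ^ (l - j) * cinner z (c *s w) ^ (l' - j) * cinner (c *s w) (c *s w) ^ j
      = c ^ l * cnj c ^ l' * (cinner w z ^ (l - j) * cinner z w ^ (l' - j) * cinner w w ^ j)"
    if "j \<le> min l l'" for j
  proof -
    have "c ^ l = c ^ (l - j) * c ^ j" "cnj c ^ l' = cnj c ^ (l' - j) * cnj c ^ j"
      using that by (simp_all add: power_add[symmetric])
    thus ?thesis
      by (simp add: cinner_scale_left cinner_scale_right power_mult_distrib)
  qed
  thus "zonal_poly l l' z (c *s w) = c ^ l * cnj c ^ l' * zonal_poly l l' z w"
    unfolding zonal_poly_def by (simp add: sum_distrib_left mult_ac)
next
  fix w
  define C where "C j = (of_real (zonal_const TYPE('n) l l' * zonal_coeff CARD('n) l l' j) :: complex)" for j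
  define x y r where "x = cinner w z" and "y = cinner z w" and "r = cinner w w"
  define A where "A j = C j * of_nat ((l - j) * (l' - j)) * (x ^ (l - j - 1) * y ^ (l' - j - 1) * r ^ j)" for j
  define B where "B j = C j * of_nat j * (of_nat ((l - j) + (l' - j) + j + CARD('n)) - 1) * (x ^ (l - j) * y ^ (l' - j) * r ^ (j - 1))" for j
  define m where "m = min l l'"
  have zz: "cinner z z = 1" using z by (simp add: cinner_self)
  have "zonal_poly l l' z = (\<lambda>w. \<Sum>j\<le>m. C j * (cinner w z ^ (l - j) * cinner z w ^ (l' - j) * cinner w w ^ j))"
    by (simp add: zonal_poly_def C_def m_def sum_distrib_left mult_ac fun_eq_iff)
  hence "laplacian (zonal_poly l l' z) w
     = (\<Sum>j\<le>m. C j * (4 * (of_nat ((l - j) * (l' - j)) * cinner z z * cinner w z ^ (l - j - 1) * cinner z w ^ (l' - j - 1) * cinner w w ^ j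
          + of_nat j * (of_nat ((l - j) + (l' - j) + j + CARD('n)) - 1) * cinner w z ^ (l - j) * cinner z w ^ (l' - j) * cinner w w ^ (j - 1))))"
    using laplacian_monomial_family[OF finite_atMost[of m], of C "\<lambda>_. z" "\<lambda>j. l - j" "\<lambda>_. z" "\<lambda>j. l' - j" "\<lambda>j. j" w]
    by simp
  also have "\<dots> = (\<Sum>j\<le>m. 4 * (A j + B j))"
    unfolding zz A_def B_def x_def y_def r_def by (intro sum.cong refl) (simp add: algebra_simps)
  also have "\<dots> = 4 * ((\<Sum>j\<le>m. A j) + (\<Sum>j\<le>m. B j))"
    by (simp only: sum_distrib_left[symmetric] sum.distrib)
  also have "(\<Sum>j\<le>m. A j) = (\<Sum>j<m. A j)"
    by (simp add: lessThan_Suc_atMost[symmetric]) (auto simp: A_def m_def min_def)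
  also have "(\<Sum>j\<le>m. B j) = (\<Sum>j<m. B (Suc j))"
    by (simp only: lessThan_Suc_atMost[symmetric] sum.lessThan_Suc_shift) (simp add: B_def)
  also have "(\<Sum>j<m. B (Suc j)) = (\<Sum>j<m. - A j)"
  proof (intro sum.cong refl)
    fix j assume "j \<in> {..<m}"
    hence j: "j < min l l'" by (simp add: m_def)
    have eq: "zonal_coeff CARD('n) l l' (Suc j) * (real (Suc j) * (real (l + l' + CARD('n)) - 2 - real j))
         = - (zonal_coeff CARD('n) l l' j * (real ((l - j) * (l' - j))))"
      using zonal_coeff_Suc[OF n j] j by (simp add: of_nat_diff mult.assoc del: of_nat_Suc)
    have nn: "of_nat ((l - Suc j) + (l' - Suc j) + Suc j + CARD('n)) - 1
        = (of_real (real (l + l' + CARD('n)) - 2 - real j) :: complex)"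
      using j by (simp add: of_nat_diff)
    have "C (Suc j) * of_nat (Suc j) * (of_nat ((l - Suc j) + (l' - Suc j) + Suc j + CARD('n)) - 1)
       = of_real (zonal_const TYPE('n) l l' * (zonal_coeff CARD('n) l l' (Suc j) * (real (Suc j) * (real (l + l' + CARD('n)) - 2 - real j))))"
      unfolding nn C_def by (simp only: of_real_mult of_real_of_nat_eq mult.assoc)
    also have "\<dots> = - (C j * of_nat ((l - j) * (l' - j)))"
      unfolding eq C_def by (simp only: of_real_mult of_real_of_nat_eq of_real_minus mult_minus_right mult.assoc)
    finally show "B (Suc j) = - A j" unfolding A_def B_def by simp
  qed
  finally show "laplacian (zonal_poly l l' z) w = 0" by (simp add: sum_negf)
qed

lemma zonal_poly_on_sphere:
  assumes "norm w = 1"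
  shows "zonal_poly l l' z w = of_real (zonal_const TYPE('n::finite) l l') *
     (\<Sum>j\<le>min l l'. of_real (zonal_coeff CARD('n) l l' j) * bimonomial (l - j) (l' - j) (z :: complex ^ 'n) w)"
  using assms by (simp add: zonal_poly_def bimonomial_def cinner_self)

lemma sphere_integral_cong:
  fixes f g :: "complex ^ 'n::finite \<Rightarrow> 'b::{banach, second_countable_topology}"
  shows "(\<And>w. norm w = 1 \<Longrightarrow> f w = g w) \<Longrightarrow> (LINT w|surface_measure. f w) = (LINT w|surface_measure. g w)"
  by (rule Bochner_Integration.integral_cong) auto

lemma continuous_on_harmonic_poly: "harmonic_poly l l' f \<Longrightarrow> continuous_on S f"
  by (auto simp: harmonic_poly_def intro: continuous_on_polymonial_function)

text \<open>
  These two identities determine the zonal harmonics: every inner product with a polynomial in \<open>\<langle>w, z\<rangle>\<close> and its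
  conjugate is computed from them.
\<close>

lemma L2_inner_bimonomial:
  fixes z :: "complex ^ 'n::finite"
  assumes f: "harmonic_poly l l' f" and z: "norm z = 1" and P: "l + q = l' + p"
  shows "p < l \<Longrightarrow> L2_inner f (bimonomial p q z) = 0"
    and "p = l \<Longrightarrow> of_real (zonal_const TYPE('n) l l') * L2_inner f (bimonomial p q z) = f z"
proof -
  have eq: "L2_inner f (bimonomial p q z) = (LINT w|surface_measure. f w * (cinner z w ^ p * cinner w z ^ q))"
    by (simp add: L2_inner_def bimonomial_def cnj_cinner)
  {
    assume "p < l"
    hence "of_nat ((l + q) choose p) * L2_inner f (bimonomial p q z) = 0"
      unfolding eq using harmonic_poly_pairing[OF f z refl P[symmetric]] by simp
    moreover have "(l + q) choose p \<noteq> 0" using P by simp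
    ultimately show "L2_inner f (bimonomial p q z) = 0" by simp
  next
    assume p: "p = l"
    hence q: "q = l'" using P by simp
    have "of_nat ((l + l') choose l) * L2_inner f (bimonomial p q z) = moment TYPE('n) (l + l') * f z"
      unfolding eq using harmonic_poly_pairing[OF f z refl P[symmetric]] p q by simp
    hence "moment TYPE('n) (l + l') * (of_real (zonal_const TYPE('n) l l') * L2_inner f (bimonomial p q z))
        = moment TYPE('n) (l + l') * f z"
      unfolding zonal_const_moment[where 'n='n, of l l', symmetric] by (simp only: mult_ac)
    moreover have "moment TYPE('n) (l + l') \<noteq> 0"
      using zonal_const_moment[where 'n='n, of l l'] by (auto simp: binomial_eq_0_iff)
    ultimately show "of_real (zonal_const TYPE('n) l l') * L2_inner f (bimonomial p q z) = f z"
      unfolding mult_cancel_left by blast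
  }
qed

lemma L2_inner_zonal_poly_sum:
  fixes z :: "complex ^ 'n::finite"
  assumes f: "continuous_on (sphere 0 1) f"
  shows "L2_inner f (\<lambda>w. bimonomial s s z w * zonal_poly k k' z w) = of_real (zonal_const TYPE('n) k k') *
     (\<Sum>j\<le>min k k'. of_real (zonal_coeff CARD('n) k k' j) * L2_inner f (bimonomial (s + k - j) (s + k' - j) z))"
proof -
  have "L2_inner f (\<lambda>w. bimonomial s s z w * zonal_poly k k' z w) = (LINT w|surface_measure.
     (\<Sum>j\<le>min k k'. of_real (zonal_const TYPE('n) k k') * (of_real (zonal_coeff CARD('n) k k' j) *
        (f w * cnj (bimonomial (s + k - j) (s + k' - j) z w)))))"
    unfolding L2_inner_def
  proof (rule sphere_integral_cong)
    fix w :: "complex ^ 'n" assume w: "norm w = 1"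
    have "f w * cnj (bimonomial s s z w * zonal_poly k k' z w) = (\<Sum>j\<le>min k k'. of_real (zonal_const TYPE('n) k k') *
        (of_real (zonal_coeff CARD('n) k k' j) * (f w * cnj (bimonomial s s z w * bimonomial (k - j) (k' - j) z w))))"
      unfolding zonal_poly_on_sphere[OF w] complex_cnj_mult cnj_sum complex_cnj_complex_of_real sum_distrib_left
      by (intro sum.cong refl) (simp only: mult_ac)
    also have "\<dots> = (\<Sum>j\<le>min k k'. of_real (zonal_const TYPE('n) k k') * (of_real (zonal_coeff CARD('n) k k' j) *
        (f w * cnj (bimonomial (s + k - j) (s + k' - j) z w))))"
    proof (intro sum.cong refl)
      fix j assume "j \<in> {..min k k'}"
      hence "s + k - j = s + (k - j)" "s + k' - j = s + (k' - j)" by auto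
      hence "bimonomial s s z w * bimonomial (k - j) (k' - j) z w = bimonomial (s + k - j) (s + k' - j) z w"
        by (simp add: bimonomial_def power_add)
      thus "of_real (zonal_const TYPE('n) k k') *
        (of_real (zonal_coeff CARD('n) k k' j) * (f w * cnj (bimonomial s s z w * bimonomial (k - j) (k' - j) z w)))
        = (of_real (zonal_const TYPE('n) k k') * (of_real (zonal_coeff CARD('n) k k' j) *
        (f w * cnj (bimonomial (s + k - j) (s + k' - j) z w))) :: complex)" by simp
    qed
    finally show "f w * cnj (bimonomial s s z w * zonal_poly k k' z w) = \<dots>" .
  qed
  also have "\<dots> = of_real (zonal_const TYPE('n) k k') *
     (\<Sum>j\<le>min k k'. of_real (zonal_coeff CARD('n) k k' j) * L2_inner f (bimonomial (s + k - j) (s + k' - j) z))"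
    unfolding L2_inner_def
    by (subst Bochner_Integration.integral_sum)
       (auto intro!: integrable_surface_measure continuous_intros f simp only: sum_distrib_left integral_mult_right_zero)
  finally show ?thesis .
qed

lemma L2_inner_zonal_poly:
  fixes z :: "complex ^ 'n::finite"
  assumes f: "harmonic_poly l l' f" and z: "norm z = 1"
  shows "L2_inner f (zonal_poly l l' z) = f z"
proof -
  have "L2_inner f (zonal_poly l l' z) = of_real (zonal_const TYPE('n) l l') *
     (\<Sum>j\<le>min l l'. of_real (zonal_coeff CARD('n) l l' j) * L2_inner f (bimonomial (l - j) (l' - j) z))"
    using L2_inner_zonal_poly_sum[OF continuous_on_harmonic_poly[OF f], of 0 z l l'] by (simp add: bimonomial_def)
  also have "(\<Sum>j\<le>min l l'. of_real (zonal_coeff CARD('n) l l' j) * L2_inner f (bimonomial (l - j) (l' - j) z))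
      = (\<Sum>j\<in>{0}. of_real (zonal_coeff CARD('n) l l' j) * L2_inner f (bimonomial (l - j) (l' - j) z))"
  proof (rule sum.mono_neutral_right)
    show "\<forall>j\<in>{..min l l'} - {0}. of_real (zonal_coeff CARD('n) l l' j) * L2_inner f (bimonomial (l - j) (l' - j) z) = 0"
    proof
      fix j assume j: "j \<in> {..min l l'} - {0}"
      hence "l + (l' - j) = l' + (l - j)" "l - j < l" by auto
      hence "L2_inner f (bimonomial (l - j) (l' - j) z) = 0"
        by (rule L2_inner_bimonomial(1)[OF f z])
      thus "of_real (zonal_coeff CARD('n) l l' j) * L2_inner f (bimonomial (l - j) (l' - j) z) = 0" by simp
    qed
  qed auto
  also have "of_real (zonal_const TYPE('n) l l') * \<dots> = f z"
    using L2_inner_bimonomial(2)[OF f z, of l' l] by simp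
  finally show ?thesis .
qed

lemma L2_inner_swap: "L2_inner f g = cnj (L2_inner g f)"
proof -
  have "L2_inner f g = (LINT x|surface_measure. cnj (g x * cnj (f x)))"
    unfolding L2_inner_def by (intro Bochner_Integration.integral_cong refl) simp
  also have "\<dots> = cnj (L2_inner g f)" unfolding L2_inner_def by (rule Bochner_Integration.integral_cnj)
  finally show ?thesis .
qed

text \<open>
  The polynomial reproduces point evaluations. An element \<open>Y\<close> of the same space that does so at \<open>z\<close> is
  determined at every \<open>v\<close>, since \<open>Y v\<close> is the inner product of \<open>Y\<close> with the reproducing element \<open>R v\<close>, hence the
  conjugate of \<open>R v z\<close>.
\<close>

lemma zonal_eq:
  fixes z :: "complex ^ 'n::finite"
  assumes n: "CARD('n) \<ge> 2" and z: "norm z = 1"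
  shows "zonal l l' z = restrict (zonal_poly l l' z) (sphere 0 1)"
proof -
  have rL: "L2_inner (restrict f (sphere 0 1)) (restrict g (sphere 0 1)) = L2_inner f g" for f g :: "complex ^ 'n \<Rightarrow> complex"
    unfolding L2_inner_def by (rule sphere_integral_cong) simp
  define R where "R v = restrict (zonal_poly l l' v) (sphere 0 1)" for v :: "complex ^ 'n"
  have Rin: "R v \<in> sph_harm l l'" if "norm v = 1" for v
    using harmonic_poly_zonal_poly[OF n that] by (auto simp: R_def sph_harm_def)
  have Rrep: "f v = L2_inner f (R v)" if f: "f \<in> sph_harm l l'" and v: "norm v = 1" for f v
  proof -
    from f obtain g where g: "f = restrict g (sphere 0 1)" "harmonic_poly l l' g"
      by (auto simp: sph_harm_def)
    show ?thesis using L2_inner_zonal_poly[OF g(2) v] v by (simp add: g(1) R_def rL)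
  qed
  show ?thesis
    unfolding zonal_def R_def[symmetric]
  proof (rule the_equality)
    show "R z \<in> sph_harm l l' \<and> (\<forall>f\<in>sph_harm l l'. f z = L2_inner f (R z))"
      using Rin[OF z] Rrep[OF _ z] by blast
  next
    fix Y assume Y: "Y \<in> sph_harm l l' \<and> (\<forall>f\<in>sph_harm l l'. f z = L2_inner f Y)"
    show "Y = R z"
    proof
      fix v
      show "Y v = R z v"
      proof (cases "norm v = 1")
        case True
        have "Y v = L2_inner Y (R v)" using Y Rrep True by blast
        also have "\<dots> = cnj (L2_inner (R v) Y)" by (rule L2_inner_swap)
        also have "L2_inner (R v) Y = R v z" using Y Rin[OF True] by simp
        also have "R v z = L2_inner (R v) (R z)" using Rrep[OF Rin[OF True] z] .
        also have "cnj \<dots> = L2_inner (R z) (R v)" by (rule L2_inner_swap[symmetric])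
        also have "\<dots> = R z v" using Rrep[OF Rin[OF z] True] by simp
        finally show ?thesis .
      next
        case False
        have "Y v = undefined" using Y False by (auto simp: sph_harm_def)
        thus ?thesis using False by (simp add: R_def)
      qed
    qed
  qed
qed

section \<open>Norms and orthogonality of zonal harmonics\<close>

text \<open>
  This is the dimension of the space of harmonics of bidegree \<open>(l, l')\<close> divided by the area of the sphere.
\<close>

definition zonal_norm2 :: "'n::finite itself \<Rightarrow> nat \<Rightarrow> nat \<Rightarrow> real" where
  "zonal_norm2 T l l' = real ((l + CARD('n) - 2) choose l) * real ((l' + CARD('n) - 2) choose l')
     * (real (l + l' + CARD('n)) - 1) / ((real CARD('n) - 1) * sphere_mass T)"

lemma zonal_poly_at_pole:
  fixes z :: "complex ^ 'n::finite"
  assumes n: "CARD('n) \<ge> 2" and z: "norm z = 1"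
  shows "zonal_poly l l' z z = of_real (zonal_norm2 TYPE('n) l l')"
proof -
  obtain m where m: "CARD('n) = m + 2" using n by (metis add.commute le_Suc_ex)
  define \<mu> where "\<mu> = sphere_mass TYPE('n)"
  have \<mu>: "\<mu> > 0" unfolding \<mu>_def by (rule sphere_mass_pos)
  define S where "S = (\<Sum>j\<le>min l l'. zonal_coeff CARD('n) l l' j)"
  have "S = (\<Sum>j\<le>l. (-1) ^ j * real (l choose j) * real (l' choose j) / real ((l + l' + m) choose j))"
    unfolding S_def zonal_coeff_def m
    by (rule sum.mono_neutral_cong_left) (auto simp: binomial_eq_0)
  hence "S * real ((l + l' + m) choose l) = real ((l + m) choose l)"
    using alternating_binomial_ratio_sum[of l l' "l + l' + m"] by simp
  hence S: "S = real ((l + m) choose l) / real ((l + l' + m) choose l)"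
    by (simp add: eq_divide_eq)
  have "zonal_const TYPE('n) l l' * S = zonal_norm2 TYPE('n) l l'"
  proof -
    have b1: "real ((l + l') choose l) = fact (l + l') / (fact l * fact l')"
      using binomial_fact[of l "l + l'", where 'a=real] by simp
    have b2: "real ((l + l' + m) choose l) = fact (l + l' + m) / (fact l * fact (l' + m))"
      using binomial_fact[of l "l + l' + m", where 'a=real] by (simp add: add.assoc)
    have b3: "real ((l' + m) choose l') = fact (l' + m) / (fact l' * fact m)"
      using binomial_fact[of l' "l' + m", where 'a=real] by simp
    have f1: "fact (l + l' + CARD('n) - 1) = real (l + l' + m + 1) * fact (l + l' + m)"
      by (simp add: m)
    have f2: "fact (CARD('n) - 1) = real (m + 1) * fact m" by (simp add: m)
    have lhs: "zonal_const TYPE('n) l l' * S = (fact (l + l') / (fact l * fact l')) * (real (l + l' + m + 1) * fact (l + l' + m))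
        / (\<mu> * fact (l + l') * (real (m + 1) * fact m)) * (real ((l + m) choose l) / (fact (l + l' + m) / (fact l * fact (l' + m))))"
      unfolding zonal_const_def S b1 b2 f1 f2 \<mu>_def ..
    have rhs: "zonal_norm2 TYPE('n) l l' = real ((l + m) choose l) * (fact (l' + m) / (fact l' * fact m))
        * real (l + l' + m + 1) / (real (m + 1) * \<mu>)"
      unfolding zonal_norm2_def b3[symmetric] \<mu>_def by (simp add: m)
    define B where "B = real ((l + m) choose l)"
    define X1 X2 X3 X4 X5 X6 :: real where "X1 = fact (l + l')" and "X2 = fact l" and "X3 = fact l'"
      and "X4 = fact (l + l' + m)" and "X5 = fact m" and "X6 = fact (l' + m)"
    define p q where "p = real (l + l' + m + 1)" and "q = real (m + 1)"
    have nz: "X1 \<noteq> 0" "X2 \<noteq> 0" "X3 \<noteq> 0" "X4 \<noteq> 0" "X5 \<noteq> 0" "X6 \<noteq> 0" "q \<noteq> 0" "\<mu> \<noteq> 0"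
      using \<mu> by (simp_all add: X1_def X2_def X3_def X4_def X5_def X6_def q_def)
    show ?thesis
      unfolding lhs rhs B_def[symmetric] X1_def[symmetric] X2_def[symmetric] X3_def[symmetric] X4_def[symmetric]
        X5_def[symmetric] X6_def[symmetric] p_def[symmetric] q_def[symmetric]
      using nz by (simp add: divide_simps)
  qed
  moreover have "zonal_poly l l' z z = of_real (zonal_const TYPE('n) l l' * S)"
    using z by (simp add: zonal_poly_on_sphere bimonomial_def cinner_self S_def)
  ultimately show ?thesis by simp
qed

lemma orthogonal_transformation_phase:
  assumes c: "cmod c = 1"
  shows "orthogonal_transformation (\<lambda>w :: complex ^ 'n::finite. c *s w)"
  unfolding orthogonal_transformation
proof (intro conjI allI linearI)
  show "c *s (x + y) = c *s x + c *s y" for x y :: "complex ^ 'n" by (simp add: vec_eq_iff algebra_simps)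
  show "c *s (r *\<^sub>R x) = r *\<^sub>R (c *s x)" for r and x :: "complex ^ 'n" by (simp add: vec_eq_iff)
  show "norm (c *s x) = norm x" for x :: "complex ^ 'n"
  proof -
    have "of_real ((norm (c *s x))\<^sup>2) = (c * cnj c) * cinner x x"
      unfolding cinner_self[symmetric] cinner_scale_left cinner_scale_right by (simp only: mult_ac)
    also have "\<dots> = of_real ((norm x)\<^sup>2)" using c by (simp add: complex_norm_square[symmetric] cinner_self)
    finally have "(norm (c *s x))\<^sup>2 = (norm x)\<^sup>2" unfolding of_real_eq_iff .
    thus ?thesis by simp
  qed
qed

text \<open>
  A rotation of all coordinates by one phase multiplies the integral by \<open>-1\<close>, if the phase is suitable.
\<close>

lemma phase_integral_zero:
  fixes g :: "complex ^ 'n::finite \<Rightarrow> complex"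
  assumes cont: "continuous_on (sphere 0 1) g" and ne: "(a::nat) \<noteq> b"
    and hom: "\<And>c w. cmod c = 1 \<Longrightarrow> g (c *s w) = c ^ a * cnj c ^ b * g w"
  shows "(LINT w|surface_measure. g w) = 0"
proof -
  define \<theta> where "\<theta> = pi / (real a - real b)"
  define c where "c = cis \<theta>"
  have c1: "cmod c = 1" by (simp add: c_def)
  have "c ^ a * cnj c ^ b = cis (real a * \<theta>) * cis (real b * (- \<theta>))"
    unfolding c_def cis_cnj Complex.DeMoivre ..
  also have "\<dots> = cis (real a * \<theta> - real b * \<theta>)" by (simp add: cis_mult)
  also have "real a * \<theta> - real b * \<theta> = (real a - real b) * \<theta>" by (simp add: algebra_simps)
  also have "\<dots> = pi" using ne by (simp add: \<theta>_def)
  finally have "c ^ a * cnj c ^ b = -1" by simp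
  hence "g (c *s w) = - g w" for w using hom[OF c1, of w] by simp
  hence "(LINT w|surface_measure. - g w) = (LINT w|surface_measure. g (c *s w))" by simp
  also have "\<dots> = (LINT w|surface_measure. g w)"
    by (rule integral_surface_measure_orthogonal[OF orthogonal_transformation_phase[OF c1] cont])
  finally show ?thesis by simp
qed

lemma L2_inner_bimonomial_degrees:
  fixes z :: "complex ^ 'n::finite"
  assumes f: "harmonic_poly l l' f" and ne: "l + q \<noteq> l' + p"
  shows "L2_inner f (bimonomial p q z) = 0"
  unfolding L2_inner_def
proof (rule phase_integral_zero[OF _ ne])
  show "continuous_on (sphere 0 1) (\<lambda>w. f w * cnj (bimonomial p q z w))"
    by (intro continuous_intros continuous_on_harmonic_poly[OF f])
  fix c w assume "cmod c = 1"
  show "f (c *s w) * cnj (bimonomial p q z (c *s w)) = c ^ (l + q) * cnj c ^ (l' + p) * (f w * cnj (bimonomial p q z w))"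
    using f by (simp add: harmonic_poly_def bimonomial_def cinner_scale_left cinner_scale_right power_mult_distrib
        power_add mult_ac)
qed

text \<open>
  With \<open>s = 0\<close> this gives the orthogonality of zonal harmonics of different bidegrees, with \<open>s = 1\<close> that
  multiplication by \<open>\<bar>\<langle>w, z\<rangle>\<bar>\<^sup>2\<close> is tridiagonal: it raises the degree by at most one step, and it
  is symmetric.
\<close>

lemma L2_inner_zonal_poly_lower:
  fixes z :: "complex ^ 'n::finite"
  assumes f: "harmonic_poly l l' f" and z: "norm z = 1"
    and deg: "l + k' \<noteq> l' + k \<or> s + k < l"
  shows "L2_inner f (\<lambda>w. bimonomial s s z w * zonal_poly k k' z w) = 0"
proof -
  have "L2_inner f (bimonomial (s + k - j) (s + k' - j) z) = 0" if j: "j \<le> min k k'" for j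
  proof (cases "l + k' = l' + k")
    case True
    hence "l + (s + k' - j) = l' + (s + k - j)" "s + k - j < l" using j deg by auto
    thus ?thesis by (rule L2_inner_bimonomial(1)[OF f z])
  next
    case False
    hence "l + (s + k' - j) \<noteq> l' + (s + k - j)" using j by auto
    thus ?thesis by (rule L2_inner_bimonomial_degrees[OF f])
  qed
  thus ?thesis
    by (simp add: L2_inner_zonal_poly_sum[OF continuous_on_harmonic_poly[OF f]])
qed

lemma bimonomial_diag: "bimonomial s s z w = of_real ((cmod (cinner w z)) ^ (2 * s))"
proof -
  have "bimonomial s s z w = (cinner w z * cnj (cinner w z)) ^ s"
    by (simp add: bimonomial_def power_mult_distrib cnj_cinner)
  also have "\<dots> = of_real ((cmod (cinner w z))\<^sup>2) ^ s" by (simp only: complex_norm_square)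
  finally show ?thesis by (simp add: power_mult)
qed

lemma L2_inner_zonal_poly_orthogonal:
  fixes z :: "complex ^ 'n::finite"
  assumes n: "CARD('n) \<ge> 2" and z: "norm z = 1"
    and deg: "l + k' \<noteq> l' + k \<or> s + k < l \<or> s + l < k"
  shows "L2_inner (zonal_poly l l' z) (\<lambda>w. bimonomial s s z w * zonal_poly k k' z w) = 0"
proof (cases "l + k' \<noteq> l' + k \<or> s + k < l")
  case True
  thus ?thesis by (rule L2_inner_zonal_poly_lower[OF harmonic_poly_zonal_poly[OF n z] z])
next
  case False
  hence "k + l' \<noteq> k' + l \<or> s + l < k" using deg by auto
  hence "L2_inner (zonal_poly k k' z) (\<lambda>w. bimonomial s s z w * zonal_poly l l' z w) = 0"
    by (rule L2_inner_zonal_poly_lower[OF harmonic_poly_zonal_poly[OF n z] z])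
  moreover have "L2_inner (zonal_poly l l' z) (\<lambda>w. bimonomial s s z w * zonal_poly k k' z w)
     = cnj (L2_inner (zonal_poly k k' z) (\<lambda>w. bimonomial s s z w * zonal_poly l l' z w))"
  proof -
    have "L2_inner (zonal_poly l l' z) (\<lambda>w. bimonomial s s z w * zonal_poly k k' z w)
       = L2_inner (\<lambda>w. bimonomial s s z w * zonal_poly l l' z w) (zonal_poly k k' z)"
      unfolding L2_inner_def bimonomial_diag by (simp add: mult_ac)
    thus ?thesis by (subst L2_inner_swap) simp
  qed
  ultimately show ?thesis by simp
qed

lemma L2_inner_zonal_poly_self:
  fixes z :: "complex ^ 'n::finite"
  assumes n: "CARD('n) \<ge> 2" and z: "norm z = 1"
  shows "L2_inner (zonal_poly l l' z) (zonal_poly l l' z) = of_real (zonal_norm2 TYPE('n) l l')"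
  using L2_inner_zonal_poly[OF harmonic_poly_zonal_poly[OF n z] z, of l l'] zonal_poly_at_pole[OF n z, of l l'] by simp

lemma sum_atMost_first_two:
  fixes g :: "nat \<Rightarrow> 'a::comm_monoid_add"
  assumes "\<And>j. 2 \<le> j \<Longrightarrow> j \<le> m \<Longrightarrow> g j = 0" "m = 0 \<Longrightarrow> g 1 = 0"
  shows "(\<Sum>j\<le>m. g j) = g 0 + g 1"
proof (cases "m = 0")
  case False
  have "(\<Sum>j\<le>m. g j) = (\<Sum>j\<in>{0, 1}. g j)"
    using False assms(1) by (intro sum.mono_neutral_right) (auto simp: numeral_2_eq_2 Suc_le_eq)
  thus ?thesis by simp
qed (use assms in simp)

text \<open>
  Only the two leading terms of \<open>\<bar>\<langle>w, z\<rangle>\<bar>\<^sup>2 Z\<close> have a nonzero product with \<open>Z\<close>. The product with the second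
  is given by the reproducing property. The leading term is, up to normalization, that of the zonal harmonic of
  bidegree \<open>(l + 1, l' + 1)\<close>, which is orthogonal to \<open>Z\<close>; this expresses the first product by the second.
\<close>

lemma L2_inner_zonal_poly_multiplied:
  fixes z :: "complex ^ 'n::finite"
  assumes n: "CARD('n) \<ge> 2" and z: "norm z = 1"
  shows "L2_inner (zonal_poly l l' z) (\<lambda>w. bimonomial 1 1 z w * zonal_poly l l' z w)
    = of_real (zonal_norm2 TYPE('n) l l' *
        (zonal_coeff CARD('n) l l' 1 - zonal_coeff CARD('n) (Suc l) (Suc l') 1))"
proof -
  define f where "f = zonal_poly l l' z"
  have hf: "harmonic_poly l l' f" unfolding f_def by (rule harmonic_poly_zonal_poly[OF n z])
  have cf: "continuous_on (sphere 0 1) f" by (rule continuous_on_harmonic_poly[OF hf])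
  define I where "I j = L2_inner f (bimonomial (Suc l - j) (Suc l' - j) z)" for j
  have I2: "I j = 0" if "2 \<le> j" "j \<le> min (Suc l) (Suc l')" for j
  proof -
    have "l + (Suc l' - j) = l' + (Suc l - j)" "Suc l - j < l" using that by auto
    thus ?thesis unfolding I_def by (rule L2_inner_bimonomial(1)[OF hf z])
  qed
  have "of_real (zonal_const TYPE('n) l l') * I 1 = f z"
    using L2_inner_bimonomial(2)[OF hf z, of l' l] by (simp add: I_def)
  hence I1: "of_real (zonal_const TYPE('n) l l') * I 1 = of_real (zonal_norm2 TYPE('n) l l')"
    by (simp add: f_def zonal_poly_at_pole[OF n z])
  have "0 = L2_inner f (\<lambda>w. bimonomial 0 0 z w * zonal_poly (Suc l) (Suc l') z w)"
    unfolding f_def by (rule L2_inner_zonal_poly_orthogonal[OF n z, symmetric]) simp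
  also have "\<dots> = of_real (zonal_const TYPE('n) (Suc l) (Suc l')) *
     (\<Sum>j\<le>min (Suc l) (Suc l'). of_real (zonal_coeff CARD('n) (Suc l) (Suc l') j) * I j)"
    unfolding L2_inner_zonal_poly_sum[OF cf] I_def by simp
  also have "(\<Sum>j\<le>min (Suc l) (Suc l'). of_real (zonal_coeff CARD('n) (Suc l) (Suc l') j) * I j)
     = of_real (zonal_coeff CARD('n) (Suc l) (Suc l') 0) * I 0 + of_real (zonal_coeff CARD('n) (Suc l) (Suc l') 1) * I 1"
    by (rule sum_atMost_first_two) (simp_all add: I2)
  finally have I0: "I 0 = - of_real (zonal_coeff CARD('n) (Suc l) (Suc l') 1) * I 1"
    using zonal_const_pos[where 'n='n, of "Suc l" "Suc l'"] by (simp add: add_eq_0_iff)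
  have "L2_inner f (\<lambda>w. bimonomial 1 1 z w * zonal_poly l l' z w)
     = of_real (zonal_const TYPE('n) l l') * (\<Sum>j\<le>min l l'. of_real (zonal_coeff CARD('n) l l' j) * I j)"
    unfolding L2_inner_zonal_poly_sum[OF cf] I_def by simp
  also have "(\<Sum>j\<le>min l l'. of_real (zonal_coeff CARD('n) l l' j) * I j)
     = of_real (zonal_coeff CARD('n) l l' 0) * I 0 + of_real (zonal_coeff CARD('n) l l' 1) * I 1"
  proof (rule sum_atMost_first_two)
    show "min l l' = 0 \<Longrightarrow> of_real (zonal_coeff CARD('n) l l' 1) * I 1 = 0"
      by (auto simp: zonal_coeff_1 min_def split: if_splits)
    show "of_real (zonal_coeff CARD('n) l l' j) * I j = 0" if "2 \<le> j" "j \<le> min l l'" for j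
      using I2[of j] that by simp
  qed
  also have "of_real (zonal_const TYPE('n) l l') * \<dots>
     = (of_real (zonal_const TYPE('n) l l') * I 1) * of_real (zonal_coeff CARD('n) l l' 1 - zonal_coeff CARD('n) (Suc l) (Suc l') 1)"
    unfolding I0 by (simp add: algebra_simps)
  also have "\<dots> = of_real (zonal_norm2 TYPE('n) l l' * (zonal_coeff CARD('n) l l' 1 - zonal_coeff CARD('n) (Suc l) (Suc l') 1))"
    unfolding I1 by simp
  finally show ?thesis unfolding f_def .
qed

lemma cmod_cinner_le: "cmod (cinner x y) \<le> norm x * norm y"
proof -
  define c where "c = cinner x y"
  define \<omega> where "\<omega> = (if c = 0 then 1 else cnj (sgn c))"
  have \<omega>: "cmod \<omega> = 1" by (simp add: \<omega>_def norm_sgn)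
  have "\<omega> * c = of_real (cmod c)"
  proof (cases "c = 0")
    case False
    have "cnj c * c = of_real (cmod c) * of_real (cmod c)"
      by (metis complex_norm_square mult.commute of_real_mult power2_eq_square)
    thus ?thesis using False by (simp add: \<omega>_def sgn_eq field_simps)
  qed (simp add: \<omega>_def)
  hence "cmod c = Re (cinner (\<omega> *s x) y)" by (simp add: cinner_scale_left c_def)
  also have "\<dots> = (\<omega> *s x) \<bullet> y" by (simp add: inner_eq_Re_cinner)
  also have "\<dots> \<le> norm (\<omega> *s x) * norm y" by (rule norm_cauchy_schwarz)
  also have "norm (\<omega> *s x) = norm x"
    using orthogonal_transformation_phase[OF \<omega>] by (auto simp: orthogonal_transformation)
  finally show ?thesis by (simp add: c_def)
qed

lemma cmod_cinner_swap: "cmod (cinner z w) = cmod (cinner w z)"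
  by (metis cnj_cinner complex_mod_cnj)

lemma varpi_squared:
  assumes "norm z = 1" "norm w = 1"
  shows "(varpi z w)\<^sup>2 = 1 - (cmod (cinner w z))\<^sup>2"
proof -
  have "(cmod (cinner z w))\<^sup>2 \<le> 1"
    using cmod_cinner_le[of z w] assms by (simp add: power_le_one)
  thus ?thesis by (simp add: varpi_def cmod_cinner_swap)
qed

lemma varpi_squared_bimonomial:
  assumes "norm z = 1" "norm w = 1"
  shows "complex_of_real ((varpi z w)\<^sup>2) = 1 - bimonomial 1 1 z w"
    and "cnj (bimonomial 1 1 z w) = bimonomial 1 1 z w"
  unfolding varpi_squared[OF assms] bimonomial_diag by simp_all

lemma varpi_nonneg: "norm z = 1 \<Longrightarrow> norm w = 1 \<Longrightarrow> 0 \<le> varpi z w"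
  using cmod_cinner_le[of z w] by (simp add: varpi_def power_le_one)

lemma continuous_on_varpi [continuous_intros]: "continuous_on S (varpi z)"
  unfolding varpi_def by (intro continuous_intros)

lemma continuous_on_weight:
  fixes z :: "complex ^ 'n::finite"
  assumes z: "norm z = 1"
  shows "continuous_on (sphere 0 1) (\<lambda>w. (1 + real N * varpi z w) powr p)"
proof (intro continuous_intros)
  show "\<forall>w\<in>sphere 0 1. 1 + real N * varpi z w \<noteq> 0"
  proof
    fix w :: "complex ^ 'n" assume "w \<in> sphere 0 1"
    hence "varpi z w \<ge> 0" using varpi_nonneg[OF z] by simp
    hence "1 + real N * varpi z w > 0" by (simp add: add_pos_nonneg)
    thus "1 + real N * varpi z w \<noteq> 0" by simp
  qed
qed

lemma norm_add_power2_le: "(norm (a + b))\<^sup>2 \<le> 2 * (norm a)\<^sup>2 + 2 * (norm b)\<^sup>2"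
  for a b :: "'a::real_normed_vector"
proof -
  have "(norm (a + b))\<^sup>2 \<le> (norm a + norm b)\<^sup>2" by (intro power_mono norm_triangle_ineq) auto
  also have "\<dots> \<le> 2 * (norm a)\<^sup>2 + 2 * (norm b)\<^sup>2"
    using zero_le_power2[of "norm a - norm b"] by (simp add: power2_eq_square algebra_simps)
  finally show ?thesis .
qed

lemma weighted_orthogonal_sum:
  fixes \<omega> :: "complex ^ 'n::finite \<Rightarrow> real"
  assumes F: "finite F" and cont: "continuous_on (sphere 0 1) \<omega>" "\<And>i. i \<in> F \<Longrightarrow> continuous_on (sphere 0 1) (\<phi> i)"
    and orth: "\<And>i j. i \<in> F \<Longrightarrow> j \<in> F \<Longrightarrow> i \<noteq> j \<Longrightarrow> (LINT w|surface_measure. of_real (\<omega> w) * (\<phi> i w * cnj (\<phi> j w))) = 0"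
  shows "(LINT w|surface_measure. \<omega> w * (cmod (\<Sum>i\<in>F. c i * \<phi> i w))\<^sup>2)
       = (\<Sum>i\<in>F. (cmod (c i))\<^sup>2 * (LINT w|surface_measure. \<omega> w * (cmod (\<phi> i w))\<^sup>2))"
proof -
  have "of_real (LINT w|surface_measure. \<omega> w * (cmod (\<Sum>i\<in>F. c i * \<phi> i w))\<^sup>2)
      = (LINT w|surface_measure. (\<Sum>i\<in>F. \<Sum>j\<in>F. (c i * cnj (c j)) * (of_real (\<omega> w) * (\<phi> i w * cnj (\<phi> j w)))))"
    unfolding integral_complex_of_real[symmetric]
  proof (rule sphere_integral_cong)
    fix w
    show "complex_of_real (\<omega> w * (cmod (\<Sum>i\<in>F. c i * \<phi> i w))\<^sup>2)
      = (\<Sum>i\<in>F. \<Sum>j\<in>F. (c i * cnj (c j)) * (of_real (\<omega> w) * (\<phi> i w * cnj (\<phi> j w))))"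
      unfolding of_real_mult complex_norm_square cnj_sum sum_product complex_cnj_mult
      by (simp only: sum_distrib_left, intro sum.cong refl) (simp only: mult_ac)
  qed
  also have "\<dots> = (\<Sum>i\<in>F. \<Sum>j\<in>F. (c i * cnj (c j)) * (LINT w|surface_measure. of_real (\<omega> w) * (\<phi> i w * cnj (\<phi> j w))))"
    by (subst Bochner_Integration.integral_sum, intro integrable_surface_measure continuous_intros cont, assumption, assumption,
        intro sum.cong refl, subst Bochner_Integration.integral_sum, intro integrable_surface_measure continuous_intros cont,
        assumption, assumption) simp
  also have "\<dots> = (\<Sum>i\<in>F. of_real ((cmod (c i))\<^sup>2 * (LINT w|surface_measure. \<omega> w * (cmod (\<phi> i w))\<^sup>2)))"
  proof (intro sum.cong refl)
    fix i assume i: "i \<in> F"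
    have "(\<Sum>j\<in>F. (c i * cnj (c j)) * (LINT w|surface_measure. of_real (\<omega> w) * (\<phi> i w * cnj (\<phi> j w))))
       = (\<Sum>j\<in>{i}. (c i * cnj (c j)) * (LINT w|surface_measure. of_real (\<omega> w) * (\<phi> i w * cnj (\<phi> j w))))"
      using i F by (intro sum.mono_neutral_right) (auto simp: orth)
    also have "\<dots> = of_real ((cmod (c i))\<^sup>2) * (LINT w|surface_measure. of_real (\<omega> w * (cmod (\<phi> i w))\<^sup>2))"
      by (simp add: complex_norm_square[symmetric])
    also have "\<dots> = of_real ((cmod (c i))\<^sup>2 * (LINT w|surface_measure. \<omega> w * (cmod (\<phi> i w))\<^sup>2))"
      by (subst integral_complex_of_real) (simp only: of_real_mult)
    finally show "(\<Sum>j\<in>F. (c i * cnj (c j)) * (LINT w|surface_measure. of_real (\<omega> w) * (\<phi> i w * cnj (\<phi> j w)))) = \<dots>" .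
  qed
  finally show ?thesis by (simp only: of_real_sum[symmetric] of_real_eq_iff)
qed

lemma integral_norm_zonal_sum:
  fixes z :: "complex ^ 'n::finite"
  assumes n: "CARD('n) \<ge> 2" and z: "norm z = 1" and F: "finite F"
  shows "(LINT w|surface_measure. (cmod (\<Sum>E\<in>F. c E * zonal_poly (fst E) (snd E) z w))\<^sup>2)
       = (\<Sum>E\<in>F. (cmod (c E))\<^sup>2 * zonal_norm2 TYPE('n) (fst E) (snd E))"
proof -
  have ip: "(LINT w|surface_measure. of_real 1 * (zonal_poly l l' z w * cnj (zonal_poly k k' z w)))
      = L2_inner (zonal_poly l l' z) (zonal_poly k k' z)" for l l' k k' by (simp add: L2_inner_def)
  have nrm: "(LINT w|surface_measure. 1 * (cmod (zonal_poly l l' z w))\<^sup>2) = zonal_norm2 TYPE('n) l l'" for l l'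
  proof -
    have "of_real (LINT w|surface_measure. 1 * (cmod (zonal_poly l l' z w))\<^sup>2)
        = L2_inner (zonal_poly l l' z) (zonal_poly l l' z)"
      unfolding integral_complex_of_real[symmetric] L2_inner_def by (simp add: complex_norm_square del: of_real_power)
    thus ?thesis by (simp only: L2_inner_zonal_poly_self[OF n z] of_real_eq_iff)
  qed
  have "(LINT w|surface_measure. 1 * (cmod (\<Sum>E\<in>F. c E * zonal_poly (fst E) (snd E) z w))\<^sup>2)
       = (\<Sum>E\<in>F. (cmod (c E))\<^sup>2 * (LINT w|surface_measure. 1 * (cmod (zonal_poly (fst E) (snd E) z w))\<^sup>2))"
  proof (rule weighted_orthogonal_sum[OF F])
    fix E E' :: "nat \<times> nat" assume "E \<noteq> E'"
    hence "fst E + snd E' \<noteq> snd E + fst E' \<or> 0 + fst E' < fst E \<or> 0 + fst E < fst E'"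
      by (cases E; cases E') auto
    from L2_inner_zonal_poly_orthogonal[OF n z this]
    show "(LINT w|surface_measure. of_real 1 * (zonal_poly (fst E) (snd E) z w * cnj (zonal_poly (fst E') (snd E') z w))) = 0"
      unfolding ip by (simp add: bimonomial_def)
  qed (intro continuous_intros)+
  thus ?thesis by (simp only: nrm) simp
qed

text \<open>
  The mean of \<open>\<varpi>\<^sup>2\<close> with respect to \<open>\<bar>Z\<bar>\<^sup>2\<close>, up to constants.
\<close>

definition polar_spread :: "nat \<Rightarrow> nat \<Rightarrow> real" where
  "polar_spread l l' = (real (min l l') + 1) / (real (max l l') + 1)"

text \<open>
  With \<open>S = l + l' + n\<close>, the integral is exactly the norm times \<open>(n - 1) / S + 2 l l' / (S (S - 2))\<close>.
\<close>

lemma varpi_integral_bound: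
  fixes z :: "complex ^ 'n::finite"
  assumes n: "CARD('n) \<ge> 2" and z: "norm z = 1"
  shows "(LINT w|surface_measure. (varpi z w)\<^sup>2 * (cmod (zonal_poly l l' z w))\<^sup>2)
     \<le> (real CARD('n) + 1) * polar_spread l l' * zonal_norm2 TYPE('n) l l'"
proof -
  define S where "S = real (l + l' + CARD('n))"
  define a b where "a = real (min l l')" and "b = real (max l l')"
  have ab: "real l * real l' = a * b" "real l + real l' = a + b" "0 \<le> a" "0 \<le> b"
    by (auto simp: a_def b_def min_def max_def)
  have S: "S = a + b + real CARD('n)" using ab by (simp add: S_def)
  have nn: "real CARD('n) \<ge> 2" using n by simp
  define \<rho> where "\<rho> = 1 - (zonal_coeff CARD('n) l l' 1 - zonal_coeff CARD('n) (Suc l) (Suc l') 1)"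
  have h: "zonal_norm2 TYPE('n) l l' \<ge> 0"
    unfolding zonal_norm2_def using sphere_mass_pos[where 'n='n] nn by (auto intro!: divide_nonneg_pos)
  have "of_real (LINT w|surface_measure. (varpi z w)\<^sup>2 * (cmod (zonal_poly l l' z w))\<^sup>2)
     = L2_inner (zonal_poly l l' z) (zonal_poly l l' z) - L2_inner (zonal_poly l l' z) (\<lambda>w. bimonomial 1 1 z w * zonal_poly l l' z w)"
    unfolding integral_complex_of_real[symmetric] L2_inner_def
    by (subst Bochner_Integration.integral_diff[symmetric], (intro integrable_surface_measure continuous_intros)+,
        rule sphere_integral_cong)
       (simp only: of_real_mult varpi_squared_bimonomial[OF z] complex_norm_square complex_cnj_mult left_diff_distrib right_diff_distrib mult_1 mult_1_right mult_ac)
  also have "\<dots> = of_real (zonal_norm2 TYPE('n) l l' * \<rho>)"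
    unfolding L2_inner_zonal_poly_self[OF n z] L2_inner_zonal_poly_multiplied[OF n z] \<rho>_def
    by (simp add: algebra_simps)
  finally have eq: "(LINT w|surface_measure. (varpi z w)\<^sup>2 * (cmod (zonal_poly l l' z w))\<^sup>2) = zonal_norm2 TYPE('n) l l' * \<rho>"
    unfolding of_real_eq_iff .
  have c1: "zonal_coeff CARD('n) l l' 1 = - (a * b / (S - 2))"
    using n ab by (simp add: zonal_coeff_1 S_def of_nat_diff)
  have c2: "zonal_coeff CARD('n) (Suc l) (Suc l') 1 = - ((a * b + a + b + 1) / S)"
  proof -
    have "(real l + 1) * (real l' + 1) = a * b + a + b + 1" using ab by (simp add: algebra_simps)
    thus ?thesis using n by (simp add: zonal_coeff_1 S_def of_nat_diff)
       (simp add: algebra_simps)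
  qed
  have Spos: "S > 0" "S \<ge> b + 1" "S - 2 \<ge> a + b" using S nn ab by auto
  \<comment> \<open>For \<open>a b = 0\<close> the denominator \<open>S - 2\<close> may vanish, and the term containing it is absent.\<close>
  have "\<rho> \<le> (real CARD('n) + 1) * ((a + 1) / (b + 1))"
  proof (cases "a * b = 0")
    case True
    have "\<rho> = (S - (a + b + 1)) / S" unfolding \<rho>_def c1 c2 True using Spos by (simp add: field_simps)
    also have "\<dots> = (real CARD('n) - 1) / S" by (simp add: S)
    also have "\<dots> \<le> (real CARD('n) - 1) / (b + 1)"
      using Spos ab nn by (intro divide_left_mono) auto
    also have "\<dots> \<le> (real CARD('n) + 1) * (a + 1) / (b + 1)"
      using ab nn by (intro divide_right_mono) (auto simp: algebra_simps)
    finally show ?thesis by simp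
  next
    case False
    hence ab0: "a > 0" "b > 0" using ab by auto
    hence S2: "S - 2 > 0" using Spos by linarith
    have "\<rho> = (real CARD('n) - 1) / S + 2 * a * b / (S * (S - 2))"
    proof -
      have "\<rho> * (S * (S - 2)) = (real CARD('n) - 1) * (S - 2) + 2 * a * b"
      proof -
        have \<nu>: "real CARD('n) = S - a - b" by (simp add: S)
        have expand: "(1 + u - v) * (S * (S - 2)) = S * (S - 2) + (u * (S - 2)) * S - (v * S) * (S - 2)" for u v
          by (simp add: algebra_simps)
        have "\<rho> = 1 + a * b / (S - 2) - (a * b + a + b + 1) / S" unfolding \<rho>_def c1 c2 by simp
        hence "\<rho> * (S * (S - 2)) = S * (S - 2) + (a * b / (S - 2) * (S - 2)) * S - ((a * b + a + b + 1) / S * S) * (S - 2)"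
          using expand[of "a * b / (S - 2)" "(a * b + a + b + 1) / S"] by simp
        also have "\<dots> = S * (S - 2) + a * b * S - (a * b + a + b + 1) * (S - 2)" using Spos S2 by simp
        also have "\<dots> = (real CARD('n) - 1) * (S - 2) + 2 * a * b" unfolding \<nu> by (simp add: algebra_simps)
        finally show ?thesis .
      qed
      hence "\<rho> = ((real CARD('n) - 1) * (S - 2) + 2 * a * b) / (S * (S - 2))"
        using Spos S2 by (simp add: eq_divide_eq)
      also have "\<dots> = (real CARD('n) - 1) / S + 2 * a * b / (S * (S - 2))"
        using S2 by (simp add: add_divide_distrib)
      finally show ?thesis .
    qed
    also have "(real CARD('n) - 1) / S \<le> (real CARD('n) - 1) * (a + 1) / (b + 1)"
      using Spos ab nn mult_nonneg_nonneg[of "real CARD('n) - 1" a] by (intro frac_le) (auto simp: algebra_simps)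
    also have "2 * a * b / (S * (S - 2)) \<le> 2 * (a + 1) / (b + 1)"
    proof -
      have "2 * a * b / (S * (S - 2)) = (2 * a / S) * (b / (S - 2))" by simp
      also have "\<dots> \<le> (2 * (a + 1) / (b + 1)) * 1"
        using Spos S2 ab ab0 by (intro mult_mono frac_le) (auto simp: field_simps)
      finally show ?thesis by simp
    qed
    finally have "\<rho> \<le> (real CARD('n) - 1) * (a + 1) / (b + 1) + 2 * (a + 1) / (b + 1)" by simp
    also have "\<dots> = ((real CARD('n) - 1) * (a + 1) + 2 * (a + 1)) / (b + 1)" by (simp only: add_divide_distrib)
    also have "(real CARD('n) - 1) * (a + 1) + 2 * (a + 1) = (real CARD('n) + 1) * (a + 1)" by (simp add: algebra_simps)
    finally show ?thesis by simp
  qed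
  hence "zonal_norm2 TYPE('n) l l' * \<rho> \<le> zonal_norm2 TYPE('n) l l' * ((real CARD('n) + 1) * ((a + 1) / (b + 1)))"
    using h by (intro mult_left_mono) auto
  thus ?thesis unfolding eq polar_spread_def a_def b_def by (simp only: mult_ac)
qed

text \<open>
  The form of \<open>\<varpi>\<^sup>2\<close> couples only neighbouring bidegrees with the same difference \<open>l - l'\<close>. Bidegrees
  whose first entries have the same parity are never neighbours, so on each of the two parity classes the form is
  diagonal.
\<close>

lemma varpi_integral_zonal_sum_bound:
  fixes z :: "complex ^ 'n::finite"
  assumes n: "CARD('n) \<ge> 2" and z: "norm z = 1" and F: "finite F"
  shows "(LINT w|surface_measure. (varpi z w)\<^sup>2 * (cmod (\<Sum>E\<in>F. c E * zonal_poly (fst E) (snd E) z w))\<^sup>2)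
       \<le> 2 * (real CARD('n) + 1) * (\<Sum>E\<in>F. (cmod (c E))\<^sup>2 * (polar_spread (fst E) (snd E) * zonal_norm2 TYPE('n) (fst E) (snd E)))"
proof -
  define Z where "Z E = zonal_poly (fst E) (snd E) z" for E
  have cZ: "continuous_on S (Z E)" for S E unfolding Z_def by (intro continuous_intros)
  define K where "K = real CARD('n) + 1"
  define B where "B E = (cmod (c E))\<^sup>2 * (polar_spread (fst E) (snd E) * zonal_norm2 TYPE('n) (fst E) (snd E))" for E
  have ip: "(LINT w|surface_measure. of_real ((varpi z w)\<^sup>2) * (zonal_poly l l' z w * cnj (zonal_poly k k' z w)))
      = L2_inner (zonal_poly l l' z) (\<lambda>w. bimonomial 0 0 z w * zonal_poly k k' z w)
        - L2_inner (zonal_poly l l' z) (\<lambda>w. bimonomial 1 1 z w * zonal_poly k k' z w)" for l l' k k'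
    unfolding L2_inner_def
    by (subst Bochner_Integration.integral_diff[symmetric], (intro integrable_surface_measure continuous_intros)+,
        rule sphere_integral_cong)
       (simp only: varpi_squared_bimonomial[OF z] complex_cnj_mult left_diff_distrib right_diff_distrib bimonomial_def[of 0 0]
          power_0 complex_cnj_one mult_1 mult_1_right mult_ac)
  have part: "(LINT w|surface_measure. (varpi z w)\<^sup>2 * (cmod (\<Sum>E\<in>G. c E * Z E w))\<^sup>2) \<le> K * (\<Sum>E\<in>G. B E)"
    if G: "G \<subseteq> F" "\<And>E E'. E \<in> G \<Longrightarrow> E' \<in> G \<Longrightarrow> even (fst E) = even (fst E')" for G
  proof -
    have fG: "finite G" using G F finite_subset by blast
    have "(LINT w|surface_measure. (varpi z w)\<^sup>2 * (cmod (\<Sum>E\<in>G. c E * Z E w))\<^sup>2)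
       = (\<Sum>E\<in>G. (cmod (c E))\<^sup>2 * (LINT w|surface_measure. (varpi z w)\<^sup>2 * (cmod (Z E w))\<^sup>2))"
    proof (rule weighted_orthogonal_sum[OF fG])
      fix E E' :: "nat \<times> nat" assume E: "E \<in> G" "E' \<in> G" "E \<noteq> E'"
      obtain l l' k k' where EE: "E = (l, l')" "E' = (k, k')" by (cases E; cases E')
      have par: "even l = even k" using G(2)[OF E(1,2)] by (simp add: EE)
      have d: "l + k' \<noteq> l' + k \<or> s + k < l \<or> s + l < k" if "s \<le> 1" for s
      proof (rule ccontr)
        assume "\<not> ?thesis"
        hence *: "l + k' = l' + k" "l \<le> k + 1" "k \<le> l + 1" using that by auto
        have "l \<noteq> Suc k" "k \<noteq> Suc l" using par by auto
        hence "l = k" using * by linarith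
        thus False using * E(3) EE by auto
      qed
      show "(LINT w|surface_measure. of_real ((varpi z w)\<^sup>2) * (Z E w * cnj (Z E' w))) = 0"
        unfolding Z_def EE fst_conv snd_conv ip
        using L2_inner_zonal_poly_orthogonal[OF n z d[of 0]] L2_inner_zonal_poly_orthogonal[OF n z d[of 1]] by simp
    qed (intro continuous_intros cZ)+
    also have "\<dots> \<le> (\<Sum>E\<in>G. K * B E)"
    proof (rule sum_mono)
      fix E
      have "(cmod (c E))\<^sup>2 * (LINT w|surface_measure. (varpi z w)\<^sup>2 * (cmod (Z E w))\<^sup>2)
         \<le> (cmod (c E))\<^sup>2 * (K * polar_spread (fst E) (snd E) * zonal_norm2 TYPE('n) (fst E) (snd E))"
        unfolding Z_def K_def by (intro mult_left_mono varpi_integral_bound[OF n z]) auto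
      thus "(cmod (c E))\<^sup>2 * (LINT w|surface_measure. (varpi z w)\<^sup>2 * (cmod (Z E w))\<^sup>2) \<le> K * B E"
        by (simp add: B_def mult_ac)
    qed
    finally show ?thesis by (simp add: sum_distrib_left)
  qed
  define G0 G1 where "G0 = {E \<in> F. even (fst E)}" and "G1 = {E \<in> F. odd (fst E)}"
  have G: "F = G0 \<union> G1" "G0 \<inter> G1 = {}" "finite G0" "finite G1" using F by (auto simp: G0_def G1_def)
  define f where "f G w = (\<Sum>E\<in>G. c E * Z E w)" for G w
  have cf: "continuous_on (sphere 0 1) (f G)" for G unfolding f_def by (intro continuous_intros cZ)
  have fsplit: "f F w = f G0 w + f G1 w" for w
    unfolding f_def by (subst G(1)) (rule sum.union_disjoint[OF G(3,4,2)])
  have "(LINT w|surface_measure. (varpi z w)\<^sup>2 * (cmod (f F w))\<^sup>2)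
      \<le> (LINT w|surface_measure. 2 * ((varpi z w)\<^sup>2 * (cmod (f G0 w))\<^sup>2) + 2 * ((varpi z w)\<^sup>2 * (cmod (f G1 w))\<^sup>2))"
  proof (rule integral_mono)
    show "(varpi z w)\<^sup>2 * (cmod (f F w))\<^sup>2 \<le> 2 * ((varpi z w)\<^sup>2 * (cmod (f G0 w))\<^sup>2) + 2 * ((varpi z w)\<^sup>2 * (cmod (f G1 w))\<^sup>2)" for w
    proof -
      have "(cmod (f F w))\<^sup>2 \<le> 2 * (cmod (f G0 w))\<^sup>2 + 2 * (cmod (f G1 w))\<^sup>2"
        unfolding fsplit by (rule norm_add_power2_le)
      hence "(varpi z w)\<^sup>2 * (cmod (f F w))\<^sup>2 \<le> (varpi z w)\<^sup>2 * (2 * (cmod (f G0 w))\<^sup>2 + 2 * (cmod (f G1 w))\<^sup>2)"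
        by (intro mult_left_mono) auto
      thus ?thesis by (simp add: algebra_simps)
    qed
  qed (intro integrable_surface_measure continuous_intros cf)+
  also have "\<dots> = 2 * (LINT w|surface_measure. (varpi z w)\<^sup>2 * (cmod (f G0 w))\<^sup>2) + 2 * (LINT w|surface_measure. (varpi z w)\<^sup>2 * (cmod (f G1 w))\<^sup>2)"
    by (subst Bochner_Integration.integral_add) ((intro integrable_surface_measure continuous_intros cf)+, simp)
  also have "\<dots> \<le> 2 * (K * (\<Sum>E\<in>G0. B E)) + 2 * (K * (\<Sum>E\<in>G1. B E))"
    unfolding f_def by (intro add_mono mult_left_mono part) (auto simp: G0_def G1_def)
  also have "\<dots> = 2 * K * (\<Sum>E\<in>F. B E)"
    using sum.union_disjoint[OF G(3,4,2), of B] by (simp add: G(1)[symmetric] algebra_simps)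
  finally show ?thesis unfolding f_def Z_def K_def B_def .
qed

section \<open>Interpolation between the weights\<close>

text \<open>
  A single term suffices, that of the least \<open>j\<close> with \<open>T \<le> 4\<^sup>j\<close>.
\<close>

lemma powr_le_dyadic_sum:
  fixes T \<alpha> :: real
  assumes T: "1 \<le> T" "T \<le> 4 ^ J" and \<alpha>: "0 \<le> \<alpha>" "\<alpha> \<le> 1"
  shows "T powr \<alpha> \<le> 4 * (\<Sum>j\<le>J. (4 powr (\<alpha> - 1)) ^ j * min T (4 ^ j))"
proof -
  define q :: real where "q = 4 powr (\<alpha> - 1)"
  have q: "q > 0" "q \<ge> 1 / 4"
    using \<alpha> powr_mono[of "-1" "\<alpha> - 1" 4] by (auto simp: q_def powr_minus_divide)
  define j where "j = (LEAST j. T \<le> 4 ^ j)"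
  have Tj: "T \<le> 4 ^ j" unfolding j_def using T(2) by (rule LeastI)
  have jJ: "j \<le> J" unfolding j_def using T(2) by (rule Least_le)
  have "T powr \<alpha> \<le> 4 * (q ^ j * min T (4 ^ j))"
  proof (cases j)
    case 0
    thus ?thesis using Tj T by simp
  next
    case (Suc i)
    have "\<not> T \<le> 4 ^ i" using not_less_Least[of i "\<lambda>j. T \<le> 4 ^ j"] Suc by (auto simp: j_def)
    hence Ti: "4 ^ i \<le> T" by simp
    have "T powr \<alpha> = T * T powr (\<alpha> - 1)" using T by (simp add: powr_diff)
    also have "T powr (\<alpha> - 1) \<le> (4 ^ i) powr (\<alpha> - 1)"
      using Ti \<alpha> by (intro powr_mono2') auto
    also have "(4 ^ i :: real) powr (\<alpha> - 1) = q ^ i"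
      by (simp add: q_def powr_power powr_realpow[symmetric] powr_powr mult.commute)
    also have "T * q ^ i \<le> T * (4 * q ^ j)"
      using T q Suc by (intro mult_left_mono) auto
    finally show ?thesis using T Tj by (simp add: mult_ac)
  qed
  also have "\<dots> \<le> 4 * (\<Sum>j\<le>J. q ^ j * min T (4 ^ j))"
    using jJ q T by (intro mult_left_mono member_le_sum) auto
  finally show ?thesis unfolding q_def .
qed

lemma dyadic_sum_above:
  fixes x \<alpha> :: real
  assumes x: "x \<ge> 1" and \<alpha>: "\<alpha> < 1"
  shows "(\<Sum>j\<le>J. if x < 2 ^ j then (4 powr (\<alpha> - 1)) ^ j else 0) \<le> x powr (2 * \<alpha> - 2) / (1 - 4 powr (\<alpha> - 1))"
proof -
  define q :: real where "q = 4 powr (\<alpha> - 1)"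
  have q: "q > 0" "q < 1" using \<alpha> powr_less_mono[of "\<alpha> - 1" 0 4] by (auto simp: q_def)
  obtain i where "x < 2 ^ i" using real_arch_pow[of 2 x] by auto
  define m where "m = (LEAST j. x < 2 ^ j)"
  have m: "x < 2 ^ m" unfolding m_def using \<open>x < 2 ^ i\<close> by (rule LeastI)
  have mle: "m \<le> j" if "x < 2 ^ j" for j unfolding m_def using that by (rule Least_le)
  have qm: "q ^ m \<le> x powr (2 * \<alpha> - 2)"
  proof -
    have "q ^ m = (2 ^ m) powr (2 * \<alpha> - 2)"
    proof -
      have "(4::real) powr (\<alpha> - 1) = 2 powr (2 * \<alpha> - 2)"
        using powr_powr[of 2 2 "\<alpha> - 1"] by (simp add: algebra_simps)
      thus ?thesis by (simp add: q_def powr_power powr_realpow[symmetric] powr_powr mult.commute)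
    qed
    also have "\<dots> \<le> x powr (2 * \<alpha> - 2)" using x m \<alpha> by (intro powr_mono2') auto
    finally show ?thesis .
  qed
  have "(\<Sum>j\<le>J. if x < 2 ^ j then q ^ j else 0) = sum ((^) q) {j. j \<le> J \<and> x < 2 ^ j}"
    by (rule sum.inter_filter[symmetric, of "{..J}", simplified])
  also have "\<dots> \<le> sum ((^) q) {m..max m J}"
    using q mle by (intro sum_mono2) auto
  also have "\<dots> = (q ^ m - q ^ Suc (max m J)) / (1 - q)"
    using q sum_gp_multiplied[of m "max m J" q] by (simp add: eq_divide_eq mult.commute)
  also have "\<dots> \<le> x powr (2 * \<alpha> - 2) / (1 - q)"
    using q qm by (intro divide_right_mono) (auto intro: order.trans[OF _ qm])
  finally show ?thesis unfolding q_def .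
qed

lemma dyadic_sum_below:
  fixes x \<alpha> :: real
  assumes x: "x \<ge> 1" and \<alpha>: "\<alpha> > 0"
  shows "(\<Sum>j\<le>J. if x < 2 ^ j then 0 else (4 powr \<alpha>) ^ j) \<le> x powr (2 * \<alpha>) * (4 powr \<alpha> / (4 powr \<alpha> - 1))"
proof -
  define q :: real where "q = 4 powr \<alpha>"
  have q: "q > 1" using \<alpha> powr_less_mono[of 0 \<alpha> 4] by (auto simp: q_def)
  obtain i where i: "x < 2 ^ i" using real_arch_pow[of 2 x] by auto
  have bnd: "j < i" if "2 ^ j \<le> x" for j
  proof -
    have "(2::real) ^ j < 2 ^ i" using that i by linarith
    thus ?thesis by simp
  qed
  hence fin: "finite {j. 2 ^ j \<le> x}" by (intro finite_subset[OF _ finite_lessThan[of i]]) auto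
  define m where "m = Max {j. 2 ^ j \<le> x}"
  have ne: "{j. 2 ^ j \<le> x} \<noteq> {}" using x by (auto intro: exI[of _ 0])
  have m: "2 ^ m \<le> x" using Max_in[OF fin ne] by (simp add: m_def)
  have mle: "j \<le> m" if "2 ^ j \<le> x" for j unfolding m_def using fin that by (intro Max_ge) auto
  have qm: "q ^ m \<le> x powr (2 * \<alpha>)"
  proof -
    have "(4::real) powr \<alpha> = 2 powr (2 * \<alpha>)" using powr_powr[of 2 2 "\<alpha>"] by simp
    hence "q ^ m = (2 ^ m) powr (2 * \<alpha>)"
      by (simp add: q_def powr_power powr_realpow[symmetric] powr_powr mult.commute)
    also have "\<dots> \<le> x powr (2 * \<alpha>)" using m \<alpha> by (intro powr_mono2) auto
    finally show ?thesis .
  qed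
  have "(\<Sum>j\<le>J. if x < 2 ^ j then 0 else q ^ j) = (\<Sum>j\<le>J. if 2 ^ j \<le> x then q ^ j else 0)"
    by (intro sum.cong refl) auto
  also have "\<dots> = sum ((^) q) {j. j \<le> J \<and> 2 ^ j \<le> x}"
    by (rule sum.inter_filter[symmetric, of "{..J}", simplified])
  also have "\<dots> \<le> sum ((^) q) {0..m}"
    using q mle by (intro sum_mono2) auto
  also have "\<dots> = (q ^ Suc m - 1) / (q - 1)"
    using q sum_gp_multiplied[of 0 m q] by (simp add: eq_divide_eq algebra_simps)
  also have "\<dots> \<le> (x powr (2 * \<alpha>) * q) / (q - 1)"
  proof (rule divide_right_mono)
    have "q ^ m * q \<le> x powr (2 * \<alpha>) * q" using q by (intro mult_right_mono qm) auto
    thus "q ^ Suc m - 1 \<le> x powr (2 * \<alpha>) * q" by (simp add: mult.commute)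
  qed (use q in auto)
  finally show ?thesis unfolding q_def by simp
qed

text \<open>
  Up to constants, the weights \<open>V\<^sub>E\<close> of the weighted estimate divided by the norms of the zonal harmonics: by
  interpolation, the integral of \<open>(1 + N \<varpi>)\<^sup>2\<^sup>\<alpha> \<bar>Z\<bar>\<^sup>2\<close> is controlled by these. For
  \<open>\<surd>\<lambda>\<close> of size \<open>N\<close> both summands have the same order of magnitude.
\<close>

definition spectral_weight :: "real \<Rightarrow> nat \<Rightarrow> nat \<Rightarrow> nat \<Rightarrow> real" where
  "spectral_weight \<alpha> N l l' = (real (min l l') + 1) powr (2 * \<alpha>)
     + (real N)\<^sup>2 * polar_spread l l' * (real (min l l') + 1) powr (2 * \<alpha> - 2)"

lemma zonal_norm2_nonneg: "CARD('n::finite) \<ge> 2 \<Longrightarrow> zonal_norm2 TYPE('n) l l' \<ge> 0"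
  unfolding zonal_norm2_def using sphere_mass_pos[where 'n='n] by (auto intro!: divide_nonneg_pos)

lemma polar_spread_nonneg: "polar_spread l l' \<ge> 0"
  by (simp add: polar_spread_def)

lemma spectral_weight_nonneg: "spectral_weight \<alpha> N l l' \<ge> 0"
  by (simp add: spectral_weight_def polar_spread_nonneg)

lemma Suc_power2_le_4_power: "1 + (real N)\<^sup>2 \<le> 4 ^ N"
proof -
  have "real N + 1 \<le> 2 ^ N"
    using less_exp[of N] by (metis Suc_leI of_nat_Suc of_nat_le_iff of_nat_numeral of_nat_power add.commute)
  hence "(real N + 1)\<^sup>2 \<le> (2 ^ N)\<^sup>2" by (intro power_mono) auto
  also have "((2::real) ^ N)\<^sup>2 = 4 ^ N" by (simp add: power_mult[symmetric] mult.commute[of N] power_mult)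
  finally show ?thesis by (simp add: power2_eq_square algebra_simps)
qed

lemma varpi_le_1: "norm z = 1 \<Longrightarrow> norm w = 1 \<Longrightarrow> (varpi z w)\<^sup>2 \<le> 1"
  by (simp add: varpi_squared)

text \<open>
  Split the sum into the part with \<open>a + 1 < 2\<^sup>j\<close>, where the full weight is affordable, and the rest, where the
  weight is replaced by its bound \<open>4\<^sup>j\<close>.
\<close>

lemma truncated_weight_integral_bound:
  fixes z :: "complex ^ 'n::finite" and c :: "nat \<times> nat \<Rightarrow> complex"
  assumes n: "CARD('n) \<ge> 2" and z: "norm z = 1" and F: "finite F"
  defines "h \<equiv> (\<lambda>E. zonal_norm2 TYPE('n) (fst E) (snd E))"
  shows "(LINT w|surface_measure. min (1 + (real N)\<^sup>2 * (varpi z w)\<^sup>2) (4 ^ j) *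
            (cmod (\<Sum>E\<in>F. c E * zonal_poly (fst E) (snd E) z w))\<^sup>2)
     \<le> 2 * (\<Sum>E\<in>F. (cmod (c E))\<^sup>2 * h E *
         (if real (min (fst E) (snd E)) + 1 < 2 ^ j
          then 1 + 2 * (real CARD('n) + 1) * ((real N)\<^sup>2 * polar_spread (fst E) (snd E)) else 4 ^ j))"
proof -
  define T where "T w = 1 + (real N)\<^sup>2 * (varpi z w)\<^sup>2" for w
  define f where "f G w = (\<Sum>E\<in>G. c E * zonal_poly (fst E) (snd E) z w)" for G w
  define D where "D E = polar_spread (fst E) (snd E)" for E :: "nat \<times> nat"
  define K where "K = 2 * (real CARD('n) + 1)"
  define G H where "G = {E \<in> F. real (min (fst E) (snd E)) + 1 < 2 ^ j}"
    and "H = {E \<in> F. \<not> real (min (fst E) (snd E)) + 1 < 2 ^ j}"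
  have GH: "F = G \<union> H" "G \<inter> H = {}" "finite G" "finite H" using F by (auto simp: G_def H_def)
  have cf: "continuous_on S (f G)" for S G unfolding f_def by (intro continuous_intros)
  have cT: "continuous_on S T" for S unfolding T_def by (intro continuous_intros)
  have T1: "1 \<le> T w" for w by (simp add: T_def)
  have fsplit: "f F w = f G w + f H w" for w
    unfolding f_def by (subst GH(1)) (rule sum.union_disjoint[OF GH(3,4,2)])
  have n2: "(LINT w|surface_measure. (cmod (f A w))\<^sup>2) = (\<Sum>E\<in>A. (cmod (c E))\<^sup>2 * h E)" if "finite A" for A
    unfolding f_def h_def by (rule integral_norm_zonal_sum[OF n z that])
  have nT: "(LINT w|surface_measure. T w * (cmod (f A w))\<^sup>2)
      \<le> (\<Sum>E\<in>A. (cmod (c E))\<^sup>2 * h E * (1 + K * ((real N)\<^sup>2 * D E)))" if A: "finite A" for A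
  proof -
    have "(LINT w|surface_measure. T w * (cmod (f A w))\<^sup>2)
       = (LINT w|surface_measure. (cmod (f A w))\<^sup>2 + (real N)\<^sup>2 * ((varpi z w)\<^sup>2 * (cmod (f A w))\<^sup>2))"
      by (simp add: T_def algebra_simps)
    also have "\<dots> = (LINT w|surface_measure. (cmod (f A w))\<^sup>2) + (real N)\<^sup>2 * (LINT w|surface_measure. (varpi z w)\<^sup>2 * (cmod (f A w))\<^sup>2)"
      by (subst Bochner_Integration.integral_add) ((intro integrable_surface_measure continuous_intros cf)+, simp)
    also have "\<dots> \<le> (\<Sum>E\<in>A. (cmod (c E))\<^sup>2 * h E) + (real N)\<^sup>2 * (K * (\<Sum>E\<in>A. (cmod (c E))\<^sup>2 * (D E * h E)))"
      unfolding n2[OF A] unfolding f_def K_def D_def h_def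
      by (intro add_left_mono mult_left_mono varpi_integral_zonal_sum_bound[OF n z A]) auto
    also have "\<dots> = (\<Sum>E\<in>A. (cmod (c E))\<^sup>2 * h E * (1 + K * ((real N)\<^sup>2 * D E)))"
      by (simp add: sum_distrib_left sum.distrib[symmetric] algebra_simps)
    finally show ?thesis .
  qed
  have "(LINT w|surface_measure. min (T w) (4 ^ j) * (cmod (f F w))\<^sup>2)
      \<le> (LINT w|surface_measure. 2 * (T w * (cmod (f G w))\<^sup>2) + (2 * 4 ^ j) * (cmod (f H w))\<^sup>2)"
  proof (rule integral_mono)
    fix w
    have "(cmod (f F w))\<^sup>2 \<le> 2 * (cmod (f G w))\<^sup>2 + 2 * (cmod (f H w))\<^sup>2"
      unfolding fsplit by (rule norm_add_power2_le)
    hence "min (T w) (4 ^ j) * (cmod (f F w))\<^sup>2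
        \<le> min (T w) (4 ^ j) * (2 * (cmod (f G w))\<^sup>2 + 2 * (cmod (f H w))\<^sup>2)"
      using T1[of w] by (intro mult_left_mono) auto
    also have "\<dots> = min (T w) (4 ^ j) * (2 * (cmod (f G w))\<^sup>2) + min (T w) (4 ^ j) * (2 * (cmod (f H w))\<^sup>2)"
      by (rule distrib_left)
    also have "\<dots> \<le> T w * (2 * (cmod (f G w))\<^sup>2) + 4 ^ j * (2 * (cmod (f H w))\<^sup>2)"
      by (intro add_mono mult_right_mono) auto
    finally show "min (T w) (4 ^ j) * (cmod (f F w))\<^sup>2 \<le> 2 * (T w * (cmod (f G w))\<^sup>2) + (2 * 4 ^ j) * (cmod (f H w))\<^sup>2"
      by simp
  qed (intro integrable_surface_measure continuous_intros cf cT)+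
  also have "\<dots> = 2 * (LINT w|surface_measure. T w * (cmod (f G w))\<^sup>2) + (2 * 4 ^ j) * (LINT w|surface_measure. (cmod (f H w))\<^sup>2)"
    by (subst Bochner_Integration.integral_add) ((intro integrable_surface_measure continuous_intros cf cT)+, simp)
  also have "\<dots> \<le> 2 * (\<Sum>E\<in>G. (cmod (c E))\<^sup>2 * h E * (1 + K * ((real N)\<^sup>2 * D E)))
      + 2 * (\<Sum>E\<in>H. (cmod (c E))\<^sup>2 * h E * 4 ^ j)"
    unfolding n2[OF GH(4)] sum_distrib_right[symmetric] using nT[OF GH(3)] by simp
  also have "\<dots> = 2 * (\<Sum>E\<in>F. (cmod (c E))\<^sup>2 * h E * (if real (min (fst E) (snd E)) + 1 < 2 ^ j then 1 + K * ((real N)\<^sup>2 * D E) else 4 ^ j))"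
    (is "_ = 2 * sum ?g F")
  proof -
    have "sum ?g F = sum ?g G + sum ?g H"
      by (subst GH(1)) (rule sum.union_disjoint[OF GH(3,4,2)])
    also have "sum ?g G = (\<Sum>E\<in>G. (cmod (c E))\<^sup>2 * h E * (1 + K * ((real N)\<^sup>2 * D E)))"
      by (intro sum.cong refl) (simp add: G_def)
    also have "sum ?g H = (\<Sum>E\<in>H. (cmod (c E))\<^sup>2 * h E * 4 ^ j)"
      by (intro sum.cong refl) (simp add: H_def)
    finally show ?thesis by simp
  qed
  finally show ?thesis unfolding T_def f_def K_def D_def .
qed

text \<open>
  Up to a constant the weight is \<open>T\<^sup>\<alpha>\<close> with \<open>T = 1 + N\<^sup>2 \<varpi>\<^sup>2\<close>. Write it as a dyadic sum of truncations,
  apply the previous lemma to each of them, and interchange the summations over \<open>j\<close> and over the bidegrees; for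
  each bidegree the sum over \<open>j\<close> consists of two geometric series.
\<close>

lemma weighted_Plancherel:
  assumes n: "CARD('n::finite) \<ge> 2" and \<alpha>: "0 < \<alpha>" "\<alpha> < 1 / 2"
  shows "\<exists>K>0. \<forall>(z :: complex ^ 'n) N F (c :: nat \<times> nat \<Rightarrow> complex). norm z = 1 \<longrightarrow> finite F \<longrightarrow>
     (LINT w|surface_measure. (1 + real N * varpi z w) powr (2 * \<alpha>) * (cmod (\<Sum>E\<in>F. c E * zonal_poly (fst E) (snd E) z w))\<^sup>2)
     \<le> K * (\<Sum>E\<in>F. (cmod (c E))\<^sup>2 * (zonal_norm2 TYPE('n) (fst E) (snd E) * spectral_weight \<alpha> N (fst E) (snd E)))"
proof -
  define q \<rho> :: real where "q = 4 powr (\<alpha> - 1)" and "\<rho> = 4 powr \<alpha>"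
  have q: "q > 0" "q < 1" using \<alpha> powr_less_mono[of "\<alpha> - 1" 0 4] by (auto simp: q_def)
  have \<rho>: "\<rho> > 1" using \<alpha> powr_less_mono[of 0 \<alpha> 4] by (auto simp: \<rho>_def)
  have q\<rho>: "q * 4 = \<rho>" by (simp add: q_def \<rho>_def powr_diff)
  define K0 where "K0 = 2 * (real CARD('n) + 1)"
  have K0: "K0 \<ge> 1" by (simp add: K0_def)
  define A B where "A = 1 / (1 - q)" and "B = \<rho> / (\<rho> - 1)"
  have AB: "A > 0" "B > 0" using q \<rho> by (auto simp: A_def B_def)
  define K where "K = 16 * (K0 * (A + B))"
  have "(LINT w|surface_measure. (1 + real N * varpi z w) powr (2 * \<alpha>) * (cmod (\<Sum>E\<in>F. c E * zonal_poly (fst E) (snd E) z w))\<^sup>2)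
     \<le> K * (\<Sum>E\<in>F. (cmod (c E))\<^sup>2 * (zonal_norm2 TYPE('n) (fst E) (snd E) * spectral_weight \<alpha> N (fst E) (snd E)))"
    if z: "norm z = 1" and F: "finite F" for z :: "complex ^ 'n" and N F and c :: "nat \<times> nat \<Rightarrow> complex"
  proof -
    define T where "T w = 1 + (real N)\<^sup>2 * (varpi z w)\<^sup>2" for w
    define f where "f w = (\<Sum>E\<in>F. c E * zonal_poly (fst E) (snd E) z w)" for w
    define h where "h E = zonal_norm2 TYPE('n) (fst E) (snd E)" for E :: "nat \<times> nat"
    define D where "D E = polar_spread (fst E) (snd E)" for E :: "nat \<times> nat"
    define x where "x E = real (min (fst E) (snd E)) + 1" for E :: "nat \<times> nat"
    have x1: "x E \<ge> 1" for E by (simp add: x_def)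
    have cf: "continuous_on S f" for S unfolding f_def by (intro continuous_intros)
    have cT: "continuous_on S T" for S unfolding T_def by (intro continuous_intros)
    have pw: "(1 + real N * varpi z w) powr (2 * \<alpha>) \<le> 8 * (\<Sum>j\<le>N. q ^ j * min (T w) (4 ^ j))"
      if w: "norm w = 1" for w
    proof -
      define v where "v = real N * varpi z w"
      have v: "v \<ge> 0" using varpi_nonneg[OF z w] by (simp add: v_def)
      have Tv: "T w = 1 + v\<^sup>2" by (simp add: T_def v_def power_mult_distrib)
      have "(1 + v) powr (2 * \<alpha>) = ((1 + v)\<^sup>2) powr \<alpha>"
        using v by (simp add: powr_powr[symmetric] powr_numeral)
      also have "\<dots> \<le> (2 * T w) powr \<alpha>"
      proof (intro powr_mono2)
        show "(1 + v)\<^sup>2 \<le> 2 * T w"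
          using zero_le_power2[of "1 - v"] by (simp add: Tv power2_eq_square algebra_simps)
      qed (use \<alpha> in auto)
      also have "\<dots> = 2 powr \<alpha> * T w powr \<alpha>" by (rule powr_mult)
      also have "\<dots> \<le> 2 * T w powr \<alpha>"
        using \<alpha> powr_mono[of \<alpha> 1 2] by (intro mult_right_mono) auto
      also have "T w powr \<alpha> \<le> 4 * (\<Sum>j\<le>N. q ^ j * min (T w) (4 ^ j))"
        unfolding q_def
      proof (rule powr_le_dyadic_sum)
        show "1 \<le> T w" by (simp add: T_def)
        have "T w \<le> 1 + (real N)\<^sup>2"
          using varpi_le_1[OF z w] mult_left_mono[of "(varpi z w)\<^sup>2" 1 "(real N)\<^sup>2"] by (simp add: T_def)
        thus "T w \<le> 4 ^ N" using Suc_power2_le_4_power[of N] by linarith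
      qed (use \<alpha> in auto)
      finally show ?thesis by (simp add: v_def)
    qed
    have "(LINT w|surface_measure. (1 + real N * varpi z w) powr (2 * \<alpha>) * (cmod (f w))\<^sup>2)
       \<le> (LINT w|surface_measure. (\<Sum>j\<le>N. (8 * q ^ j) * (min (T w) (4 ^ j) * (cmod (f w))\<^sup>2)))"
    proof (rule integral_mono)
      fix w assume "w \<in> space (surface_measure :: (complex ^ 'n) measure)"
      hence w: "norm w = 1" by simp
      have "(1 + real N * varpi z w) powr (2 * \<alpha>) * (cmod (f w))\<^sup>2 \<le> 8 * (\<Sum>j\<le>N. q ^ j * min (T w) (4 ^ j)) * (cmod (f w))\<^sup>2"
        by (intro mult_right_mono pw w) auto
      thus "(1 + real N * varpi z w) powr (2 * \<alpha>) * (cmod (f w))\<^sup>2 \<le> (\<Sum>j\<le>N. (8 * q ^ j) * (min (T w) (4 ^ j) * (cmod (f w))\<^sup>2))"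
        by (simp add: sum_distrib_left sum_distrib_right mult_ac)
    next
      show "integrable surface_measure (\<lambda>w. (1 + real N * varpi z w) powr (2 * \<alpha>) * (cmod (f w))\<^sup>2)"
        by (intro integrable_surface_measure continuous_on_weight[OF z] continuous_intros cf)
    qed (intro integrable_surface_measure continuous_intros cf cT)
    also have "\<dots> = (\<Sum>j\<le>N. (8 * q ^ j) * (LINT w|surface_measure. min (T w) (4 ^ j) * (cmod (f w))\<^sup>2))"
      by (subst Bochner_Integration.integral_sum) (intro integrable_surface_measure continuous_intros cf cT, simp)
    also have "\<dots> \<le> (\<Sum>j\<le>N. (8 * q ^ j) * (2 * (\<Sum>E\<in>F. (cmod (c E))\<^sup>2 * h E * (if x E < 2 ^ j then 1 + K0 * ((real N)\<^sup>2 * D E) else 4 ^ j))))"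
      unfolding f_def T_def h_def x_def K0_def D_def using q
      by (intro sum_mono mult_left_mono truncated_weight_integral_bound[OF n z F]) auto
    also have "\<dots> = 16 * (\<Sum>j\<le>N. \<Sum>E\<in>F. (cmod (c E))\<^sup>2 * h E * ((1 + K0 * ((real N)\<^sup>2 * D E)) * (if x E < 2 ^ j then q ^ j else 0) + (if x E < 2 ^ j then 0 else \<rho> ^ j)))"
    proof -
      have "(8 * q ^ j) * (2 * ((cmod (c E))\<^sup>2 * h E * (if x E < 2 ^ j then 1 + K0 * ((real N)\<^sup>2 * D E) else 4 ^ j)))
        = 16 * ((cmod (c E))\<^sup>2 * h E * ((1 + K0 * ((real N)\<^sup>2 * D E)) * (if x E < 2 ^ j then q ^ j else 0) + (if x E < 2 ^ j then 0 else \<rho> ^ j)))" for j E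
        unfolding q\<rho>[symmetric] by (simp add: power_mult_distrib)
      thus ?thesis by (simp only: sum_distrib_left)
    qed
    also have "\<dots> = 16 * (\<Sum>E\<in>F. (cmod (c E))\<^sup>2 * h E * ((1 + K0 * ((real N)\<^sup>2 * D E)) * (\<Sum>j\<le>N. if x E < 2 ^ j then q ^ j else 0) + (\<Sum>j\<le>N. if x E < 2 ^ j then 0 else \<rho> ^ j)))"
      by (subst sum.swap) (simp only: sum_distrib_left[symmetric] sum.distrib)
    also have "\<dots> \<le> 16 * (\<Sum>E\<in>F. (cmod (c E))\<^sup>2 * h E * (K0 * (A + B) * spectral_weight \<alpha> N (fst E) (snd E)))"
    proof (rule mult_left_mono[OF sum_mono])
      fix E
      have D0: "D E \<ge> 0" unfolding D_def by (rule polar_spread_nonneg)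
      define X Y where "X = x E powr (2 * \<alpha>)" and "Y = (real N)\<^sup>2 * D E * x E powr (2 * \<alpha> - 2)"
      have XY: "X \<ge> 0" "Y \<ge> 0" using D0 by (auto simp: X_def Y_def)
      have le: "x E powr (2 * \<alpha> - 2) \<le> X" unfolding X_def using x1 by (intro powr_mono) auto
      have "(1 + K0 * ((real N)\<^sup>2 * D E)) * (\<Sum>j\<le>N. if x E < 2 ^ j then q ^ j else 0)
          \<le> (1 + K0 * ((real N)\<^sup>2 * D E)) * (x E powr (2 * \<alpha> - 2) / (1 - q))"
        unfolding q_def using D0 K0 \<alpha> x1 by (intro mult_left_mono dyadic_sum_above) auto
      also have "\<dots> = (x E powr (2 * \<alpha> - 2) + K0 * Y) * A"
        by (simp add: A_def Y_def algebra_simps add_divide_distrib)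
      also have "\<dots> \<le> (K0 * X + K0 * Y) * A"
      proof (intro mult_right_mono add_right_mono)
        have "1 * X \<le> K0 * X" using K0 XY by (intro mult_right_mono) auto
        thus "x E powr (2 * \<alpha> - 2) \<le> K0 * X" using le by linarith
      qed (use AB in auto)
      finally have 1: "(1 + K0 * ((real N)\<^sup>2 * D E)) * (\<Sum>j\<le>N. if x E < 2 ^ j then q ^ j else 0) \<le> (K0 * X + K0 * Y) * A" .
      have "(\<Sum>j\<le>N. if x E < 2 ^ j then 0 else \<rho> ^ j) \<le> X * B"
        unfolding \<rho>_def X_def B_def using x1 \<alpha> by (intro dyadic_sum_below) auto
      also have "X * B \<le> (K0 * X + K0 * Y) * B"
      proof (intro mult_right_mono)
        have "1 * X \<le> K0 * X" using K0 XY by (intro mult_right_mono) auto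
        moreover have "0 \<le> K0 * Y" using K0 XY by auto
        ultimately show "X \<le> K0 * X + K0 * Y" by linarith
      qed (use AB in auto)
      finally have "(1 + K0 * ((real N)\<^sup>2 * D E)) * (\<Sum>j\<le>N. if x E < 2 ^ j then q ^ j else 0) + (\<Sum>j\<le>N. if x E < 2 ^ j then 0 else \<rho> ^ j)
         \<le> K0 * (A + B) * (X + Y)"
        using 1 by (simp add: algebra_simps)
      moreover have "X + Y = spectral_weight \<alpha> N (fst E) (snd E)"
        by (simp add: spectral_weight_def X_def Y_def x_def D_def)
      ultimately show "(cmod (c E))\<^sup>2 * h E * ((1 + K0 * ((real N)\<^sup>2 * D E)) * (\<Sum>j\<le>N. if x E < 2 ^ j then q ^ j else 0) + (\<Sum>j\<le>N. if x E < 2 ^ j then 0 else \<rho> ^ j))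
         \<le> (cmod (c E))\<^sup>2 * h E * (K0 * (A + B) * spectral_weight \<alpha> N (fst E) (snd E))"
        using zonal_norm2_nonneg[OF n] by (intro mult_left_mono) (auto simp: h_def)
    qed auto
    also have "\<dots> = K * (\<Sum>E\<in>F. (cmod (c E))\<^sup>2 * (h E * spectral_weight \<alpha> N (fst E) (snd E)))"
      unfolding K_def sum_distrib_left by (intro sum.cong refl) (simp only: mult_ac)
    finally show ?thesis unfolding f_def h_def .
  qed
  moreover have "K > 0" using K0 AB by (auto simp: K_def intro!: mult_pos_pos add_pos_pos)
  ultimately show ?thesis by blast
qed

section \<open>Counting eigenvalues in windows\<close>

lemma choose_le_power: "real ((a + m) choose a) \<le> (real a + 1) ^ m"
proof (induction m)
  case (Suc m)
  have sym: "(a + k) choose a = (a + k) choose k" for k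
    using binomial_symmetric[of a "a + k"] by simp
  have "Suc m * (Suc (a + m) choose Suc m) = Suc (a + m) * ((a + m) choose m)"
    by (rule Suc_times_binomial)
  hence "real (Suc m) * real ((a + Suc m) choose a) = real (Suc (a + m)) * real ((a + m) choose a)"
    unfolding sym by (simp only: of_nat_mult[symmetric] add_Suc_right)
  also have "\<dots> \<le> (real (Suc m) * (real a + 1)) * (real a + 1) ^ m"
    by (intro mult_mono Suc.IH) (auto simp: algebra_simps)
  finally show ?case by (simp add: mult.assoc del: of_nat_Suc)
qed simp

lemma zonal_norm2_commute: "zonal_norm2 T l l' = zonal_norm2 T l' l"
  by (simp add: zonal_norm2_def mult_ac add_ac)

lemma spectral_weight_commute: "spectral_weight \<alpha> N l l' = spectral_weight \<alpha> N l' l"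
  by (simp add: spectral_weight_def polar_spread_def min.commute max.commute)

lemma eigval_commute: "eigval n l l' = eigval n l' l"
  by (simp add: eigval_def)

lemma eigval_nonneg: "n \<ge> 1 \<Longrightarrow> eigval n l l' \<ge> 0"
  by (simp add: eigval_def)

definition eigval_window :: "nat \<Rightarrow> nat \<Rightarrow> (nat \<times> nat) set" where
  "eigval_window n i = {E. (real i - 1)\<^sup>2 \<le> eigval n (fst E) (snd E) \<and> eigval n (fst E) (snd E) \<le> (real i)\<^sup>2}"

lemma eigval_ge:
  assumes "n \<ge> 2" shows "eigval n l l' \<ge> 4 * real l * real l' + 2 * (real l + real l')"
proof -
  have "1 * (real l + real l') \<le> (real n - 1) * (real l + real l')"
    using assms by (intro mult_right_mono) auto
  thus ?thesis unfolding eigval_def mult.assoc by linarith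
qed

lemma finite_eigval_le:
  assumes "n \<ge> 2" shows "finite {E. eigval n (fst E) (snd E) \<le> x}"
proof (rule finite_subset)
  show "finite ({..nat \<lceil>x\<rceil>} \<times> {..nat \<lceil>x\<rceil>})" by simp
  show "{E. eigval n (fst E) (snd E) \<le> x} \<subseteq> {..nat \<lceil>x\<rceil>} \<times> {..nat \<lceil>x\<rceil>}"
  proof
    fix E assume "E \<in> {E. eigval n (fst E) (snd E) \<le> x}"
    hence "4 * real (fst E) * real (snd E) + (2 * real (fst E) + 2 * real (snd E)) \<le> x"
      using eigval_ge[OF assms, of "fst E" "snd E"] by simp
    moreover have "0 \<le> 4 * real (fst E) * real (snd E)" by simp
    ultimately have "2 * real (fst E) + 2 * real (snd E) \<le> x" by linarith
    moreover have "0 \<le> real (fst E)" "0 \<le> real (snd E)" by simp_all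
    ultimately have "real (fst E) \<le> x \<and> real (snd E) \<le> x" by (intro conjI; linarith)
    moreover have "k \<le> nat \<lceil>x\<rceil>" if "real k \<le> x" for k using that by linarith
    ultimately show "E \<in> {..nat \<lceil>x\<rceil>} \<times> {..nat \<lceil>x\<rceil>}" by (cases E) auto
  qed
qed

lemma finite_eigval_window: "n \<ge> 2 \<Longrightarrow> finite (eigval_window n i)"
  by (rule finite_subset[OF _ finite_eigval_le[of n "(real i)\<^sup>2"]]) (auto simp: eigval_window_def)

lemma eigval_window_product:
  assumes n: "n \<ge> 2" and i: "i \<ge> 1" and E: "(a, b) \<in> eigval_window n i"
  shows "(real a + 1) * (real b + 1) \<le> 2 * (real i)\<^sup>2"
proof -
  define p I where "p = real a * real b" and "I = (real i)\<^sup>2"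
  have "4 * p + 2 * real a + 2 * real b \<le> I"
    using E eigval_ge[OF n, of a b] by (simp add: eigval_window_def p_def I_def mult.assoc)
  moreover have "0 \<le> p" by (simp add: p_def)
  moreover have "1 \<le> I" using i by (simp add: I_def)
  ultimately have "p + real a + real b + 1 \<le> 2 * I" by linarith
  thus ?thesis by (simp add: p_def I_def algebra_simps)
qed

text \<open>
  With \<open>x = a + 1\<close> and \<open>y = b + 1\<close>, the norm is at most a constant times \<open>(x y)\<^bsup>n - 2\<^esup> y\<close>, and \<open>x y \<le> 2 i\<^sup>2\<close>
  in the window. The factor \<open>y\<close> is either combined with \<open>x\<^sup>2\<^sup>\<alpha>\<close> to \<open>x y \<sqdot> x\<^bsup>2\<alpha> - 1\<^esup>\<close> or cancels the
  denominator of the spread.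
\<close>

lemma zonal_norm2_weight_bound:
  assumes n: "CARD('n::finite) \<ge> 2" and i: "1 \<le> i" "i \<le> N" and E: "(a, b) \<in> eigval_window CARD('n) i" and ab: "a \<le> b"
  shows "zonal_norm2 TYPE('n) a b * spectral_weight \<alpha> N a b
     \<le> ((real CARD('n) + 1) / sphere_mass TYPE('n) * 2 ^ CARD('n) * 3) * real N ^ (2 * CARD('n) - 2) * (real a + 1) powr (2 * \<alpha> - 1)"
proof -
  obtain m where m: "CARD('n) = m + 2" using n by (metis add.commute le_Suc_ex)
  define \<mu> where "\<mu> = sphere_mass TYPE('n)"
  have \<mu>: "\<mu> > 0" unfolding \<mu>_def by (rule sphere_mass_pos)
  define x y where "x = real a + 1" and "y = real b + 1"
  have xy: "x \<ge> 1" "y \<ge> 1" "x \<le> y" using ab by (auto simp: x_def y_def)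
  have xyi: "x * y \<le> 2 * (real i)\<^sup>2" unfolding x_def y_def by (rule eigval_window_product[OF n i(1) E])
  have xyN: "x * y \<le> 2 * (real N)\<^sup>2"
  proof -
    have "(real i)\<^sup>2 \<le> (real N)\<^sup>2" using i by (intro power_mono) auto
    thus ?thesis using xyi by linarith
  qed
  have h: "zonal_norm2 TYPE('n) a b \<le> (x * y) ^ m * (((m + 3) * y) / \<mu>)"
  proof -
    have "zonal_norm2 TYPE('n) a b = (real ((a + m) choose a) * real ((b + m) choose b)) * ((real (a + b) + real m + 1) / ((real m + 1) * \<mu>))"
      by (simp add: zonal_norm2_def m \<mu>_def add_ac)
    also have "\<dots> \<le> (x ^ m * y ^ m) * (((m + 3) * y) / \<mu>)"
    proof (intro mult_mono)
      show "real ((a + m) choose a) \<le> x ^ m" "real ((b + m) choose b) \<le> y ^ m"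
        unfolding x_def y_def by (rule choose_le_power)+
      have "(real (a + b) + real m + 1) / ((real m + 1) * \<mu>) \<le> (real (a + b) + real m + 1) / \<mu>"
        using \<mu> by (intro divide_left_mono) (auto intro!: mult_pos_pos)
      also have "\<dots> \<le> ((m + 3) * y) / \<mu>"
      proof (intro divide_right_mono)
        have "real a \<le> real b" "0 \<le> real m * real b" using ab by auto
        moreover have "real (m + 3) * y = real m * real b + real m + 3 * real b + 3" by (simp add: y_def algebra_simps)
        ultimately show "real (a + b) + real m + 1 \<le> real (m + 3) * y" unfolding of_nat_add by linarith
      qed (use \<mu> in auto)
      finally show "(real (a + b) + real m + 1) / ((real m + 1) * \<mu>) \<le> ((m + 3) * y) / \<mu>" .
    qed (use xy \<mu> in auto)
    finally show ?thesis by (simp add: power_mult_distrib)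
  qed
  define X where "X = x powr (2 * \<alpha> - 1)"
  have X: "X \<ge> 0" by (simp add: X_def)
  have x1: "x powr (2 * \<alpha>) = x * X" "x * x powr (2 * \<alpha> - 2) = X"
    using xy by (simp_all add: X_def powr_mult_base)
  have sw: "spectral_weight \<alpha> N a b = x * X + (real N)\<^sup>2 * (X / y)"
    using ab x1 by (simp add: spectral_weight_def polar_spread_def x_def y_def)
  have "zonal_norm2 TYPE('n) a b * spectral_weight \<alpha> N a b \<le> ((x * y) ^ m * (((m + 3) * y) / \<mu>)) * spectral_weight \<alpha> N a b"
    by (intro mult_right_mono h spectral_weight_nonneg)
  also have "\<dots> = (x * y) ^ m * ((real (m + 3) / \<mu>) * ((x * y) * X + (real N)\<^sup>2 * X))"
  proof -
    have "y * (x * X + (real N)\<^sup>2 * (X / y)) = (x * y) * X + (real N)\<^sup>2 * X"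
      using xy by (simp add: distrib_left)
    hence "(x * y) ^ m * ((real (m + 3) / \<mu>) * (y * (x * X + (real N)\<^sup>2 * (X / y))))
        = (x * y) ^ m * ((real (m + 3) / \<mu>) * ((x * y) * X + (real N)\<^sup>2 * X))" by simp
    thus ?thesis unfolding sw by simp
  qed
  also have "\<dots> \<le> (2 * (real N)\<^sup>2) ^ m * ((real (m + 3) / \<mu>) * ((2 * (real N)\<^sup>2) * X + (real N)\<^sup>2 * X))"
  proof -
    define u v where "u = x * y" and "v = 2 * (real N)\<^sup>2"
    have uv: "0 \<le> u" "u \<le> v" "0 \<le> v" using xy xyN by (auto simp: u_def v_def)
    have "u ^ m * ((real (m + 3) / \<mu>) * (u * X + (real N)\<^sup>2 * X))
        \<le> v ^ m * ((real (m + 3) / \<mu>) * (v * X + (real N)\<^sup>2 * X))"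
      using uv X \<mu> by (intro mult_mono power_mono add_mono) auto
    thus ?thesis by (simp only: u_def v_def)
  qed
  also have "\<dots> = (real (m + 3) / \<mu> * 2 ^ m * 3) * ((real N)\<^sup>2) ^ Suc m * X"
  proof -
    have "(2 * v) ^ m * (k * ((2 * v) * X + v * X)) = (k * 2 ^ m * 3) * v ^ Suc m * X" for v k :: real
      by (simp add: power_mult_distrib algebra_simps)
    thus ?thesis .
  qed
  also have "((real N)\<^sup>2) ^ Suc m = real N ^ (2 * CARD('n) - 2)"
    unfolding power_mult[symmetric] by (simp add: m)
  also have "(real (m + 3) / \<mu> * 2 ^ m * 3) * real N ^ (2 * CARD('n) - 2) * X
     \<le> ((real CARD('n) + 1) / \<mu> * 2 ^ CARD('n) * 3) * real N ^ (2 * CARD('n) - 2) * X"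
    using \<mu> X by (intro mult_right_mono mult_mono) (auto simp: m intro!: divide_right_mono)
  finally show ?thesis by (simp add: \<mu>_def X_def x_def)
qed

text \<open>
  For fixed \<open>a\<close> the eigenvalue is an affine function of \<open>b\<close> of slope at least \<open>2 (a + 1)\<close>, and the window has
  length less than \<open>2 i\<close>, so there are at most \<open>1 + i / (a + 1)\<close> values of \<open>b\<close>.
\<close>

lemma card_eigval_window_slice:
  assumes n: "n \<ge> 2" and i: "1 \<le> i" and a: "a < 2 * i"
  defines "B \<equiv> {b. a \<le> b \<and> (a, b) \<in> eigval_window n i}"
  shows "finite B" "real (card B) \<le> 3 * real i / (real a + 1)"
proof -
  have "B \<subseteq> snd ` eigval_window n i" by (force simp: B_def)
  thus fin: "finite B" using finite_eigval_window[OF n] finite_subset finite_imageI by metis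
  have ai: "1 \<le> 2 * real i / (real a + 1)" using a by (simp add: field_simps)
  show "real (card B) \<le> 3 * real i / (real a + 1)"
  proof (cases "B = {}")
    case False
    define b0 where "b0 = Min B"
    have b0: "b0 \<in> B" "\<And>b. b \<in> B \<Longrightarrow> b0 \<le> b" using fin False by (auto simp: b0_def)
    define k where "k = nat \<lfloor>real i / (real a + 1)\<rfloor>"
    have "B \<subseteq> {b0..b0 + k}"
    proof
      fix b assume b: "b \<in> B"
      have le: "b0 \<le> b" using b0 b by auto
      have "eigval n a b - eigval n a b0 \<le> (real i)\<^sup>2 - (real i - 1)\<^sup>2"
        using b b0(1) by (auto simp: B_def eigval_window_def)
      also have "\<dots> \<le> 2 * real i" by (simp add: power2_eq_square algebra_simps)
      finally have 1: "(4 * real a + 2 * (real n - 1)) * (real b - real b0) \<le> 2 * real i"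
        by (simp add: eigval_def algebra_simps)
      have "(2 * (real a + 1)) * (real b - real b0) \<le> (4 * real a + 2 * (real n - 1)) * (real b - real b0)"
        using n le by (intro mult_right_mono) auto
      hence "(real a + 1) * (real b - real b0) \<le> real i" using 1 by linarith
      hence "real (b - b0) \<le> real i / (real a + 1)" using le by (simp add: field_simps of_nat_diff)
      hence "b - b0 \<le> k" unfolding k_def by (simp add: le_nat_floor)
      thus "b \<in> {b0..b0 + k}" using le by auto
    qed
    hence "card B \<le> card {b0..b0 + k}" by (intro card_mono) auto
    hence "real (card B) \<le> real k + 1" by simp
    also have "real k \<le> real i / (real a + 1)" by (simp add: k_def)
    also have "real i / (real a + 1) + 1 \<le> 3 * real i / (real a + 1)"
    proof -
      have "3 * real i / (real a + 1) = real i / (real a + 1) + 2 * real i / (real a + 1)"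
        by (simp add: add_divide_distrib[symmetric])
      thus ?thesis using ai by linarith
    qed
    finally show ?thesis by simp
  qed simp
qed

text \<open>
  Sum the previous two bounds over \<open>a\<close>, using the symmetry in the two entries of the bidegree. The resulting
  series of \<open>(a + 1)\<^bsup>2\<alpha> - 2\<^esup>\<close> converges because \<open>2 \<alpha> - 2 < - 1\<close>.
\<close>

lemma window_sum_bound:
  assumes n: "CARD('n::finite) \<ge> 2" and \<alpha>: "0 < \<alpha>" "\<alpha> < 1 / 2"
  shows "\<exists>L>0. \<forall>N i. 1 \<le> i \<longrightarrow> i \<le> N \<longrightarrow>
     (\<Sum>E\<in>eigval_window CARD('n) i. zonal_norm2 TYPE('n) (fst E) (snd E) * spectral_weight \<alpha> N (fst E) (snd E))
     \<le> L * real N ^ (2 * CARD('n) - 1)"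
proof -
  define C where "C = (real CARD('n) + 1) / sphere_mass TYPE('n) * 2 ^ CARD('n) * 3"
  have C: "C > 0" unfolding C_def using sphere_mass_pos[where 'n='n] by simp
  define s where "s = (\<lambda>a. (real a + 1) powr (2 * \<alpha> - 2))"
  have "summable (\<lambda>a. real a powr (2 * \<alpha> - 2))" using \<alpha> by (subst summable_real_powr_iff) simp
  hence "summable (\<lambda>a. real (Suc a) powr (2 * \<alpha> - 2))" by (subst summable_Suc_iff)
  hence summ: "summable s" by (simp add: s_def add.commute)
  define Z where "Z = suminf s"
  have Z: "Z > 0" unfolding Z_def by (rule suminf_pos[OF summ]) (simp add: s_def)
  define L where "L = 2 * (3 * C * Z)"
  have "(\<Sum>E\<in>eigval_window CARD('n) i. zonal_norm2 TYPE('n) (fst E) (snd E) * spectral_weight \<alpha> N (fst E) (snd E))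
     \<le> L * real N ^ (2 * CARD('n) - 1)" if i: "1 \<le> i" "i \<le> N" for N i
  proof -
    define W where "W = eigval_window CARD('n) i"
    define g where "g E = zonal_norm2 TYPE('n) (fst E) (snd E) * spectral_weight \<alpha> N (fst E) (snd E)" for E
    have fW: "finite W" unfolding W_def by (rule finite_eigval_window[OF n])
    have gpos: "g E \<ge> 0" for E unfolding g_def by (intro mult_nonneg_nonneg zonal_norm2_nonneg[OF n] spectral_weight_nonneg)
    define U where "U = {E \<in> W. fst E \<le> snd E}"
    define B where "B a = {b. a \<le> b \<and> (a, b) \<in> W}" for a
    define P where "P = real N ^ (2 * CARD('n) - 2)"
    have P: "P \<ge> 0" by (simp add: P_def)
    have slice: "finite (B a)" "real (card (B a)) \<le> 3 * real i / (real a + 1)" if "a < 2 * i" for a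
      using card_eigval_window_slice[OF n i(1) that] by (auto simp: B_def W_def)
    have U: "U = Sigma {..<2 * i} B"
    proof (intro set_eqI iffI)
      fix E assume "E \<in> U"
      then obtain a b where E: "E = (a, b)" "(a, b) \<in> W" "a \<le> b" by (cases E) (auto simp: U_def)
      have "(real a + 1) * (real a + 1) \<le> (real a + 1) * (real b + 1)" using E by (intro mult_left_mono) auto
      also have "\<dots> \<le> 2 * (real i)\<^sup>2" using eigval_window_product[OF n i(1)] E by (simp add: W_def)
      also have "\<dots> \<le> (2 * real i)\<^sup>2" by (simp add: power2_eq_square)
      finally have "(real a + 1)\<^sup>2 \<le> (2 * real i)\<^sup>2" by (simp add: power2_eq_square)
      hence "real a + 1 \<le> 2 * real i" by (rule power2_le_imp_le) simp
      hence "a < 2 * i" by linarith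
      thus "E \<in> Sigma {..<2 * i} B" using E by (simp add: B_def)
    qed (auto simp: U_def B_def)
    have "sum g U = (\<Sum>a<2 * i. \<Sum>b\<in>B a. g (a, b))"
      unfolding U by (subst sum.Sigma) (auto simp: slice)
    also have "\<dots> \<le> (\<Sum>a<2 * i. \<Sum>b\<in>B a. C * P * (real a + 1) powr (2 * \<alpha> - 1))"
      unfolding g_def C_def P_def
      by (intro sum_mono, simp only: fst_conv snd_conv, rule zonal_norm2_weight_bound[OF n i]) (auto simp: B_def W_def)
    also have "\<dots> = (\<Sum>a<2 * i. real (card (B a)) * (C * P * (real a + 1) powr (2 * \<alpha> - 1)))" by simp
    also have "\<dots> \<le> (\<Sum>a<2 * i. 3 * real i / (real a + 1) * (C * P * (real a + 1) powr (2 * \<alpha> - 1)))"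
      using slice C P by (intro sum_mono mult_right_mono) auto
    also have "\<dots> = (\<Sum>a<2 * i. (3 * real i * C * P) * s a)"
    proof (intro sum.cong refl)
      fix a :: nat
      have "(real a + 1) powr (2 * \<alpha> - 1) = (real a + 1) * s a"
        unfolding s_def by (subst powr_mult_base) auto
      thus "3 * real i / (real a + 1) * (C * P * (real a + 1) powr (2 * \<alpha> - 1)) = (3 * real i * C * P) * s a"
        by simp
    qed
    also have "\<dots> = (3 * real i * C * P) * (\<Sum>a<2 * i. s a)" by (rule sum_distrib_left[symmetric])
    also have "\<dots> \<le> (3 * real N * C * P) * Z"
      unfolding Z_def using i C P
      by (intro mult_mono sum_le_suminf[OF summ]) (auto simp: s_def sum_nonneg)
    also have "\<dots> = (3 * C * Z) * (real N * P)" by simp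
    also have "real N * P = real N ^ (2 * CARD('n) - 1)"
    proof -
      have "2 * CARD('n) - 1 = Suc (2 * CARD('n) - 2)" using n by simp
      thus ?thesis by (simp add: P_def)
    qed
    finally have sumU: "sum g U \<le> (3 * C * Z) * real N ^ (2 * CARD('n) - 1)" .
    define U' where "U' = {E \<in> W. snd E \<le> fst E}"
    have "sum g U' = sum g U"
    proof (rule sum.reindex_bij_witness[of _ prod.swap prod.swap])
      show "prod.swap E \<in> U" if "E \<in> U'" for E
        using that by (auto simp: U_def U'_def W_def eigval_window_def eigval_commute[of _ "fst E"])
      show "prod.swap E \<in> U'" if "E \<in> U" for E
        using that by (auto simp: U_def U'_def W_def eigval_window_def eigval_commute[of _ "fst E"])
      show "g (prod.swap E) = g E" for E
        by (simp add: g_def zonal_norm2_commute[of _ "snd E"] spectral_weight_commute[of _ _ "snd E"])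
    qed auto
    moreover have "sum g W \<le> sum g U + sum g U'"
    proof -
      have "W = U \<union> U'" by (auto simp: U_def U'_def)
      moreover have "sum g (U \<union> U') = sum g U + sum g U' - sum g (U \<inter> U')"
        by (rule sum_Un) (use fW in \<open>auto simp: U_def U'_def\<close>)
      ultimately have "sum g W = sum g U + sum g U' - sum g (U \<inter> U')" by simp
      thus ?thesis using sum_nonneg[of "U \<inter> U'" g] gpos by simp
    qed
    ultimately show ?thesis using sumU unfolding W_def[symmetric] g_def[symmetric] L_def by linarith
  qed
  moreover have "L > 0" using C Z by (simp add: L_def)
  ultimately show ?thesis by blast
qed

section \<open>The bilinear estimate\<close>

lemma ennreal_sqrt_le:
  assumes le: "x \<le> ennreal (K\<^sup>2) * y" and K: "K > 0"
  shows "ennreal_sqrt x \<le> ennreal K * ennreal_sqrt y"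
proof (cases "y = top")
  case True
  thus ?thesis using K by (simp add: ennreal_sqrt_def ennreal_mult_top)
next
  case False
  then obtain r where r: "y = ennreal r" "r \<ge> 0" by (cases y) auto
  have x: "x \<le> ennreal (K\<^sup>2 * r)" using le r K by (simp add: ennreal_mult)
  then obtain s where s: "x = ennreal s" "s \<ge> 0" by (cases x) (auto simp: top_unique)
  have "s \<le> K\<^sup>2 * r" using x s r K by (simp add: ennreal_le_iff)
  hence "sqrt s \<le> K * sqrt r"
    using K real_sqrt_le_mono[of s "K\<^sup>2 * r"] by (simp add: real_sqrt_mult)
  thus ?thesis using r s K by (simp add: ennreal_sqrt_def ennreal_mult[symmetric] ennreal_le_iff)
qed

definition cell_sup :: "nat \<Rightarrow> (real \<times> real \<Rightarrow> complex) \<Rightarrow> nat \<Rightarrow> nat \<Rightarrow> ennreal" where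
  "cell_sup N m i j = (SUP p \<in> {(real i - 1) / real N .. real i / real N} \<times> {(real j - 1) / real N .. real j / real N}.
     ennreal ((cmod ((\<lambda>(x, y). m (real N * x, real N * y)) p))\<^sup>2))"

text \<open>
  The bidegree \<open>(0, 0)\<close>, with eigenvalue \<open>0\<close>, belongs to the first window; hence the maximum with \<open>1\<close>.
\<close>

definition window_index :: "nat \<Rightarrow> nat \<times> nat \<Rightarrow> nat" where
  "window_index n E = max 1 (nat \<lceil>sqrt (eigval n (fst E) (snd E))\<rceil>)"

lemma window_index_bounds:
  assumes n: "n \<ge> 2" and E: "eigval n (fst E) (snd E) \<le> (real N)\<^sup>2" and N: "N \<ge> 1"
  shows "window_index n E \<in> {1..N}" and "E \<in> eigval_window n (window_index n E)"
    and "sqrt (eigval n (fst E) (snd E)) \<in> {real (window_index n E) - 1 .. real (window_index n E)}"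
proof -
  define s where "s = sqrt (eigval n (fst E) (snd E))"
  have ev: "eigval n (fst E) (snd E) \<ge> 0" using n by (intro eigval_nonneg) simp
  have s0: "s \<ge> 0" and s2: "eigval n (fst E) (snd E) = s\<^sup>2" using ev by (auto simp: s_def)
  have sN: "s \<le> real N" using E unfolding s2 by (rule power2_le_imp_le) simp
  define i where "i = window_index n E"
  have i: "i = max 1 (nat \<lceil>s\<rceil>)" by (simp add: i_def window_index_def s_def)
  have "nat \<lceil>s\<rceil> \<le> N" using sN by (simp add: nat_le_iff ceiling_le_iff)
  thus "window_index n E \<in> {1..N}" using N i i_def by auto
  have i1: "real i - 1 \<le> s"
  proof (cases "nat \<lceil>s\<rceil> \<le> 1")
    case False
    hence "real i = real_of_int \<lceil>s\<rceil>" using i by auto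
    thus ?thesis using ceiling_correct[of s] by linarith
  qed (use i s0 in auto)
  have i2: "s \<le> real i"
  proof -
    have "s \<le> real (nat \<lceil>s\<rceil>)" by (rule real_nat_ceiling_ge)
    also have "\<dots> \<le> real i" by (simp add: i)
    finally show ?thesis .
  qed
  show "sqrt (eigval n (fst E) (snd E)) \<in> {real (window_index n E) - 1 .. real (window_index n E)}"
    using i1 i2 unfolding i_def s_def by simp
  have "(real i - 1)\<^sup>2 \<le> s\<^sup>2" using i1 i by (intro power_mono) auto
  moreover have "s\<^sup>2 \<le> (real i)\<^sup>2" using i2 s0 by (intro power_mono) auto
  ultimately show "E \<in> eigval_window n (window_index n E)"
    unfolding eigval_window_def i_def[symmetric] s2[symmetric] by (simp add: s2)
qed

lemma multiplier_le_cell_sup: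
  assumes n: "n \<ge> 2" and N: "N \<ge> 1"
    and E: "eigval n (fst E) (snd E) \<le> (real N)\<^sup>2" "eigval n (fst E') (snd E') \<le> (real N)\<^sup>2"
  shows "ennreal ((cmod (m (sqrt (eigval n (fst E) (snd E)), sqrt (eigval n (fst E') (snd E')))))\<^sup>2)
    \<le> cell_sup N m (window_index n E) (window_index n E')"
proof -
  define s t where "s = sqrt (eigval n (fst E) (snd E))" and "t = sqrt (eigval n (fst E') (snd E'))"
  have "ennreal ((cmod ((\<lambda>(x, y). m (real N * x, real N * y)) (s / real N, t / real N)))\<^sup>2) \<le> cell_sup N m (window_index n E) (window_index n E')"
    unfolding cell_sup_def
  proof (rule SUP_upper)
    show "(s / real N, t / real N) \<in> {(real (window_index n E) - 1) / real N .. real (window_index n E) / real N}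
        \<times> {(real (window_index n E') - 1) / real N .. real (window_index n E') / real N}"
      using window_index_bounds(3)[OF n E(1) N] window_index_bounds(3)[OF n E(2) N]
      by (auto simp: s_def t_def intro!: divide_right_mono)
  qed
  thus ?thesis using N by (simp add: s_def t_def)
qed

lemma sum_over_windows:
  assumes F: "finite F" and \<iota>: "\<And>E. E \<in> F \<Longrightarrow> \<iota> E \<in> {1..N::nat}"
    and v: "\<And>E. E \<in> F \<Longrightarrow> v E \<ge> 0" and v': "\<And>E. E \<in> F \<Longrightarrow> v' E \<ge> 0"
    and A: "\<And>i. i \<in> {1..N} \<Longrightarrow> (\<Sum>E | E \<in> F \<and> \<iota> E = i. v E) \<le> A"
    and A': "\<And>i. i \<in> {1..N} \<Longrightarrow> (\<Sum>E | E \<in> F \<and> \<iota> E = i. v' E) \<le> A'"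
    and A0: "A \<ge> 0"
  shows "(\<Sum>E\<in>F. \<Sum>E'\<in>F. ennreal (v E * v' E') * S (\<iota> E) (\<iota> E')) \<le> ennreal (A * A') * (\<Sum>i=1..N. \<Sum>j=1..N. S i j)"
proof -
  have img: "\<iota> ` F \<subseteq> {1..N}" using \<iota> by auto
  have "(\<Sum>E\<in>F. \<Sum>E'\<in>F. ennreal (v E * v' E') * S (\<iota> E) (\<iota> E'))
      = (\<Sum>i=1..N. \<Sum>E | E \<in> F \<and> \<iota> E = i. \<Sum>j=1..N. \<Sum>E' | E' \<in> F \<and> \<iota> E' = j. ennreal (v E * v' E') * S (\<iota> E) (\<iota> E'))"
    by (subst sum.group[OF F finite_atLeastAtMost img, symmetric], subst sum.group[OF F finite_atLeastAtMost img, symmetric]) simp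
  also have "\<dots> = (\<Sum>i=1..N. \<Sum>j=1..N. \<Sum>E | E \<in> F \<and> \<iota> E = i. \<Sum>E' | E' \<in> F \<and> \<iota> E' = j. ennreal (v E * v' E') * S i j)"
    by (intro sum.cong refl, subst sum.swap) simp
  also have "\<dots> \<le> (\<Sum>i=1..N. \<Sum>j=1..N. ennreal (A * A') * S i j)"
  proof (intro sum_mono)
    fix i j assume i: "i \<in> {1..N}" and j: "j \<in> {1..N}"
    have "(\<Sum>E | E \<in> F \<and> \<iota> E = i. \<Sum>E' | E' \<in> F \<and> \<iota> E' = j. ennreal (v E * v' E') * S i j)
        = (\<Sum>E | E \<in> F \<and> \<iota> E = i. \<Sum>E' | E' \<in> F \<and> \<iota> E' = j. ennreal (v E * v' E')) * S i j"
      by (simp only: sum_distrib_right)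
    also have "(\<Sum>E | E \<in> F \<and> \<iota> E = i. \<Sum>E' | E' \<in> F \<and> \<iota> E' = j. ennreal (v E * v' E'))
        = ennreal (\<Sum>E | E \<in> F \<and> \<iota> E = i. \<Sum>E' | E' \<in> F \<and> \<iota> E' = j. v E * v' E')"
      using v v' by (subst sum_ennreal[symmetric], force intro!: sum_nonneg, intro sum.cong refl, subst sum_ennreal) auto
    also have "(\<Sum>E | E \<in> F \<and> \<iota> E = i. \<Sum>E' | E' \<in> F \<and> \<iota> E' = j. v E * v' E')
        = (\<Sum>E | E \<in> F \<and> \<iota> E = i. v E) * (\<Sum>E' | E' \<in> F \<and> \<iota> E' = j. v' E')"
      by (simp add: sum_product)
    also have "ennreal \<dots> * S i j \<le> ennreal (A * A') * S i j"
      using A[OF i] A'[OF j] A0 v' by (intro mult_right_mono ennreal_leI mult_mono) (auto intro!: sum_nonneg)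
    finally show "(\<Sum>E | E \<in> F \<and> \<iota> E = i. \<Sum>E' | E' \<in> F \<and> \<iota> E' = j. ennreal (v E * v' E') * S i j) \<le> ennreal (A * A') * S i j" .
  qed
  also have "\<dots> = ennreal (A * A') * (\<Sum>i=1..N. \<Sum>j=1..N. S i j)" by (simp only: sum_distrib_left)
  finally show ?thesis .
qed

lemma bi_kernel_eq:
  fixes z w u :: "complex ^ 'n::finite"
  assumes n: "CARD('n) \<ge> 2" and z: "norm z = 1" and w: "norm w = 1" and u: "norm u = 1"
    and supp: "supp m \<subseteq> {0..real N} \<times> {0..real N}"
  defines "F \<equiv> {E. eigval CARD('n) (fst E) (snd E) \<le> (real N)\<^sup>2}"
  shows "bi_kernel m z w u = (\<Sum>E\<in>F. \<Sum>E'\<in>F.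
     m (sqrt (eigval CARD('n) (fst E) (snd E)), sqrt (eigval CARD('n) (fst E') (snd E')))
       * cnj (zonal_poly (fst E) (snd E) z w) * cnj (zonal_poly (fst E') (snd E') z u))"
proof -
  define M where "M E E' = m (sqrt (eigval CARD('n) (fst E) (snd E)), sqrt (eigval CARD('n) (fst E') (snd E')))" for E E'
  define g where "g E E' = M E E' * cnj (zonal_poly (fst E) (snd E) z w) * cnj (zonal_poly (fst E') (snd E') z u)" for E E'
  have F: "finite F" unfolding F_def by (rule finite_eigval_le[OF n])
  have M0: "M E E' = 0" if "E \<notin> F \<or> E' \<notin> F" for E E'
  proof (rule ccontr)
    assume "M E E' \<noteq> 0"
    hence "(sqrt (eigval CARD('n) (fst E) (snd E)), sqrt (eigval CARD('n) (fst E') (snd E'))) \<in> supp m"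
      unfolding supp_def M_def by (intro subsetD[OF closure_subset]) simp
    hence "sqrt (eigval CARD('n) (fst E) (snd E)) \<le> real N" "sqrt (eigval CARD('n) (fst E') (snd E')) \<le> real N"
      using supp by auto
    hence "E \<in> F" "E' \<in> F" unfolding F_def by (auto dest: sqrt_le_D)
    thus False using that by blast
  qed
  have "bi_kernel m z w u = (\<Sum>\<^sub>\<infinity>(l1, l1', l2, l2')\<in>UNIV. g (l1, l1') (l2, l2'))"
    unfolding bi_kernel_def g_def M_def zonal_eq[OF n z] using w u by simp
  also have "\<dots> = (\<Sum>\<^sub>\<infinity>(l1, l1', l2, l2')\<in>(\<lambda>(E, E'). (fst E, snd E, fst E', snd E')) ` (F \<times> F). g (l1, l1') (l2, l2'))"
  proof (rule infsum_cong_neutral)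
    fix p assume "p \<in> UNIV - (\<lambda>(E, E'). (fst E, snd E, fst E', snd E')) ` (F \<times> F)"
    moreover obtain l1 l1' l2 l2' where p: "p = (l1, l1', l2, l2')" by (cases p)
    ultimately have "(l1, l1') \<notin> F \<or> (l2, l2') \<notin> F" by (force simp: image_iff)
    thus "(case p of (l1, l1', l2, l2') \<Rightarrow> g (l1, l1') (l2, l2')) = 0" by (simp add: p g_def M0)
  qed auto
  also have "\<dots> = (\<Sum>(l1, l1', l2, l2')\<in>(\<lambda>(E, E'). (fst E, snd E, fst E', snd E')) ` (F \<times> F). g (l1, l1') (l2, l2'))"
    using F by (intro infsum_finite) auto
  also have "\<dots> = (\<Sum>(E, E')\<in>F \<times> F. g E E')"
    by (subst sum.reindex) (auto simp: inj_on_def case_prod_unfold intro!: sum.cong)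
  also have "\<dots> = (\<Sum>E\<in>F. \<Sum>E'\<in>F. g E E')" by (rule sum.cartesian_product[symmetric])
  finally show ?thesis unfolding g_def M_def .
qed

lemma nn_integral_surface_measure_le:
  fixes f :: "'a::euclidean_space \<Rightarrow> real"
  assumes "continuous_on (sphere 0 1) f" "\<And>w. norm w = 1 \<Longrightarrow> 0 \<le> f w" "(LINT w|surface_measure. f w) \<le> B"
  shows "(\<integral>\<^sup>+w. ennreal (f w) \<partial>surface_measure) \<le> ennreal B"
proof -
  have "(\<integral>\<^sup>+w. ennreal (f w) \<partial>surface_measure) = ennreal (LINT w|surface_measure. f w)"
    by (intro nn_integral_eq_integral integrable_surface_measure assms(1) AE_I2) (use assms(2) in auto)
  thus ?thesis using assms(3) by (simp add: ennreal_leI)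
qed

text \<open>
  For fixed \<open>u\<close> the double sum is a sum of zonal harmonics in \<open>w\<close> with coefficients depending on \<open>u\<close>, and
  these coefficients are sums of zonal harmonics in \<open>u\<close>; the weighted estimate is applied to both in turn.
\<close>

lemma bilinear_weighted_Plancherel:
  assumes n: "CARD('n::finite) \<ge> 2" and \<alpha>1: "0 < \<alpha>1" "\<alpha>1 < 1 / 2" and \<alpha>2: "0 < \<alpha>2" "\<alpha>2 < 1 / 2"
  shows "\<exists>K>0. \<forall>(z :: complex ^ 'n) N F (M :: nat \<times> nat \<Rightarrow> nat \<times> nat \<Rightarrow> complex). norm z = 1 \<longrightarrow> finite F \<longrightarrow>
     (\<integral>\<^sup>+u. (\<integral>\<^sup>+w. ennreal ((1 + real N * varpi z w) powr (2 * \<alpha>1) * ((1 + real N * varpi z u) powr (2 * \<alpha>2) *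
         (cmod (\<Sum>E\<in>F. \<Sum>E'\<in>F. M E E' * zonal_poly (fst E) (snd E) z w * zonal_poly (fst E') (snd E') z u))\<^sup>2))
       \<partial>surface_measure) \<partial>surface_measure)
     \<le> ennreal (K * (\<Sum>E\<in>F. \<Sum>E'\<in>F. (cmod (M E E'))\<^sup>2 *
          (zonal_norm2 TYPE('n) (fst E) (snd E) * spectral_weight \<alpha>1 N (fst E) (snd E)) *
          (zonal_norm2 TYPE('n) (fst E') (snd E') * spectral_weight \<alpha>2 N (fst E') (snd E'))))"
proof -
  define v where "v \<alpha> N E = zonal_norm2 TYPE('n) (fst E) (snd E) * spectral_weight \<alpha> N (fst E) (snd E)" for \<alpha> N E
  have v0: "v \<alpha> N E \<ge> 0" for \<alpha> N E
    unfolding v_def by (intro mult_nonneg_nonneg zonal_norm2_nonneg[OF n] spectral_weight_nonneg)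
  obtain K1 where K1: "K1 > 0" "\<And>(z :: complex ^ 'n) N F c. norm z = 1 \<Longrightarrow> finite F \<Longrightarrow>
     (LINT w|surface_measure. (1 + real N * varpi z w) powr (2 * \<alpha>1) * (cmod (\<Sum>E\<in>F. c E * zonal_poly (fst E) (snd E) z w))\<^sup>2)
       \<le> K1 * (\<Sum>E\<in>F. (cmod (c E))\<^sup>2 * v \<alpha>1 N E)"
    using weighted_Plancherel[OF n \<alpha>1] unfolding v_def by blast
  obtain K2 where K2: "K2 > 0" "\<And>(z :: complex ^ 'n) N F c. norm z = 1 \<Longrightarrow> finite F \<Longrightarrow>
     (LINT w|surface_measure. (1 + real N * varpi z w) powr (2 * \<alpha>2) * (cmod (\<Sum>E\<in>F. c E * zonal_poly (fst E) (snd E) z w))\<^sup>2)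
       \<le> K2 * (\<Sum>E\<in>F. (cmod (c E))\<^sup>2 * v \<alpha>2 N E)"
    using weighted_Plancherel[OF n \<alpha>2] unfolding v_def by blast
  have "(\<integral>\<^sup>+u. (\<integral>\<^sup>+w. ennreal ((1 + real N * varpi z w) powr (2 * \<alpha>1) * ((1 + real N * varpi z u) powr (2 * \<alpha>2) *
         (cmod (\<Sum>E\<in>F. \<Sum>E'\<in>F. M E E' * zonal_poly (fst E) (snd E) z w * zonal_poly (fst E') (snd E') z u))\<^sup>2))
       \<partial>surface_measure) \<partial>surface_measure)
     \<le> ennreal ((K1 * K2) * (\<Sum>E\<in>F. \<Sum>E'\<in>F. (cmod (M E E'))\<^sup>2 * v \<alpha>1 N E * v \<alpha>2 N E'))"
    if z: "norm z = 1" and F: "finite F"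
    for z :: "complex ^ 'n" and N F and M :: "nat \<times> nat \<Rightarrow> nat \<times> nat \<Rightarrow> complex"
  proof -
    define Z where "Z E w = zonal_poly (fst E) (snd E) z w" for E w
    define a where "a w = (1 + real N * varpi z w) powr (2 * \<alpha>1)" for w
    define b where "b w = (1 + real N * varpi z w) powr (2 * \<alpha>2)" for w
    define c where "c E u = (\<Sum>E'\<in>F. M E E' * Z E' u)" for E u
    have cZ: "continuous_on S (Z E)" for S E unfolding Z_def by (intro continuous_intros)
    have ca: "continuous_on (sphere 0 1) a" and cb: "continuous_on (sphere 0 1) b"
      unfolding a_def b_def by (rule continuous_on_weight[OF z])+
    have cc: "continuous_on S (c E)" for S E unfolding c_def by (intro continuous_intros cZ)
    have ab: "a w \<ge> 0" "b w \<ge> 0" for w by (auto simp: a_def b_def)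
    have split: "(\<Sum>E\<in>F. \<Sum>E'\<in>F. M E E' * Z E w * Z E' u) = (\<Sum>E\<in>F. c E u * Z E w)" for w u
      unfolding c_def sum_distrib_right by (intro sum.cong refl) (simp only: mult_ac)
    have inner: "(\<integral>\<^sup>+w. ennreal (a w * (b u * (cmod (\<Sum>E\<in>F. c E u * Z E w))\<^sup>2)) \<partial>surface_measure)
        \<le> ennreal (\<Sum>E\<in>F. (K1 * v \<alpha>1 N E) * (b u * (cmod (c E u))\<^sup>2))" for u
    proof (rule nn_integral_surface_measure_le)
      show "continuous_on (sphere 0 1) (\<lambda>w. a w * (b u * (cmod (\<Sum>E\<in>F. c E u * Z E w))\<^sup>2))"
        by (intro continuous_intros ca cZ)
      show "0 \<le> a w * (b u * (cmod (\<Sum>E\<in>F. c E u * Z E w))\<^sup>2)" for w using ab by simp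
      have "(LINT w|surface_measure. a w * (b u * (cmod (\<Sum>E\<in>F. c E u * Z E w))\<^sup>2))
          = b u * (LINT w|surface_measure. a w * (cmod (\<Sum>E\<in>F. c E u * Z E w))\<^sup>2)"
        unfolding integral_mult_right_zero[symmetric] by (intro Bochner_Integration.integral_cong refl) (simp only: mult_ac)
      also have "\<dots> \<le> b u * (K1 * (\<Sum>E\<in>F. (cmod (c E u))\<^sup>2 * v \<alpha>1 N E))"
        unfolding a_def Z_def by (intro mult_left_mono K1(2)[OF z F] ab)
      also have "\<dots> = (\<Sum>E\<in>F. (K1 * v \<alpha>1 N E) * (b u * (cmod (c E u))\<^sup>2))"
        unfolding sum_distrib_left by (intro sum.cong refl) (simp only: mult_ac)
      finally show "(LINT w|surface_measure. a w * (b u * (cmod (\<Sum>E\<in>F. c E u * Z E w))\<^sup>2))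
          \<le> (\<Sum>E\<in>F. (K1 * v \<alpha>1 N E) * (b u * (cmod (c E u))\<^sup>2))" .
    qed
    have "(\<integral>\<^sup>+u. (\<integral>\<^sup>+w. ennreal (a w * (b u * (cmod (\<Sum>E\<in>F. \<Sum>E'\<in>F. M E E' * Z E w * Z E' u))\<^sup>2)) \<partial>surface_measure) \<partial>surface_measure)
       \<le> (\<integral>\<^sup>+u. ennreal (\<Sum>E\<in>F. (K1 * v \<alpha>1 N E) * (b u * (cmod (c E u))\<^sup>2)) \<partial>surface_measure)"
      unfolding split by (intro nn_integral_mono inner)
    also have "\<dots> \<le> ennreal ((K1 * K2) * (\<Sum>E\<in>F. \<Sum>E'\<in>F. (cmod (M E E'))\<^sup>2 * v \<alpha>1 N E * v \<alpha>2 N E'))"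
    proof (rule nn_integral_surface_measure_le)
      show "continuous_on (sphere 0 1) (\<lambda>u. \<Sum>E\<in>F. (K1 * v \<alpha>1 N E) * (b u * (cmod (c E u))\<^sup>2))"
        by (intro continuous_intros cb cc)
      show "0 \<le> (\<Sum>E\<in>F. (K1 * v \<alpha>1 N E) * (b u * (cmod (c E u))\<^sup>2))" for u
        using K1(1) v0 ab by (intro sum_nonneg mult_nonneg_nonneg) auto
      have "(LINT u|surface_measure. (\<Sum>E\<in>F. (K1 * v \<alpha>1 N E) * (b u * (cmod (c E u))\<^sup>2)))
          = (\<Sum>E\<in>F. (K1 * v \<alpha>1 N E) * (LINT u|surface_measure. b u * (cmod (c E u))\<^sup>2))"
        by (subst Bochner_Integration.integral_sum) (intro integrable_surface_measure continuous_intros cb cc, simp)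
      also have "\<dots> \<le> (\<Sum>E\<in>F. (K1 * v \<alpha>1 N E) * (K2 * (\<Sum>E'\<in>F. (cmod (M E E'))\<^sup>2 * v \<alpha>2 N E')))"
        using K1(1) v0 unfolding b_def c_def Z_def
        by (intro sum_mono mult_left_mono K2(2)[OF z F]) auto
      also have "\<dots> = (K1 * K2) * (\<Sum>E\<in>F. \<Sum>E'\<in>F. (cmod (M E E'))\<^sup>2 * v \<alpha>1 N E * v \<alpha>2 N E')"
        unfolding sum_distrib_left by (intro sum.cong refl) (simp only: mult_ac)
      finally show "(LINT u|surface_measure. (\<Sum>E\<in>F. (K1 * v \<alpha>1 N E) * (b u * (cmod (c E u))\<^sup>2))) \<le> \<dots>" .
    qed
    finally show ?thesis unfolding a_def b_def Z_def .
  qed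
  moreover have "K1 * K2 > 0" using K1 K2 by simp
  ultimately show ?thesis unfolding v_def by blast
qed

theorem proposition4p6:
  fixes \<alpha>1 \<alpha>2 :: real and Q :: nat
  assumes "CARD('n::finite) \<ge> 2"
    and "Q = 2 * CARD('n)"
    and "0 \<le> \<alpha>1" "\<alpha>1 < 1 / 2"
    and "0 \<le> \<alpha>2" "\<alpha>2 < 1 / 2"
  shows "\<exists>C::real. C > 0 \<and>
    (\<forall>(N::nat) (m :: real \<times> real \<Rightarrow> complex) (z :: complex ^ 'n).
       N \<ge> 1 \<longrightarrow> supp m \<subseteq> {0..real N} \<times> {0..real N} \<longrightarrow> z \<in> sphere 0 1 \<longrightarrow>
       ennreal_sqrt
         (\<integral>\<^sup>+u. (\<integral>\<^sup>+w.
            ennreal ((cmod (bi_kernel m z w u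
                * complex_of_real ((1 + real N * varpi z w) powr \<alpha>1)
                * complex_of_real ((1 + real N * varpi z u) powr \<alpha>2)))\<^sup>2)
            \<partial>surface_measure) \<partial>surface_measure)
       \<le> ennreal (C * real N ^ Q) * grid_norm N N (\<lambda>(x, y). m (real N * x, real N * y)))"
proof -
  \<comment> \<open>The exponents are raised to positive ones, still below \<open>1/2\<close>: the geometric series need this when \<open>\<alpha> = 0\<close>.\<close>
  define \<beta>1 \<beta>2 where "\<beta>1 = (\<alpha>1 + 1 / 2) / 2" and "\<beta>2 = (\<alpha>2 + 1 / 2) / 2"
  have \<beta>1: "0 < \<beta>1" "\<beta>1 < 1 / 2" "\<alpha>1 \<le> \<beta>1" and \<beta>2: "0 < \<beta>2" "\<beta>2 < 1 / 2" "\<alpha>2 \<le> \<beta>2"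
    using assms by (auto simp: \<beta>1_def \<beta>2_def)
  note n = assms(1)
  define v where "v \<alpha> N E = zonal_norm2 TYPE('n) (fst E) (snd E) * spectral_weight \<alpha> N (fst E) (snd E)" for \<alpha> N E
  have v0: "v \<alpha> N E \<ge> 0" for \<alpha> N E
    unfolding v_def by (intro mult_nonneg_nonneg zonal_norm2_nonneg[OF n] spectral_weight_nonneg)
  obtain K where K: "K > 0" "\<And>(z :: complex ^ 'n) N F M. norm z = 1 \<Longrightarrow> finite F \<Longrightarrow>
     (\<integral>\<^sup>+u. (\<integral>\<^sup>+w. ennreal ((1 + real N * varpi z w) powr (2 * \<beta>1) * ((1 + real N * varpi z u) powr (2 * \<beta>2) *
         (cmod (\<Sum>E\<in>F. \<Sum>E'\<in>F. M E E' * zonal_poly (fst E) (snd E) z w * zonal_poly (fst E') (snd E') z u))\<^sup>2))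
       \<partial>surface_measure) \<partial>surface_measure)
     \<le> ennreal (K * (\<Sum>E\<in>F. \<Sum>E'\<in>F. (cmod (M E E'))\<^sup>2 * v \<beta>1 N E * v \<beta>2 N E'))"
    using bilinear_weighted_Plancherel[OF n \<beta>1(1,2) \<beta>2(1,2)] unfolding v_def by blast
  obtain L1 where L1: "L1 > 0" "\<And>N i. 1 \<le> i \<Longrightarrow> i \<le> N \<Longrightarrow> (\<Sum>E\<in>eigval_window CARD('n) i. v \<beta>1 N E) \<le> L1 * real N ^ (2 * CARD('n) - 1)"
    using window_sum_bound[OF n \<beta>1(1,2)] unfolding v_def by blast
  obtain L2 where L2: "L2 > 0" "\<And>N i. 1 \<le> i \<Longrightarrow> i \<le> N \<Longrightarrow> (\<Sum>E\<in>eigval_window CARD('n) i. v \<beta>2 N E) \<le> L2 * real N ^ (2 * CARD('n) - 1)"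
    using window_sum_bound[OF n \<beta>2(1,2)] unfolding v_def by blast
  define C where "C = sqrt (K * (L1 * L2))"
  have C: "C > 0" "C\<^sup>2 = K * (L1 * L2)" using K L1 L2 by (simp_all add: C_def)
  show ?thesis
  proof (intro exI[of _ C] conjI allI impI C(1))
    fix N :: nat and m :: "real \<times> real \<Rightarrow> complex" and z :: "complex ^ 'n"
    assume N: "N \<ge> 1" and supp: "supp m \<subseteq> {0..real N} \<times> {0..real N}" and "z \<in> sphere 0 1"
    hence z: "norm z = 1" by simp
    define F where "F = {E. eigval CARD('n) (fst E) (snd E) \<le> (real N)\<^sup>2}"
    have F: "finite F" unfolding F_def by (rule finite_eigval_le[OF n])
    define \<iota> where "\<iota> = window_index CARD('n)"
    define M where "M E E' = m (sqrt (eigval CARD('n) (fst E) (snd E)), sqrt (eigval CARD('n) (fst E') (snd E')))" for E E'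
    define P where "P = real N ^ (2 * CARD('n) - 1)"
    define I where "I = (\<integral>\<^sup>+u. (\<integral>\<^sup>+w.
            ennreal ((cmod (bi_kernel m z w u
                * complex_of_real ((1 + real N * varpi z w) powr \<alpha>1)
                * complex_of_real ((1 + real N * varpi z u) powr \<alpha>2)))\<^sup>2)
            \<partial>surface_measure) \<partial>surface_measure)"
    have "I \<le> (\<integral>\<^sup>+u. (\<integral>\<^sup>+w. ennreal ((1 + real N * varpi z w) powr (2 * \<beta>1) * ((1 + real N * varpi z u) powr (2 * \<beta>2) *
         (cmod (\<Sum>E\<in>F. \<Sum>E'\<in>F. cnj (M E E') * zonal_poly (fst E) (snd E) z w * zonal_poly (fst E') (snd E') z u))\<^sup>2))
       \<partial>surface_measure) \<partial>surface_measure)"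
      unfolding I_def
    proof (intro nn_integral_mono ennreal_leI)
      fix u w :: "complex ^ 'n"
      assume "u \<in> space surface_measure" "w \<in> space surface_measure"
      hence u: "norm u = 1" and w: "norm w = 1" by auto
      define S where "S = (\<Sum>E\<in>F. \<Sum>E'\<in>F. cnj (M E E') * zonal_poly (fst E) (snd E) z w * zonal_poly (fst E') (snd E') z u)"
      \<comment> \<open>Conjugation removes the conjugates on the zonal harmonics and affects only the multiplier.\<close>
      have "bi_kernel m z w u = cnj S"
        unfolding bi_kernel_eq[OF n z w u supp] S_def F_def M_def by simp
      hence nS: "cmod (bi_kernel m z w u) = cmod S" by simp
      have weight: "((1 + real N * varpi z y) powr \<alpha>)\<^sup>2 \<le> (1 + real N * varpi z y) powr (2 * \<beta>)"
        if y: "norm y = 1" and ab: "\<alpha> \<le> \<beta>" for y \<alpha> \<beta>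
      proof -
        have "1 + real N * varpi z y \<ge> 1" using varpi_nonneg[OF z y] by simp
        hence "((1 + real N * varpi z y) powr \<alpha>)\<^sup>2 = (1 + real N * varpi z y) powr (2 * \<alpha>)"
          by (simp add: powr_power)
        also have "\<dots> \<le> (1 + real N * varpi z y) powr (2 * \<beta>)"
          using ab varpi_nonneg[OF z y] by (intro powr_mono) auto
        finally show ?thesis .
      qed
      have "(cmod (bi_kernel m z w u * complex_of_real ((1 + real N * varpi z w) powr \<alpha>1)
                * complex_of_real ((1 + real N * varpi z u) powr \<alpha>2)))\<^sup>2
          = ((1 + real N * varpi z w) powr \<alpha>1)\<^sup>2 * (((1 + real N * varpi z u) powr \<alpha>2)\<^sup>2 * (cmod S)\<^sup>2)"
        by (simp add: norm_mult nS power_mult_distrib)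
      also have "\<dots> \<le> (1 + real N * varpi z w) powr (2 * \<beta>1) * ((1 + real N * varpi z u) powr (2 * \<beta>2) * (cmod S)\<^sup>2)"
        by (intro mult_mono weight w u \<beta>1(3) \<beta>2(3)) auto
      finally show "(cmod (bi_kernel m z w u * complex_of_real ((1 + real N * varpi z w) powr \<alpha>1)
                * complex_of_real ((1 + real N * varpi z u) powr \<alpha>2)))\<^sup>2
          \<le> (1 + real N * varpi z w) powr (2 * \<beta>1) * ((1 + real N * varpi z u) powr (2 * \<beta>2) *
         (cmod (\<Sum>E\<in>F. \<Sum>E'\<in>F. cnj (M E E') * zonal_poly (fst E) (snd E) z w * zonal_poly (fst E') (snd E') z u))\<^sup>2)"
        unfolding S_def .
    qed
    also have "\<dots> \<le> ennreal (K * (\<Sum>E\<in>F. \<Sum>E'\<in>F. (cmod (M E E'))\<^sup>2 * v \<beta>1 N E * v \<beta>2 N E'))"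
      using K(2)[OF z F, of N "\<lambda>E E'. cnj (M E E')"] by simp
    also have "\<dots> = (\<Sum>E\<in>F. \<Sum>E'\<in>F. ennreal ((K * v \<beta>1 N E) * v \<beta>2 N E') * ennreal ((cmod (M E E'))\<^sup>2))"
    proof -
      have "K * (\<Sum>E\<in>F. \<Sum>E'\<in>F. (cmod (M E E'))\<^sup>2 * v \<beta>1 N E * v \<beta>2 N E')
          = (\<Sum>E\<in>F. \<Sum>E'\<in>F. ((K * v \<beta>1 N E) * v \<beta>2 N E') * (cmod (M E E'))\<^sup>2)"
        unfolding sum_distrib_left by (intro sum.cong refl) (simp only: mult_ac)
      moreover have nn: "0 \<le> ((K * v \<beta>1 N E) * v \<beta>2 N E') * (cmod (M E E'))\<^sup>2" for E E'
        using K(1) v0 by simp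
      ultimately show ?thesis
        using K(1) v0 by (simp add: sum_ennreal[symmetric] sum_nonneg ennreal_mult)
    qed
    also have "\<dots> \<le> (\<Sum>E\<in>F. \<Sum>E'\<in>F. ennreal ((K * v \<beta>1 N E) * v \<beta>2 N E') * cell_sup N m (\<iota> E) (\<iota> E'))"
      unfolding M_def \<iota>_def by (intro sum_mono mult_left_mono multiplier_le_cell_sup[OF n N]) (auto simp: F_def)
    also have "\<dots> \<le> ennreal ((K * (L1 * P)) * (L2 * P)) * (\<Sum>i=1..N. \<Sum>j=1..N. cell_sup N m i j)"
    proof (rule sum_over_windows[OF F])
      show "\<iota> E \<in> {1..N}" if "E \<in> F" for E
        using window_index_bounds(1)[OF n _ N] that by (auto simp: \<iota>_def F_def)
      have part: "(\<Sum>E | E \<in> F \<and> \<iota> E = i. v \<beta> N E) \<le> (\<Sum>E\<in>eigval_window CARD('n) i. v \<beta> N E)" for i \<beta>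
        using window_index_bounds(2)[OF n _ N] v0
        by (intro sum_mono2 finite_eigval_window[OF n]) (auto simp: \<iota>_def F_def)
      show "(\<Sum>E | E \<in> F \<and> \<iota> E = i. K * v \<beta>1 N E) \<le> K * (L1 * P)" if "i \<in> {1..N}" for i
        using part[of \<beta>1 i] L1(2)[of i N] that K(1)
        by (auto simp: sum_distrib_left[symmetric] P_def intro!: mult_left_mono)
      show "(\<Sum>E | E \<in> F \<and> \<iota> E = i. v \<beta>2 N E) \<le> L2 * P" if "i \<in> {1..N}" for i
        using part[of \<beta>2 i] L2(2)[of i N] that by (auto simp: P_def)
    qed (use K L1 v0 in \<open>auto simp: P_def\<close>)
    also have "\<dots> = ennreal ((C * real N ^ Q)\<^sup>2) * (ennreal (1 / (real N * real N)) * (\<Sum>i=1..N. \<Sum>j=1..N. cell_sup N m i j))"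
    proof -
      have "real N ^ Q = real N * P"
      proof -
        have "Q = Suc (2 * CARD('n) - 1)" using assms(2) n by simp
        thus ?thesis unfolding P_def by (simp only: power_Suc)
      qed
      hence "(C * real N ^ Q)\<^sup>2 * (1 / (real N * real N)) = C\<^sup>2 * P\<^sup>2"
        using N by (simp add: power_mult_distrib power2_eq_square)
      also have "\<dots> = (K * (L1 * P)) * (L2 * P)" unfolding C(2) unfolding power2_eq_square by (simp only: mult_ac)
      finally show ?thesis
        by (simp only: mult.assoc[symmetric] ennreal_mult'[symmetric] zero_le_power2)
    qed
    finally have "ennreal_sqrt I \<le> ennreal (C * real N ^ Q) *
        ennreal_sqrt (ennreal (1 / (real N * real N)) * (\<Sum>i=1..N. \<Sum>j=1..N. cell_sup N m i j))"
      by (rule ennreal_sqrt_le) (use C N in simp)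
    thus "ennreal_sqrt
         (\<integral>\<^sup>+u. (\<integral>\<^sup>+w.
            ennreal ((cmod (bi_kernel m z w u
                * complex_of_real ((1 + real N * varpi z w) powr \<alpha>1)
                * complex_of_real ((1 + real N * varpi z u) powr \<alpha>2)))\<^sup>2)
            \<partial>surface_measure) \<partial>surface_measure)
       \<le> ennreal (C * real N ^ Q) * grid_norm N N (\<lambda>(x, y). m (real N * x, real N * y))"
      unfolding I_def grid_norm_def cell_sup_def .
  qed
qed

end
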